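(* Let $(G, N, L)$ be a discrete constrained Lagrangian system, let $g \in G$, and let $\widehat{L}$ be a smooth extension of $L$ to a neighborhood of $N$ in $G$, so that $L = \widehat{L}|_N$. Assume that $G_2 \cap (N \times N)$ is a submanifold of $N \times N$ and that the restricted multiplication $m|_{G_2 \cap (N \times N)} \colon G_2 \cap (N \times N) \to G$ has constant rank in an open neighborhood of $\mathcal{C}^2_{g,N}$. If $(g_1, g_2) \in \mathcal{C}^2_{g,N}$ is a critical point of the discrete constrained action sum $$\mathcal{C}^2_{g,N} \to \mathbb{R}, \qquad (g_1, g_2) \mapsto L(g_1) + L(g_2),$$ then there exist $\Lambda_1 \in \nu^\ast_{g_1} N$ and $\Lambda_2 \in \nu^\ast_{g_2} N$ such that $$\overleftarrow{X}[\widehat{L}](g_1) + \langle \Lambda_1, \overleftarrow{X}(g_1) \rangle = \overrightarrow{X}[\widehat{L}](g_2) + \langle \Lambda_2, \overrightarrow{X}(g_2) \rangle$$ for all sections $X \in \Gamma(AG)$.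
   Context: A Lie groupoid $G \rightrightarrows Q$ has submersions $\alpha, \beta \colon G \to Q$ (source, target), a smooth multiplication $m(g,h) = gh$ defined on $G_2 = \{(g,h) : \beta(g) = \alpha(h)\}$, an identity section $\epsilon \colon Q \to G$ and an inversion $i \colon G \to G$, with $\epsilon(\alpha(g)) g = g = g\,\epsilon(\beta(g))$, $g g^{-1} = \epsilon(\alpha(g))$, $g^{-1} g = \epsilon(\beta(g))$. Translations: $\ell_g \colon \alpha^{-1}(\beta(g)) \to \alpha^{-1}(\alpha(g))$, $\ell_g(h) = gh$, and $r_g \colon \beta^{-1}(\alpha(g)) \to \beta^{-1}(\beta(g))$, $r_g(h) = hg$. The Lie algebroid $AG \to Q$ is the vector bundle with fibers $A_q G = \ker T_{\epsilon(q)} \alpha$. For $v \in A_{\beta(g)} G$ put $\overleftarrow{v}(g) = T_{\epsilon(\beta(g))} \ell_g(v)$, and for $v \in A_{\alpha(g)} G$ put $\overrightarrow{v}(g) = -T_{\epsilon(\alpha(g))}(r_g \circ i)(v)$; for $X \in \Gamma(AG)$ this gives vector fields $\overleftarrow{X}(g) = \overleftarrow{X(\beta(g))}(g)$ and $\overrightarrow{X}(g) = \overrightarrow{X(\alpha(g))}(g)$ on $G$. $X[f]$ denotes the derivative of $f$ along the vector field $X$. A discrete constrained Lagrangian system $(G,N,L)$ consists of a Lie groupoid $G \rightrightarrows Q$, a submanifold $N \subset G$, and a smooth function $L \colon N \to \mathbb{R}$. The conormal space is $\nu^\ast_h N = (T_h N)^0 = \{\Lambda \in T_h^\ast G : \langle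 \Lambda, v \rangle = 0 \text{ for all } v \in T_h N\}$ for $h \in N$. The space of admissible trajectories of length $2$ is $\mathcal{C}^2_{g,N} = \{(g_1, g_2) \in G_2 \cap (N \times N) : g_1 g_2 = g\}$; under the stated hypotheses it is a submanifold of $G_2 \cap (N \times N)$. Its tangent space at $(g_1,g_2)$, the space of admissible variations, is taken to be $$T_{(g_1,g_2)} \mathcal{C}^2_{g,N} = \{ (v_{g_1}, v_{g_2}) \in T_{g_1} N \times T_{g_2} N : T_{g_1}\beta(v_{g_1}) = T_{g_2}\alpha(v_{g_2}),\ T_{(g_1,g_2)} m(v_{g_1}, v_{g_2}) = 0 \},$$ which equals $\{(\overleftarrow{v}(g_1), -\overrightarrow{v}(g_2)) : v \in (A_q G)_{(N,g_1,g_2)}\}$, where $q = \beta(g_1) = \alpha(g_2)$ and $(A_q G)_{(N,g_1,g_2)} = \{ v \in A_q G : \overleftarrow{v}(g_1) \in T_{g_1} N,\ \overrightarrow{v}(g_2) \in T_{g_2} N \}$. A critical point is a trajectory at which the differential of the action sum vanishes on all admissible variations, i.e. $\langle \mathrm{d}L, \overleftarrow{v}(g_1) \rangle - \langle \mathrm{d}L, \overrightarrow{v}(g_2) \rangle = 0$ for all $v \in (A_q G)_{(N,g_1,g_2)}$. *)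

theory Defs
  imports "HOL-Analysis.Analysis" "HOL-Library.Function_Algebras"
begin

section \<open>Functions as a real vector space\<close>

instantiation "fun" :: (type, real_vector) real_vector
begin

definition scaleR_fun :: "real \<Rightarrow> ('a \<Rightarrow> 'b) \<Rightarrow> 'a \<Rightarrow> 'b" where
  "scaleR_fun c f = (\<lambda>x. c *\<^sub>R f x)"

instance
  by standard (simp_all add: scaleR_fun_def fun_eq_iff algebra_simps)

end

section \<open>Smooth manifolds\<close>

primrec Ck_on :: "nat \<Rightarrow> 'e::euclidean_space set \<Rightarrow> ('e \<Rightarrow> 'f::euclidean_space) \<Rightarrow> bool" where
  "Ck_on 0 S = (\<lambda>f. continuous_on S f)"
| "Ck_on (Suc k) S = (\<lambda>f. (\<forall>x\<in>S. f differentiable (at x)) \<and>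
     (\<forall>v. Ck_on k S (\<lambda>x. frechet_derivative f (at x) v)))"

text \<open>Smoothness on an arbitrary subset means local extendability to a smooth function. It is used
  below only for relatively open subsets of linear subspaces, where it agrees with smoothness in
  linear coordinates of the subspace.\<close>

definition smooth_on :: "'e::euclidean_space set \<Rightarrow> ('e \<Rightarrow> 'f::euclidean_space) \<Rightarrow> bool" where
  "smooth_on S f \<longleftrightarrow> (\<forall>x\<in>S. \<exists>W F. open W \<and> x \<in> W \<and> (\<forall>k. Ck_on k W F) \<and> (\<forall>y\<in>W \<inter> S. F y = f y))"

text \<open>The model of an \<open>n\<close>-dimensional manifold is an \<open>n\<close>-dimensional linear subspace of a
  Euclidean type. Types of class \<open>euclidean_space\<close> have positive dimension, so that charts into
  open subsets of the whole type would exclude \<open>0\<close>-dimensional manifolds (for instance the base of a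
  Lie group, viewed as a Lie groupoid). The same convention lets a submanifold keep the model
  type of the ambient manifold.\<close>

type_synonym ('a, 'e) chart = "'a set \<times> ('a \<Rightarrow> 'e)"

definition atlas_carrier :: "('a, 'e) chart set \<Rightarrow> 'a set" where
  "atlas_carrier A = (\<Union>c\<in>A. fst c)"

definition local_chart ::
    "nat \<Rightarrow> 'a::topological_space set \<Rightarrow> ('a, 'e::euclidean_space) chart \<Rightarrow> bool" where
  "local_chart n M = (\<lambda>(U, \<phi>). openin (top_of_set M) U \<and>
     (\<exists>V. subspace V \<and> dim V = n \<and> openin (top_of_set V) (\<phi> ` U)) \<and>
     (\<exists>\<psi>. homeomorphism U (\<phi> ` U) \<phi> \<psi>))"

definition smooth_transition ::
    "('a, 'e::euclidean_space) chart \<Rightarrow> ('a, 'e) chart \<Rightarrow> bool" where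
  "smooth_transition = (\<lambda>(U, \<phi>) (V, \<psi>). smooth_on (\<phi> ` (U \<inter> V)) (\<psi> \<circ> inv_into U \<phi>))"

definition smooth_manifold ::
    "nat \<Rightarrow> ('a::topological_space, 'e::euclidean_space) chart set \<Rightarrow> bool" where
  "smooth_manifold n A \<longleftrightarrow> (\<forall>c\<in>A. local_chart n (atlas_carrier A) c) \<and>
     (\<forall>c\<in>A. \<forall>d\<in>A. smooth_transition c d)"

definition maximal_atlas ::
    "('a::topological_space, 'e::euclidean_space) chart set \<Rightarrow> ('a, 'e) chart set" where
  "maximal_atlas A = {c. (\<exists>n. local_chart n (atlas_carrier A) c) \<and>
     (\<forall>d\<in>A. smooth_transition c d \<and> smooth_transition d c)}"

definition smooth_at ::
    "('a::topological_space, 'e::euclidean_space) chart set \<Rightarrow> ('b, 'f::euclidean_space) chart set \<Rightarrow>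
     ('a \<Rightarrow> 'b) \<Rightarrow> 'a \<Rightarrow> bool" where
  "smooth_at A B f p \<longleftrightarrow> (\<exists>(U, \<phi>)\<in>A. \<exists>(V, \<psi>)\<in>B. \<exists>W. openin (top_of_set (atlas_carrier A)) W \<and>
     p \<in> W \<and> W \<subseteq> U \<and> f ` W \<subseteq> V \<and> smooth_on (\<phi> ` W) (\<psi> \<circ> f \<circ> inv_into U \<phi>))"

definition smooth_map ::
    "('a::topological_space, 'e::euclidean_space) chart set \<Rightarrow> ('b, 'f::euclidean_space) chart set \<Rightarrow>
     ('a \<Rightarrow> 'b) \<Rightarrow> bool" where
  "smooth_map A B f \<longleftrightarrow> (\<forall>p\<in>atlas_carrier A. smooth_at A B f p)"

definition euclidean_atlas :: "('e::euclidean_space, 'e) chart set" where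
  "euclidean_atlas = {(UNIV, id)}"

definition prod_atlas ::
    "('a, 'e) chart set \<Rightarrow> ('b, 'f) chart set \<Rightarrow> ('a \<times> 'b, 'e \<times> 'f) chart set" where
  "prod_atlas A B = {(U \<times> V, map_prod \<phi> \<psi>) | U \<phi> V \<psi>. (U, \<phi>) \<in> A \<and> (V, \<psi>) \<in> B}"

text \<open>For a nonempty chart, \<open>span (\<phi> ` U)\<close> is its model subspace.\<close>

definition slice_chart :: "nat \<Rightarrow> 'a set \<Rightarrow> ('a, 'e::euclidean_space) chart \<Rightarrow> bool" where
  "slice_chart k S = (\<lambda>(U, \<phi>). \<exists>V. subspace V \<and> V \<subseteq> span (\<phi> ` U) \<and> dim V = k \<and>
     \<phi> ` (U \<inter> S) = \<phi> ` U \<inter> V)"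

definition embedded_submanifold ::
    "('a::topological_space, 'e::euclidean_space) chart set \<Rightarrow> 'a set \<Rightarrow> bool" where
  "embedded_submanifold A S \<longleftrightarrow> S \<subseteq> atlas_carrier A \<and>
     (\<exists>k. \<forall>p\<in>S. \<exists>c\<in>maximal_atlas A. p \<in> fst c \<and> slice_chart k S c)"

definition induced_atlas ::
    "('a::topological_space, 'e::euclidean_space) chart set \<Rightarrow> 'a set \<Rightarrow> ('a, 'e) chart set" where
  "induced_atlas A S = {(U \<inter> S, \<phi>) | U \<phi>. (U, \<phi>) \<in> maximal_atlas A \<and> (\<exists>k. slice_chart k S (U, \<phi>))}"

section \<open>Tangent vectors\<close>

text \<open>A tangent vector is the class of a smooth curve, represented by the directional derivative
  that it induces on germs of smooth functions; functions that are not smooth near the base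
  point are sent to \<open>0\<close> by convention. The vector space operations are pointwise.
  The base point is not part of the vector and is always passed separately.\<close>

type_synonym 'a tangent_vector = "('a \<Rightarrow> real) \<Rightarrow> real"

definition velocity ::
    "('a::topological_space, 'e::euclidean_space) chart set \<Rightarrow> (real \<Rightarrow> 'a) \<Rightarrow> 'a tangent_vector" where
  "velocity A c = (\<lambda>f. if smooth_at A euclidean_atlas f (c 0) then deriv (\<lambda>t. f (c t)) 0 else 0)"

definition smooth_curve_in ::
    "('a::topological_space, 'e::euclidean_space) chart set \<Rightarrow> 'a set \<Rightarrow> 'a \<Rightarrow> (real \<Rightarrow> 'a) \<Rightarrow> bool" where
  "smooth_curve_in A S p c \<longleftrightarrow> c 0 = p \<and>
     (\<exists>e>0. \<forall>t\<in>{-e<..<e}. c t \<in> S \<and> smooth_at euclidean_atlas A c t)"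

text \<open>\<open>tangent_space A S p\<close> is the tangent space at \<open>p\<close> of the submanifold \<open>S\<close>, as a subspace of the
  tangent space of the ambient manifold.\<close>

definition tangent_space ::
    "('a::topological_space, 'e::euclidean_space) chart set \<Rightarrow> 'a set \<Rightarrow> 'a \<Rightarrow> 'a tangent_vector set" where
  "tangent_space A S p = velocity A ` {c. smooth_curve_in A S p c}"

definition representing_curve ::
    "('a::topological_space, 'e::euclidean_space) chart set \<Rightarrow> 'a set \<Rightarrow> 'a \<Rightarrow> 'a tangent_vector \<Rightarrow>
     real \<Rightarrow> 'a" where
  "representing_curve A S p v = (SOME c. smooth_curve_in A S p c \<and> velocity A c = v)"

text \<open>The tangent map and the differential of a map defined on the submanifold \<open>S\<close>; the values of the
  map outside \<open>S\<close> play no role.\<close>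

definition tangent_map ::
    "('a::topological_space, 'e::euclidean_space) chart set \<Rightarrow> 'a set \<Rightarrow>
     ('b::topological_space, 'f::euclidean_space) chart set \<Rightarrow> ('a \<Rightarrow> 'b) \<Rightarrow> 'a \<Rightarrow>
     'a tangent_vector \<Rightarrow> 'b tangent_vector" where
  "tangent_map A S B f p v = velocity B (f \<circ> representing_curve A S p v)"

definition differential ::
    "('a::topological_space, 'e::euclidean_space) chart set \<Rightarrow> 'a set \<Rightarrow> ('a \<Rightarrow> real) \<Rightarrow> 'a \<Rightarrow>
     'a tangent_vector \<Rightarrow> real" where
  "differential A S f p v = deriv (\<lambda>t. f (representing_curve A S p v t)) 0"

text \<open>The identification of \<open>T\<^sub>p M \<times> T\<^sub>q M'\<close> with the tangent space of \<open>M \<times> M'\<close> at \<open>(p, q)\<close>.\<close>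

definition pair_tangent ::
    "('a::topological_space, 'e::euclidean_space) chart set \<Rightarrow>
     ('b::topological_space, 'f::euclidean_space) chart set \<Rightarrow> 'a \<Rightarrow> 'b \<Rightarrow>
     'a tangent_vector \<Rightarrow> 'b tangent_vector \<Rightarrow> ('a \<times> 'b) tangent_vector" where
  "pair_tangent A B p q v w =
     tangent_map A (atlas_carrier A) (prod_atlas A B) (\<lambda>x. (x, q)) p v +
     tangent_map B (atlas_carrier B) (prod_atlas A B) (\<lambda>y. (p, y)) q w"

definition submersion ::
    "('a::topological_space, 'e::euclidean_space) chart set \<Rightarrow>
     ('b::topological_space, 'f::euclidean_space) chart set \<Rightarrow> ('a \<Rightarrow> 'b) \<Rightarrow> bool" where
  "submersion A B f \<longleftrightarrow> smooth_map A B f \<and>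
     (\<forall>p\<in>atlas_carrier A. tangent_map A (atlas_carrier A) B f p ` tangent_space A (atlas_carrier A) p =
        tangent_space B (atlas_carrier B) (f p))"

definition constant_rank_near ::
    "('a::topological_space, 'e::euclidean_space) chart set \<Rightarrow> 'a set \<Rightarrow>
     ('b::topological_space, 'f::euclidean_space) chart set \<Rightarrow> ('a \<Rightarrow> 'b) \<Rightarrow> 'a set \<Rightarrow> bool" where
  "constant_rank_near A S B f C \<longleftrightarrow> (\<exists>W r. openin (top_of_set S) W \<and> C \<subseteq> W \<and>
     (\<forall>p\<in>W. dim (tangent_map A S B f p ` tangent_space A S p) = r))"

definition cotangent_space ::
    "('a::topological_space, 'e::euclidean_space) chart set \<Rightarrow> 'a \<Rightarrow> ('a tangent_vector \<Rightarrow> real) set" where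
  "cotangent_space A p = {\<Lambda>.
     (\<forall>v\<in>tangent_space A (atlas_carrier A) p. \<forall>w\<in>tangent_space A (atlas_carrier A) p.
        \<Lambda> (v + w) = \<Lambda> v + \<Lambda> w) \<and>
     (\<forall>a. \<forall>v\<in>tangent_space A (atlas_carrier A) p. \<Lambda> (a *\<^sub>R v) = a * \<Lambda> v)}"

definition conormal_space ::
    "('a::topological_space, 'e::euclidean_space) chart set \<Rightarrow> 'a set \<Rightarrow> 'a \<Rightarrow>
     ('a tangent_vector \<Rightarrow> real) set" where
  "conormal_space A S p = {\<Lambda> \<in> cotangent_space A p. \<forall>v\<in>tangent_space A S p. \<Lambda> v = 0}"

section \<open>Lie groupoids\<close>

text \<open>Arrows \<open>g\<close> and \<open>h\<close> are composable when \<open>target g = source h\<close>; the values of \<open>mul\<close> on other pairs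
  play no role.\<close>

record ('g, 'e, 'q, 'f) groupoid_data =
  arrow_atlas :: "('g, 'e) chart set"
  object_atlas :: "('q, 'f) chart set"
  source :: "'g \<Rightarrow> 'q"
  target :: "'g \<Rightarrow> 'q"
  mul :: "'g \<Rightarrow> 'g \<Rightarrow> 'g"
  identity :: "'q \<Rightarrow> 'g"
  inversion :: "'g \<Rightarrow> 'g"

definition composable :: "('g, 'e, 'q, 'f) groupoid_data \<Rightarrow> ('g \<times> 'g) set" where
  "composable G = {(g, h). target G g = source G h}"

locale lie_groupoid =
  fixes G :: "('g::{t2_space, second_countable_topology}, 'e::euclidean_space,
               'q::{t2_space, second_countable_topology}, 'f::euclidean_space) groupoid_data"
  assumes arrow_manifold: "\<exists>n. smooth_manifold n (arrow_atlas G)"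
    and arrow_carrier: "atlas_carrier (arrow_atlas G) = UNIV"
    and object_manifold: "\<exists>n. smooth_manifold n (object_atlas G)"
    and object_carrier: "atlas_carrier (object_atlas G) = UNIV"
    and source_submersion: "submersion (arrow_atlas G) (object_atlas G) (source G)"
    and target_submersion: "submersion (arrow_atlas G) (object_atlas G) (target G)"
    and source_mul: "target G g = source G h \<Longrightarrow> source G (mul G g h) = source G g"
    and target_mul: "target G g = source G h \<Longrightarrow> target G (mul G g h) = target G h"
    and mul_assoc: "target G g = source G h \<Longrightarrow> target G h = source G k \<Longrightarrow>
          mul G (mul G g h) k = mul G g (mul G h k)"
    and source_identity: "source G (identity G q) = q"
    and target_identity: "target G (identity G q) = q"
    and identity_mul: "mul G (identity G (source G g)) g = g"
    and mul_identity: "mul G g (identity G (target G g)) = g"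
    and source_inversion: "source G (inversion G g) = target G g"
    and target_inversion: "target G (inversion G g) = source G g"
    and mul_inversion: "mul G g (inversion G g) = identity G (source G g)"
    and inversion_mul: "mul G (inversion G g) g = identity G (target G g)"
    and mul_smooth: "smooth_map
          (induced_atlas (prod_atlas (arrow_atlas G) (arrow_atlas G)) (composable G))
          (arrow_atlas G) (\<lambda>(g, h). mul G g h)"
    and composable_submanifold:
          "embedded_submanifold (prod_atlas (arrow_atlas G) (arrow_atlas G)) (composable G)"
    and identity_smooth: "smooth_map (object_atlas G) (arrow_atlas G) (identity G)"
    and inversion_smooth: "smooth_map (arrow_atlas G) (arrow_atlas G) (inversion G)"

definition source_fiber :: "('g, 'e, 'q, 'f) groupoid_data \<Rightarrow> 'q \<Rightarrow> 'g set" where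
  "source_fiber G q = {h. source G h = q}"

definition algebroid_fiber ::
    "('g::topological_space, 'e::euclidean_space, 'q::topological_space, 'f::euclidean_space) groupoid_data \<Rightarrow>
     'q \<Rightarrow> 'g tangent_vector set" where
  "algebroid_fiber G q = {v \<in> tangent_space (arrow_atlas G) UNIV (identity G q).
     tangent_map (arrow_atlas G) UNIV (object_atlas G) (source G) (identity G q) v = 0}"

text \<open>A section is smooth as a map into the tangent bundle of the arrows: its components
  \<open>X q [\<phi>\<^sub>b]\<close> in every chart \<open>\<phi>\<close> depend smoothly on \<open>q\<close>.\<close>

definition algebroid_sections ::
    "('g::topological_space, 'e::euclidean_space, 'q::topological_space, 'f::euclidean_space) groupoid_data \<Rightarrow>
     ('q \<Rightarrow> 'g tangent_vector) set" where
  "algebroid_sections G = {X. (\<forall>q. X q \<in> algebroid_fiber G q) \<and>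
     (\<forall>(U, \<phi>)\<in>arrow_atlas G. \<forall>q. identity G q \<in> U \<longrightarrow>
        smooth_at (object_atlas G) euclidean_atlas
          (\<lambda>q'. \<Sum>b\<in>Basis. X q' (\<lambda>x. \<phi> x \<bullet> b) *\<^sub>R b) q)}"

definition left_vec ::
    "('g::topological_space, 'e::euclidean_space, 'q, 'f) groupoid_data \<Rightarrow>
     'g tangent_vector \<Rightarrow> 'g \<Rightarrow> 'g tangent_vector" where
  "left_vec G v g = tangent_map (arrow_atlas G) (source_fiber G (target G g)) (arrow_atlas G)
     (\<lambda>h. mul G g h) (identity G (target G g)) v"

definition right_vec ::
    "('g::topological_space, 'e::euclidean_space, 'q, 'f) groupoid_data \<Rightarrow>
     'g tangent_vector \<Rightarrow> 'g \<Rightarrow> 'g tangent_vector" where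
  "right_vec G v g = - tangent_map (arrow_atlas G) (source_fiber G (source G g)) (arrow_atlas G)
     (\<lambda>h. mul G (inversion G h) g) (identity G (source G g)) v"

definition left_vf ::
    "('g::topological_space, 'e::euclidean_space, 'q, 'f) groupoid_data \<Rightarrow>
     ('q \<Rightarrow> 'g tangent_vector) \<Rightarrow> 'g \<Rightarrow> 'g tangent_vector" where
  "left_vf G X g = left_vec G (X (target G g)) g"

definition right_vf ::
    "('g::topological_space, 'e::euclidean_space, 'q, 'f) groupoid_data \<Rightarrow>
     ('q \<Rightarrow> 'g tangent_vector) \<Rightarrow> 'g \<Rightarrow> 'g tangent_vector" where
  "right_vf G X g = right_vec G (X (source G g)) g"

section \<open>Discrete constrained Lagrangian systems\<close>

locale discrete_constrained_system = lie_groupoid G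
  for G :: "('g::{t2_space, second_countable_topology}, 'e::euclidean_space,
             'q::{t2_space, second_countable_topology}, 'f::euclidean_space) groupoid_data" +
  fixes N :: "'g set" and L :: "'g \<Rightarrow> real"
  assumes constraint_submanifold: "embedded_submanifold (arrow_atlas G) N"
    and lagrangian_smooth: "smooth_map (induced_atlas (arrow_atlas G) N) euclidean_atlas L"

definition admissible_trajectories ::
    "('g, 'e, 'q, 'f) groupoid_data \<Rightarrow> 'g set \<Rightarrow> 'g \<Rightarrow> ('g \<times> 'g) set" where
  "admissible_trajectories G N g = {(g1, g2) \<in> composable G \<inter> N \<times> N. mul G g1 g2 = g}"

definition admissible_variations ::
    "('g::topological_space, 'e::euclidean_space, 'q::topological_space, 'f::euclidean_space) groupoid_data \<Rightarrow>
     'g set \<Rightarrow> 'g \<Rightarrow> 'g \<Rightarrow> ('g tangent_vector \<times> 'g tangent_vector) set" where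
  "admissible_variations G N g1 g2 =
     {(v1, v2) \<in> tangent_space (arrow_atlas G) N g1 \<times> tangent_space (arrow_atlas G) N g2.
        tangent_map (arrow_atlas G) UNIV (object_atlas G) (target G) g1 v1 =
          tangent_map (arrow_atlas G) UNIV (object_atlas G) (source G) g2 v2 \<and>
        tangent_map (prod_atlas (arrow_atlas G) (arrow_atlas G)) (composable G) (arrow_atlas G)
          (\<lambda>(g, h). mul G g h) (g1, g2)
          (pair_tangent (arrow_atlas G) (arrow_atlas G) g1 g2 v1 v2) = 0}"

definition action_sum :: "('g \<Rightarrow> real) \<Rightarrow> 'g \<times> 'g \<Rightarrow> real" where
  "action_sum L = (\<lambda>(g1, g2). L g1 + L g2)"

text \<open>The differential of the action sum is taken on \<open>N \<times> N\<close>, where the action sum is defined and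
  smooth and to which every admissible variation is tangent.\<close>

definition critical_point ::
    "('g::topological_space, 'e::euclidean_space, 'q::topological_space, 'f::euclidean_space) groupoid_data \<Rightarrow>
     'g set \<Rightarrow> ('g \<Rightarrow> real) \<Rightarrow> 'g \<Rightarrow> 'g \<times> 'g \<Rightarrow> bool" where
  "critical_point G N L g = (\<lambda>(g1, g2). (g1, g2) \<in> admissible_trajectories G N g \<and>
     (\<forall>(v1, v2)\<in>admissible_variations G N g1 g2.
        differential (prod_atlas (arrow_atlas G) (arrow_atlas G)) (N \<times> N) (action_sum L) (g1, g2)
          (pair_tangent (arrow_atlas G) (arrow_atlas G) g1 g2 v1 v2) = 0))"

end

theory Submission
  imports Defs
begin

text \<open>Put \<open>q = target g1 = source g2\<close>. The algebroid fiber at \<open>q\<close> produces variations of \<open>(g1, g2)\<close> with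
  fixed product: if the curve \<open>c\<close> runs in the source fiber over \<open>q\<close> and starts at the identity with
  velocity \<open>v\<close>, then \<open>t \<mapsto> (g1 c(t), c(t)\<inverse> g2)\<close> consists of composable pairs with product \<open>g1 g2\<close>, and
  its velocity is the pair formed by the left vector of \<open>v\<close> at \<open>g1\<close> and minus the right vector of \<open>v\<close>
  at \<open>g2\<close> (\<open>algebroid_variation\<close>). If both components are tangent to \<open>N\<close>, the pair is an admissible
  variation, and criticality says that \<open>(x, y) \<mapsto> x[Lhat] + y[Lhat]\<close> vanishes on it
  (\<open>differential_action_sum\<close>). These pairs form a linear space \<open>J\<close>, so the functional vanishes on the
  intersection of \<open>J\<close> with \<open>T N \<times> T N\<close>. A functional on \<open>J\<close> with this property coincides on \<open>J\<close> with a
  functional on the whole space that annihilates \<open>T N \<times> T N\<close> (\<open>lagrange_multipliers\<close>); the negatives of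
  its two components are the covectors of the theorem.

  The rest is the differential geometry that makes this argument meaningful. Tangent vectors are
  operators on functions, and a tangent map is computed along an arbitrarily chosen curve. Two facts
  tame this choice. A map is differentiated correctly and linearly as soon as its composites with smooth
  functions extend to smooth functions of the ambient manifold (\<open>smooth_along\<close>), which also covers the
  multiplication, defined on composable pairs only. And tangent spaces are vector spaces because in
  adapted charts they are linear subspaces (\<open>subspace_tangent_space\<close>).

  The analytic core is that a vector in the kernel of the differential of a submersion is the velocity
  of a smooth curve in the fiber (\<open>submersion_kernel_curve\<close>): without it the left and right vectors of
  an algebroid element would be unspecified. It rests on an inverse function theorem for smooth maps.\<close>

section \<open>Functions of class \<open>C\<^sup>k\<close>\<close>

lemma Ck_on_cong:
  assumes "open S" "\<And>x. x \<in> S \<Longrightarrow> f x = g x" "Ck_on k S f"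
  shows "Ck_on k S g"
  using assms(2,3)
proof (induction k arbitrary: f g)
  case 0
  then show ?case
    by (metis Ck_on.simps(1) continuous_on_cong)
next
  case (Suc k)
  have der: "(g has_derivative frechet_derivative f (at x)) (at x)" if "x \<in> S" for x
  proof (rule has_derivative_transform_within_open[OF _ \<open>open S\<close> that Suc.prems(1)])
    show "(f has_derivative frechet_derivative f (at x)) (at x)"
      using Suc.prems(2) that by (simp add: frechet_derivative_works)
  qed
  have "frechet_derivative g (at x) = frechet_derivative f (at x)" if "x \<in> S" for x
    using frechet_derivative_at[OF der[OF that]] by simp
  have "Ck_on k S (\<lambda>x. frechet_derivative g (at x) v)" for v
  proof (rule Suc.IH)
    show "Ck_on k S (\<lambda>x. frechet_derivative f (at x) v)"
      using Suc.prems(2) by simp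
  qed (simp add: \<open>\<And>x. x \<in> S \<Longrightarrow> frechet_derivative g (at x) = frechet_derivative f (at x)\<close>)
  moreover have "g differentiable (at x)" if "x \<in> S" for x
    using der[OF that] by (rule differentiableI)
  ultimately show ?case
    by simp
qed

lemma Ck_on_SucI:
  assumes "open S" "\<And>x. x \<in> S \<Longrightarrow> (f has_derivative f' x) (at x)"
    and "\<And>v. Ck_on k S (\<lambda>x. f' x v)"
  shows "Ck_on (Suc k) S f"
proof -
  have eq: "f' x v = frechet_derivative f (at x) v" if "x \<in> S" for x v
    using frechet_derivative_at[OF assms(2)[OF that]] by simp
  have "Ck_on k S (\<lambda>x. frechet_derivative f (at x) v)" for v
    by (rule Ck_on_cong[OF assms(1) eq assms(3)])
  moreover have "f differentiable (at x)" if "x \<in> S" for x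
    using assms(2)[OF that] by (rule differentiableI)
  ultimately show ?thesis
    by simp
qed

lemma Ck_on_Suc_has_derivative:
  "Ck_on (Suc k) S f \<Longrightarrow> x \<in> S \<Longrightarrow> (f has_derivative frechet_derivative f (at x)) (at x)"
  by (simp add: frechet_derivative_works)

lemma Ck_on_Suc_derivative:
  "Ck_on (Suc k) S f \<Longrightarrow> Ck_on k S (\<lambda>x. frechet_derivative f (at x) v)"
  by simp

lemma Ck_on_SucD: "Ck_on (Suc k) S f \<Longrightarrow> Ck_on k S f"
proof (induction k arbitrary: f)
  case 0
  then show ?case
    by (auto intro!: continuous_at_imp_continuous_on differentiable_imp_continuous_within)
next
  case (Suc k)
  then have "f differentiable (at x)" if "x \<in> S" for x
    using that by simp
  moreover have "Ck_on k S (\<lambda>x. frechet_derivative f (at x) v)" for v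
    by (rule Suc.IH) (use Suc.prems in simp)
  ultimately show ?case
    by simp
qed

lemma Ck_on_subset: "Ck_on k S f \<Longrightarrow> T \<subseteq> S \<Longrightarrow> Ck_on k T f"
proof (induction k arbitrary: f)
  case 0
  then show ?case by (auto intro: continuous_on_subset)
next
  case (Suc k)
  then have "Ck_on k T (\<lambda>x. frechet_derivative f (at x) v)" for v
    by (intro Suc.IH) auto
  then show ?case using Suc.prems by auto
qed

declare Ck_on.simps(2) [simp del]

lemma Ck_on_imp_continuous_on: "Ck_on k S f \<Longrightarrow> continuous_on S f"
proof (induction k)
  case (Suc k)
  then show ?case using Ck_on_SucD by blast
qed simp

lemma Ck_on_const: "open S \<Longrightarrow> Ck_on k S (\<lambda>x. c)"
proof (induction k arbitrary: c)
  case (Suc k)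
  show ?case
    by (intro Ck_on_SucI[OF Suc.prems, where f' = "\<lambda>x v. 0"] has_derivative_const Suc.IH Suc.prems)
qed simp

lemma Ck_on_ident: "open S \<Longrightarrow> Ck_on k S (\<lambda>x. x)"
proof (cases k)
  case (Suc k')
  assume "open S"
  then show ?thesis
    unfolding Suc by (intro Ck_on_SucI[where f' = "\<lambda>x v. v"] has_derivative_ident Ck_on_const)
qed simp

lemma Ck_on_bounded_linear:
  assumes "bounded_linear h" "open S"
  shows "Ck_on k S f \<Longrightarrow> Ck_on k S (\<lambda>x. h (f x))"
proof (induction k arbitrary: f)
  case 0
  then show ?case
    using bounded_linear.continuous_on[OF assms(1)] by simp
next
  case (Suc k)
  obtain f' where f': "\<And>x. x \<in> S \<Longrightarrow> (f has_derivative f' x) (at x)"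
      "\<And>v. Ck_on k S (\<lambda>x. f' x v)"
    by (rule that[OF Ck_on_Suc_has_derivative[OF Suc.prems] Ck_on_Suc_derivative[OF Suc.prems]])
  show ?case
    by (intro Ck_on_SucI[where f' = "\<lambda>x v. h (f' x v)"] bounded_linear.has_derivative[OF assms(1)]
        assms(2) f' Suc.IH)
qed

lemma Ck_on_add:
  assumes "open S"
  shows "Ck_on k S f \<Longrightarrow> Ck_on k S g \<Longrightarrow> Ck_on k S (\<lambda>x. f x + g x)"
proof (induction k arbitrary: f g)
  case (Suc k)
  obtain f' where f': "\<And>x. x \<in> S \<Longrightarrow> (f has_derivative f' x) (at x)"
      "\<And>v. Ck_on k S (\<lambda>x. f' x v)"
    by (rule that[OF Ck_on_Suc_has_derivative[OF Suc.prems(1)] Ck_on_Suc_derivative[OF Suc.prems(1)]])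
  obtain g' where g': "\<And>x. x \<in> S \<Longrightarrow> (g has_derivative g' x) (at x)"
      "\<And>v. Ck_on k S (\<lambda>x. g' x v)"
    by (rule that[OF Ck_on_Suc_has_derivative[OF Suc.prems(2)] Ck_on_Suc_derivative[OF Suc.prems(2)]])
  show ?case
    by (intro Ck_on_SucI[where f' = "\<lambda>x v. f' x v + g' x v"] has_derivative_add assms f' g' Suc.IH)
qed (auto intro: continuous_on_add)

lemma Ck_on_sum:
  assumes "open S" "finite I" "\<And>i. i \<in> I \<Longrightarrow> Ck_on k S (f i)"
  shows "Ck_on k S (\<lambda>x. \<Sum>i\<in>I. f i x)"
  using assms(2,3)
proof induction
  case (insert i I)
  then show ?case
    using Ck_on_add[OF assms(1), of k "f i"] by simp
qed (simp add: Ck_on_const assms(1))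

lemma Ck_on_scaleR:
  fixes f :: "'e::euclidean_space \<Rightarrow> real"
  assumes "open S"
  shows "Ck_on k S f \<Longrightarrow> Ck_on k S g \<Longrightarrow> Ck_on k S (\<lambda>x. f x *\<^sub>R g x)"
proof (induction k arbitrary: f g)
  case (Suc k)
  obtain f' where f': "\<And>x. x \<in> S \<Longrightarrow> (f has_derivative f' x) (at x)"
      "\<And>v. Ck_on k S (\<lambda>x. f' x v)"
    by (rule that[OF Ck_on_Suc_has_derivative[OF Suc.prems(1)] Ck_on_Suc_derivative[OF Suc.prems(1)]])
  obtain g' where g': "\<And>x. x \<in> S \<Longrightarrow> (g has_derivative g' x) (at x)"
      "\<And>v. Ck_on k S (\<lambda>x. g' x v)"
    by (rule that[OF Ck_on_Suc_has_derivative[OF Suc.prems(2)] Ck_on_Suc_derivative[OF Suc.prems(2)]])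
  show ?case
  proof (rule Ck_on_SucI[where f' = "\<lambda>x v. f x *\<^sub>R g' x v + f' x v *\<^sub>R g x"])
    show "Ck_on k S (\<lambda>x. f x *\<^sub>R g' x v + f' x v *\<^sub>R g x)" for v
      by (rule Ck_on_add[OF assms Suc.IH[OF Suc.prems(1)[THEN Ck_on_SucD] g'(2)]
            Suc.IH[OF f'(2) Suc.prems(2)[THEN Ck_on_SucD]]])
  qed (intro assms has_derivative_scaleR f' g')+
qed (auto intro: continuous_on_scaleR)

lemma Ck_on_Pair:
  fixes f :: "'a::euclidean_space \<Rightarrow> 'b::euclidean_space" and g :: "'a \<Rightarrow> 'c::euclidean_space"
  assumes "open S" "Ck_on k S f" "Ck_on k S g"
  shows "Ck_on k S (\<lambda>x. (f x, g x))"
proof -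
  have "bounded_linear (\<lambda>x. (x, 0 :: 'c))" "bounded_linear (\<lambda>x. (0 :: 'b, x))"
    by (intro bounded_linear_Pair bounded_linear_ident bounded_linear_zero)+
  from Ck_on_add[OF assms(1) Ck_on_bounded_linear[OF this(1) assms(1,2)]
      Ck_on_bounded_linear[OF this(2) assms(1,3)]]
  show ?thesis by simp
qed

text \<open>A family of linear maps is handled through its values on fixed vectors; expanding a varying
  argument in the standard basis reduces the general case to products of scalar and vector valued
  functions.\<close>

lemma linear_expand_Basis:
  fixes m :: "'e::euclidean_space"
  assumes "linear h"
  shows "h m = (\<Sum>b\<in>Basis. (m \<bullet> b) *\<^sub>R h b)"
proof -
  have "h m = h (\<Sum>b\<in>Basis. (m \<bullet> b) *\<^sub>R b)"
    by (simp add: euclidean_representation)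
  then show ?thesis
    using assms by (simp add: linear_sum linear_cmul)
qed

lemma Ck_on_linear_apply:
  assumes S: "open S" and lin: "\<And>x. x \<in> S \<Longrightarrow> linear (M x)"
    and M: "\<And>b. Ck_on k S (\<lambda>x. M x b)" and m: "Ck_on k S m"
  shows "Ck_on k S (\<lambda>x. M x (m x))"
proof (rule Ck_on_cong[OF S])
  show "Ck_on k S (\<lambda>x. \<Sum>b\<in>Basis. (m x \<bullet> b) *\<^sub>R M x b)"
    by (intro Ck_on_sum Ck_on_scaleR S finite_Basis M
        Ck_on_bounded_linear[OF bounded_linear_inner_left _ m])
qed (use linear_expand_Basis[OF lin] in metis)

lemma Ck_on_compose:
  assumes "open S" "open T" "f ` S \<subseteq> T"
  shows "Ck_on k S f \<Longrightarrow> Ck_on k T h \<Longrightarrow> Ck_on k S (\<lambda>x. h (f x))"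
proof (induction k arbitrary: h)
  case 0
  then show ?case
    using continuous_on_compose2 assms(3) by auto
next
  case (Suc k)
  obtain f' where f': "\<And>x. x \<in> S \<Longrightarrow> (f has_derivative f' x) (at x)"
      "\<And>v. Ck_on k S (\<lambda>x. f' x v)"
    by (rule that[OF Ck_on_Suc_has_derivative[OF Suc.prems(1)] Ck_on_Suc_derivative[OF Suc.prems(1)]])
  obtain h' where h': "\<And>x. x \<in> T \<Longrightarrow> (h has_derivative h' x) (at x)"
      "\<And>v. Ck_on k T (\<lambda>x. h' x v)"
    by (rule that[OF Ck_on_Suc_has_derivative[OF Suc.prems(2)] Ck_on_Suc_derivative[OF Suc.prems(2)]])
  have "f x \<in> T" if "x \<in> S" for x
    using assms that by auto
  note sub = this
  show ?case
  proof (rule Ck_on_SucI[OF assms(1), where f' = "\<lambda>x v. h' (f x) (f' x v)"])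
    show "((\<lambda>x. h (f x)) has_derivative (\<lambda>v. h' (f x) (f' x v))) (at x)" if "x \<in> S" for x
      using has_derivative_compose[OF f'(1)[OF that] h'(1)[OF sub[OF that]]] .
    show "Ck_on k S (\<lambda>x. h' (f x) (f' x v))" for v
      by (rule Ck_on_linear_apply[OF assms(1) has_derivative_linear[OF h'(1)[OF sub]]
            Suc.IH[OF Ck_on_SucD[OF Suc.prems(1)] h'(2)] f'(2)])
  qed
qed

text \<open>A product rule in which the second factor is merely continuous; at a zero of the first factor this is
  enough. It yields the derivative of an inverse family from its continuity alone.\<close>

lemma has_derivative_scaleR_vanishing:
  fixes s :: "'e::real_normed_vector \<Rightarrow> real" and q :: "'e \<Rightarrow> 'f::real_normed_vector"
  assumes s: "(s has_derivative s') (at a)" and s0: "s a = 0" and q: "isCont q a"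
  shows "((\<lambda>x. s x *\<^sub>R q x) has_derivative (\<lambda>h. s' h *\<^sub>R q a)) (at a)"
proof -
  have lin: "bounded_linear s'"
    using s by (rule has_derivative_bounded_linear)
  then obtain K where K: "\<And>x. norm (s' x) \<le> norm x * K"
    using bounded_linear.bounded by blast
  define r where "r x = norm (s x - s' (x - a)) / norm (x - a)" for x
  have r: "(r \<longlongrightarrow> 0) (at a)"
    using s s0 unfolding has_derivative_iff_norm r_def by simp
  have dq: "((\<lambda>x. norm (q x - q a)) \<longlongrightarrow> 0) (at a)"
    using q by (auto simp: isCont_def intro: tendsto_norm_zero LIM_zero)
  have "((\<lambda>x. r x * norm (q x) + K * norm (q x - q a)) \<longlongrightarrow> 0 * norm (q a) + K * 0) (at a)"
    using q by (intro tendsto_add tendsto_mult tendsto_norm r dq tendsto_const) (auto simp: isCont_def)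
  then have lim: "((\<lambda>x. r x * norm (q x) + K * norm (q x - q a)) \<longlongrightarrow> 0) (at a)"
    by simp
  have bound: "norm (norm (s x *\<^sub>R q x - s' (x - a) *\<^sub>R q a) / norm (x - a))
      \<le> r x * norm (q x) + K * norm (q x - q a)" if "x \<noteq> a" for x
  proof -
    have "s x *\<^sub>R q x - s' (x - a) *\<^sub>R q a
        = (s x - s' (x - a)) *\<^sub>R q x + s' (x - a) *\<^sub>R (q x - q a)"
      by (simp add: algebra_simps)
    then have "norm (s x *\<^sub>R q x - s' (x - a) *\<^sub>R q a)
        \<le> norm (s x - s' (x - a)) * norm (q x) + norm (s' (x - a)) * norm (q x - q a)"
      by (metis norm_scaleR norm_triangle_ineq real_norm_def)
    also have "\<dots> \<le> norm (s x - s' (x - a)) * norm (q x) + (norm (x - a) * K) * norm (q x - q a)"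
      by (intro add_left_mono mult_right_mono K) auto
    finally show ?thesis
      using that by (simp add: r_def field_simps)
  qed
  have "((\<lambda>x. norm (s x *\<^sub>R q x - s' (x - a) *\<^sub>R q a) / norm (x - a)) \<longlongrightarrow> 0) (at a)"
    by (rule Lim_null_comparison[OF _ lim]) (use bound in \<open>auto simp: eventually_at_filter\<close>)
  then show ?thesis
    using lin s0 by (simp add: has_derivative_iff_norm bounded_linear_scaleR_left bounded_linear_scaleR_const)
qed

text \<open>Near \<open>a\<close> the maps \<open>M x\<close> satisfy a common lower bound \<open>c/2 * norm w \<le> norm (M x w)\<close>, so that the inverses
  are uniformly bounded and \<open>N x u - N a u = N x ((M a - M x) (N a u))\<close> tends to \<open>0\<close>.\<close>

lemma continuous_inverse_linear_family:
  fixes M :: "'x::t2_space \<Rightarrow> 'e::euclidean_space \<Rightarrow> 'e"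
  assumes S: "open S" "a \<in> S" and lin: "\<And>x. x \<in> S \<Longrightarrow> linear (M x)"
    and NM: "\<And>x v. x \<in> S \<Longrightarrow> N x (M x v) = v" and MN: "\<And>x v. x \<in> S \<Longrightarrow> M x (N x v) = v"
    and cont: "\<And>v. continuous_on S (\<lambda>x. M x v)"
  shows "((\<lambda>x. N x u) \<longlongrightarrow> N a u) (at a)"
proof -
  have tend: "((\<lambda>x. M x v) \<longlongrightarrow> M a v) (at a)" for v
    using cont[of v] S continuous_on_eq_continuous_at[OF S(1)] isCont_def by blast
  have "inj (M a)"
    using NM[OF S(2)] by (metis injI)
  then obtain c where c: "c > 0" "\<And>w. c * norm w \<le> norm (M a w)"
    using linear_inj_bounded_below_pos[OF lin[OF S(2)]] by blast
  have "((\<lambda>x. \<Sum>b\<in>Basis. norm (M x b - M a b)) \<longlongrightarrow> (\<Sum>b\<in>(Basis::'e set). norm (M a b - M a b))) (at a)"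
    by (intro tendsto_intros tend)
  then have "eventually (\<lambda>x. (\<Sum>b\<in>Basis. norm (M x b - M a b)) < c / 2) (at a)"
    using c(1) by (auto dest!: order_tendstoD(2)[where a = "c / 2"])
  moreover have "eventually (\<lambda>x. x \<in> S) (at a)"
    using S eventually_at_topological by blast
  ultimately have ev: "eventually (\<lambda>x. norm (N x u - N a u) \<le> (2 / c) * norm (M x (N a u) - M a (N a u))) (at a)"
  proof eventually_elim
    case (elim x)
    have low: "c / 2 * norm w \<le> norm (M x w)" for w
    proof -
      have l: "linear (\<lambda>w. M x w - M a w)"
        using lin elim S by (intro linear_compose_sub) auto
      have "norm (M x w - M a w) = norm (\<Sum>b\<in>Basis. (w \<bullet> b) *\<^sub>R (M x b - M a b))"
        using linear_expand_Basis[OF l, of w] by simp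
      also have "\<dots> \<le> (\<Sum>b\<in>Basis. norm w * norm (M x b - M a b))"
        by (intro order_trans[OF norm_sum] sum_mono) (auto intro!: mult_right_mono Basis_le_norm)
      also have "\<dots> = norm w * (\<Sum>b\<in>Basis. norm (M x b - M a b))"
        by (simp add: sum_distrib_left)
      also have "\<dots> \<le> norm w * (c / 2)"
        using elim by (intro mult_left_mono) auto
      finally have "norm (M x w - M a w) \<le> c / 2 * norm w"
        by (simp add: mult.commute)
      then show ?thesis
        using c(2)[of w] norm_triangle_ineq2[of "M a w" "M x w"] by (simp add: norm_minus_commute)
    qed
    have "M x (N x u - N a u) = M a (N a u) - M x (N a u)"
      using lin elim S MN by (simp add: linear_diff)
    then have "c / 2 * norm (N x u - N a u) \<le> norm (M x (N a u) - M a (N a u))"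
      using low[of "N x u - N a u"] by (simp add: norm_minus_commute)
    then show ?case
      using c(1) by (simp add: field_simps)
  qed
  have "((\<lambda>x. (2 / c) * norm (M x (N a u) - M a (N a u))) \<longlongrightarrow> (2 / c) * norm (M a (N a u) - M a (N a u))) (at a)"
    by (intro tendsto_intros tend)
  then have "((\<lambda>x. N x u - N a u) \<longlongrightarrow> 0) (at a)"
    using ev by (auto intro: Lim_null_comparison)
  then show ?thesis
    by (rule LIM_zero_cancel)
qed

text \<open>The derivative of \<open>x \<mapsto> (M x)\<inverse> u\<close> is \<open>- (M x)\<inverse> (\<partial>M x ((M x)\<inverse> u))\<close>, which only involves inverses of
  \<open>M x\<close> again; this makes the induction on the order of differentiability work.\<close>

lemma Ck_on_inverse_linear_family:
  fixes M :: "'x::euclidean_space \<Rightarrow> 'e::euclidean_space \<Rightarrow> 'e"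
  assumes S: "open S" and lin: "\<And>x. x \<in> S \<Longrightarrow> linear (M x)"
    and linN: "\<And>x. x \<in> S \<Longrightarrow> linear (N x)"
    and NM: "\<And>x v. x \<in> S \<Longrightarrow> N x (M x v) = v" and MN: "\<And>x v. x \<in> S \<Longrightarrow> M x (N x v) = v"
  shows "(\<And>v. Ck_on k S (\<lambda>x. M x v)) \<Longrightarrow> Ck_on k S (\<lambda>x. N x u)"
proof (induction k arbitrary: u)
  case 0
  then show ?case
    using continuous_inverse_linear_family[where M = M and N = N, OF S _ lin NM MN]
    by (simp add: isCont_def continuous_on_eq_continuous_at S)
next
  case (Suc k)
  have MCk: "Ck_on k S (\<lambda>x. M x v)" for v
    using Suc.prems by (rule Ck_on_SucD)
  have cont: "continuous_on S (\<lambda>x. M x v)" for v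
    using Suc.prems by (rule Ck_on_imp_continuous_on)
  have "\<exists>M'. \<forall>v. (\<forall>x\<in>S. ((\<lambda>x. M x v) has_derivative (\<lambda>h. M' h x v)) (at x)) \<and> (\<forall>h. Ck_on k S (\<lambda>x. M' h x v))"
  proof -
    have "\<exists>f'. (\<forall>x\<in>S. ((\<lambda>x. M x v) has_derivative f' x) (at x)) \<and> (\<forall>h. Ck_on k S (\<lambda>x. f' x h))" for v
      by (intro exI[of _ "\<lambda>x. frechet_derivative (\<lambda>x. M x v) (at x)"] conjI ballI allI
          Ck_on_Suc_has_derivative[OF Suc.prems] Ck_on_Suc_derivative[OF Suc.prems])
    then obtain f' where "\<And>v. (\<forall>x\<in>S. ((\<lambda>x. M x v) has_derivative f' v x) (at x)) \<and> (\<forall>h. Ck_on k S (\<lambda>x. f' v x h))"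
      by metis
    then show ?thesis
      by (intro exI[of _ "\<lambda>h x v. f' v x h"]) auto
  qed
  then obtain M' where M': "\<And>x v. x \<in> S \<Longrightarrow> ((\<lambda>x. M x v) has_derivative (\<lambda>h. M' h x v)) (at x)"
      and M'k: "\<And>v h. Ck_on k S (\<lambda>x. M' h x v)"
    by blast
  have linM': "linear (M' h x)" if "x \<in> S" for h x
  proof (rule linearI)
    fix v w :: 'e and c :: real
    have "((\<lambda>x. M x (v + w)) has_derivative (\<lambda>h. M' h x v + M' h x w)) (at x)"
      by (rule has_derivative_transform_within_open[OF has_derivative_add[OF M'[OF that] M'[OF that]] S that])
        (use lin in \<open>auto simp: linear_add\<close>)
    then show "M' h x (v + w) = M' h x v + M' h x w"
      by (rule fun_cong[OF has_derivative_unique[OF M'[OF that]]])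
    have "((\<lambda>x. M x (c *\<^sub>R v)) has_derivative (\<lambda>h. c *\<^sub>R M' h x v)) (at x)"
      by (rule has_derivative_transform_within_open[OF has_derivative_scaleR_right[OF M'[OF that]] S that])
        (use lin in \<open>auto simp: linear_cmul\<close>)
    then show "M' h x (c *\<^sub>R v) = c *\<^sub>R M' h x v"
      by (rule fun_cong[OF has_derivative_unique[OF M'[OF that]]])
  qed
  show ?case
  proof (rule Ck_on_SucI[OF S, where f' = "\<lambda>x h. N x (- M' h x (N x u))"])
    fix a assume a: "a \<in> S"
    define y where "y = N a u"
    \<comment> \<open>\<open>N x u = y + N x (u - M x y)\<close>, and the argument of the last \<open>N x\<close> vanishes at \<open>a\<close>.\<close>
    have psi: "((\<lambda>x. (u - M x y) \<bullet> b) has_derivative (\<lambda>h. (- M' h a y) \<bullet> b)) (at a)" for b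
      by (auto intro!: derivative_eq_intros M'[OF a])
    have Ncont: "isCont (\<lambda>x. N x b) a" for b
      using continuous_inverse_linear_family[OF S a lin NM MN cont] by (simp add: isCont_def)
    have "((\<lambda>x. ((u - M x y) \<bullet> b) *\<^sub>R N x b) has_derivative (\<lambda>h. ((- M' h a y) \<bullet> b) *\<^sub>R N a b)) (at a)" for b
      by (rule has_derivative_scaleR_vanishing[OF psi _ Ncont]) (simp add: y_def MN a)
    then have "((\<lambda>x. y + (\<Sum>b\<in>Basis. ((u - M x y) \<bullet> b) *\<^sub>R N x b)) has_derivative
        (\<lambda>h. 0 + (\<Sum>b\<in>Basis. ((- M' h a y) \<bullet> b) *\<^sub>R N a b))) (at a)"
      by (intro has_derivative_add has_derivative_const has_derivative_sum) auto
    moreover have "(\<lambda>h. 0 + (\<Sum>b\<in>Basis. ((- M' h a y) \<bullet> b) *\<^sub>R N a b)) = (\<lambda>h. N a (- M' h a y))"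
      using linear_expand_Basis[OF linN[OF a]] by (metis add_0)
    moreover have "y + (\<Sum>b\<in>Basis. ((u - M x y) \<bullet> b) *\<^sub>R N x b) = N x u" if "x \<in> S" for x
    proof -
      have "N x (u - M x y) = N x u - y"
        using linN NM that by (simp add: linear_diff)
      then show ?thesis
        using linear_expand_Basis[OF linN[OF that], of "u - M x y"] by simp
    qed
    ultimately have "((\<lambda>x. y + (\<Sum>b\<in>Basis. ((u - M x y) \<bullet> b) *\<^sub>R N x b)) has_derivative
        (\<lambda>h. N a (- M' h a y))) (at a)"
      by simp
    from has_derivative_transform_within_open[OF this S a \<open>\<And>x. x \<in> S \<Longrightarrow>
        y + (\<Sum>b\<in>Basis. ((u - M x y) \<bullet> b) *\<^sub>R N x b) = N x u\<close>]
    show "((\<lambda>x. N x u) has_derivative (\<lambda>h. N a (- M' h a (N a u)))) (at a)"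
      by (simp add: y_def)
  next
    fix v
    have "Ck_on k S (\<lambda>x. M' v x (N x u))"
      using Ck_on_linear_apply[where M = "M' v" and m = "\<lambda>x. N x u", OF S linM' M'k Suc.IH[OF MCk]] .
    then have "Ck_on k S (\<lambda>x. - M' v x (N x u))"
      using Ck_on_bounded_linear[OF bounded_linear_minus[OF bounded_linear_ident] S] by blast
    from Ck_on_linear_apply[where M = N, OF S linN Suc.IH[OF MCk] this]
    show "Ck_on k S (\<lambda>x. N x (- M' v x (N x u)))" .
  qed
qed

section \<open>Coordinate expressions\<close>

text \<open>Near \<open>p\<close>, the map \<open>f\<close> is a smooth function of the coordinates \<open>\<phi>\<close>. The map \<open>F\<close> lives on an open subset
  of the whole Euclidean type even when \<open>\<phi>\<close> takes values in a proper subspace. Being a preorder in its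
  two function arguments, the relation turns changes of charts and compositions into instances of
  transitivity.\<close>

definition smooth_via ::
    "('a::topological_space \<Rightarrow> 'e::euclidean_space) \<Rightarrow> ('a \<Rightarrow> 'f::euclidean_space) \<Rightarrow> 'a \<Rightarrow> bool" where
  "smooth_via \<phi> f p \<longleftrightarrow> (\<exists>\<Omega> F. open \<Omega> \<and> \<phi> p \<in> \<Omega> \<and> (\<forall>k. Ck_on k \<Omega> F) \<and>
     (\<forall>\<^sub>F y in nhds p. \<phi> y \<in> \<Omega> \<and> f y = F (\<phi> y)))"

lemma smooth_viaI:
  assumes "open \<Omega>" "\<And>k. Ck_on k \<Omega> F" "\<forall>\<^sub>F y in nhds p. \<phi> y \<in> \<Omega>" "\<forall>\<^sub>F y in nhds p. f y = F (\<phi> y)"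
  shows "smooth_via \<phi> f p"
  unfolding smooth_via_def using assms eventually_nhds_x_imp_x[OF assms(3)]
  by (auto intro!: exI[of _ \<Omega>] exI[of _ F] eventually_conj)

lemma smooth_viaE:
  assumes "smooth_via \<phi> f p"
  obtains \<Omega> F where "open \<Omega>" "\<phi> p \<in> \<Omega>" "\<And>k. Ck_on k \<Omega> F"
    "\<forall>\<^sub>F y in nhds p. \<phi> y \<in> \<Omega>" "\<forall>\<^sub>F y in nhds p. f y = F (\<phi> y)" "f p = F (\<phi> p)"
proof -
  obtain \<Omega> F where *: "open \<Omega>" "\<phi> p \<in> \<Omega>" "\<forall>k. Ck_on k \<Omega> F"
      "\<forall>\<^sub>F y in nhds p. \<phi> y \<in> \<Omega> \<and> f y = F (\<phi> y)"
    using assms unfolding smooth_via_def by blast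
  then show ?thesis
    using that[of \<Omega> F] eventually_nhds_x_imp_x[OF *(4)] by (auto simp: eventually_conj_iff)
qed

lemma smooth_via_smooth:
  assumes "open \<Omega>" "\<And>k. Ck_on k \<Omega> F" "\<forall>\<^sub>F y in nhds p. \<phi> y \<in> \<Omega>"
  shows "smooth_via \<phi> (\<lambda>y. F (\<phi> y)) p"
  by (rule smooth_viaI[OF assms]) simp

lemma smooth_via_bounded_linear: "bounded_linear h \<Longrightarrow> smooth_via \<phi> (\<lambda>y. h (\<phi> y)) p"
  by (rule smooth_via_smooth[of UNIV h]) (simp_all add: Ck_on_bounded_linear[OF _ _ Ck_on_ident])

lemma smooth_via_refl: "smooth_via \<phi> \<phi> p"
  using smooth_via_bounded_linear[OF bounded_linear_ident] .

lemma smooth_via_const: "smooth_via \<phi> (\<lambda>y. c) p"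
  by (rule smooth_via_smooth[of UNIV "\<lambda>_. c"]) (auto intro: Ck_on_const)

lemma smooth_via_cong:
  assumes "smooth_via \<phi> f p" "\<forall>\<^sub>F y in nhds p. f y = g y"
  shows "smooth_via \<phi> g p"
proof -
  from assms(1) obtain \<Omega> F where F: "open \<Omega>" "\<And>k. Ck_on k \<Omega> F"
      "\<forall>\<^sub>F y in nhds p. \<phi> y \<in> \<Omega>" "\<forall>\<^sub>F y in nhds p. f y = F (\<phi> y)"
    by (elim smooth_viaE) (rule that)
  have "\<forall>\<^sub>F y in nhds p. g y = F (\<phi> y)"
    using F(4) assms(2) by eventually_elim simp
  with F show ?thesis
    by (intro smooth_viaI)
qed

lemma smooth_via_trans:
  assumes "smooth_via \<phi> \<psi> p" "smooth_via \<psi> f p"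
  shows "smooth_via \<phi> f p"
proof -
  from assms(1) obtain \<Omega> T where T: "open \<Omega>" "\<And>k. Ck_on k \<Omega> T"
      "\<forall>\<^sub>F y in nhds p. \<phi> y \<in> \<Omega>" "\<forall>\<^sub>F y in nhds p. \<psi> y = T (\<phi> y)"
    by (elim smooth_viaE) (rule that)
  from assms(2) obtain \<Omega>' F where F: "open \<Omega>'" "\<And>k. Ck_on k \<Omega>' F"
      "\<forall>\<^sub>F y in nhds p. \<psi> y \<in> \<Omega>'" "\<forall>\<^sub>F y in nhds p. f y = F (\<psi> y)"
    by (elim smooth_viaE) (rule that)
  have op: "open (\<Omega> \<inter> T -` \<Omega>')"
    using continuous_open_preimage[OF Ck_on_imp_continuous_on[OF T(2)[of 0]] T(1) F(1)] .
  show ?thesis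
  proof (rule smooth_viaI[OF op])
    show "Ck_on k (\<Omega> \<inter> T -` \<Omega>') (\<lambda>z. F (T z))" for k
      by (rule Ck_on_compose[OF op F(1) _ Ck_on_subset[OF T(2)] F(2)]) auto
    show "\<forall>\<^sub>F y in nhds p. \<phi> y \<in> \<Omega> \<inter> T -` \<Omega>'"
      using T(3,4) F(3) by eventually_elim simp
    show "\<forall>\<^sub>F y in nhds p. f y = F (T (\<phi> y))"
      using T(4) F(4) by eventually_elim simp
  qed
qed

lemma smooth_via_comp:
  assumes "smooth_via \<psi> h (f p)" "filterlim f (nhds (f p)) (nhds p)"
  shows "smooth_via (\<lambda>x. \<psi> (f x)) (\<lambda>x. h (f x)) p"
proof -
  from assms(1) obtain \<Omega> F where F: "open \<Omega>" "\<And>k. Ck_on k \<Omega> F"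
      "\<forall>\<^sub>F y in nhds (f p). \<psi> y \<in> \<Omega>" "\<forall>\<^sub>F y in nhds (f p). h y = F (\<psi> y)"
    by (elim smooth_viaE) (rule that)
  show ?thesis
    by (rule smooth_viaI[OF F(1,2)])
      (use eventually_compose_filterlim[OF F(3) assms(2)] eventually_compose_filterlim[OF F(4) assms(2)] in auto)
qed

lemma smooth_via_Pair:
  assumes "smooth_via \<phi> f p" "smooth_via \<phi> g p"
  shows "smooth_via \<phi> (\<lambda>x. (f x, g x)) p"
proof -
  from assms(1) obtain \<Omega> F where F: "open \<Omega>" "\<And>k. Ck_on k \<Omega> F"
      "\<forall>\<^sub>F y in nhds p. \<phi> y \<in> \<Omega>" "\<forall>\<^sub>F y in nhds p. f y = F (\<phi> y)"
    by (elim smooth_viaE) (rule that)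
  from assms(2) obtain \<Omega>' H where H: "open \<Omega>'" "\<And>k. Ck_on k \<Omega>' H"
      "\<forall>\<^sub>F y in nhds p. \<phi> y \<in> \<Omega>'" "\<forall>\<^sub>F y in nhds p. g y = H (\<phi> y)"
    by (elim smooth_viaE) (rule that)
  have op: "open (\<Omega> \<inter> \<Omega>')"
    using F(1) H(1) by blast
  show ?thesis
  proof (rule smooth_viaI[OF op])
    show "Ck_on k (\<Omega> \<inter> \<Omega>') (\<lambda>z. (F z, H z))" for k
      by (intro Ck_on_Pair op Ck_on_subset[OF F(2)] Ck_on_subset[OF H(2)]) auto
    show "\<forall>\<^sub>F y in nhds p. \<phi> y \<in> \<Omega> \<inter> \<Omega>'"
      using F(3) H(3) by eventually_elim simp
    show "\<forall>\<^sub>F y in nhds p. (f y, g y) = (F (\<phi> y), H (\<phi> y))"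
      using F(4) H(4) by eventually_elim simp
  qed
qed

lemma smooth_via_add:
  assumes "smooth_via \<phi> f p" "smooth_via \<phi> g p"
  shows "smooth_via \<phi> (\<lambda>x. f x + g x) p"
  using smooth_via_trans[OF smooth_via_Pair[OF assms]
      smooth_via_bounded_linear[OF bounded_linear_add[OF bounded_linear_fst bounded_linear_snd]]]
  by simp

lemma smooth_via_continuous:
  assumes "smooth_via \<phi> f p" "filterlim \<phi> (nhds (\<phi> p)) (nhds p)"
  shows "filterlim f (nhds (f p)) (nhds p)"
proof -
  from assms(1) obtain \<Omega> F where F: "open \<Omega>" "\<phi> p \<in> \<Omega>" "\<And>k. Ck_on k \<Omega> F"
      "\<forall>\<^sub>F y in nhds p. \<phi> y \<in> \<Omega>" "\<forall>\<^sub>F y in nhds p. f y = F (\<phi> y)" "f p = F (\<phi> p)"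
    by (elim smooth_viaE) (rule that)
  have "((\<lambda>y. F (\<phi> y)) \<longlongrightarrow> F (\<phi> p)) (nhds p)"
    by (rule continuous_on_tendsto_compose[OF Ck_on_imp_continuous_on[OF F(3)[of 0]] assms(2) F(2,4)])
  then show ?thesis
    using filterlim_cong[OF refl refl F(5)] F(6) by simp
qed

text \<open>Local extendability of \<open>f \<circ> \<phi>\<inverse>\<close> on \<open>\<phi> ` W\<close> already provides the ambient function that \<open>smooth_via\<close> asks
  for.\<close>

lemma smooth_via_on:
  assumes sm: "smooth_on (\<phi> ` W) (f \<circ> inv_into U \<phi>)" and W: "\<forall>\<^sub>F y in nhds p. y \<in> W" "W \<subseteq> U"
    and \<phi>: "filterlim \<phi> (nhds (\<phi> p)) (nhds p)" and inj: "inj_on \<phi> U"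
  shows "smooth_via \<phi> f p"
proof -
  have "p \<in> W"
    using eventually_nhds_x_imp_x[OF W(1)] .
  then obtain \<Omega> F where F: "open \<Omega>" "\<phi> p \<in> \<Omega>" "\<forall>k. Ck_on k \<Omega> F"
      "\<forall>y\<in>\<Omega> \<inter> \<phi> ` W. F y = (f \<circ> inv_into U \<phi>) y"
    using sm unfolding smooth_on_def by blast
  have ev: "\<forall>\<^sub>F y in nhds p. \<phi> y \<in> \<Omega>"
    using topological_tendstoD[OF \<phi> F(1,2)] .
  moreover have "\<forall>\<^sub>F y in nhds p. f y = F (\<phi> y)"
    using ev W(1)
  proof eventually_elim
    case (elim y)
    then show ?case
      using F(4) W(2) inj by (auto simp: inv_into_f_f)
  qed
  ultimately show ?thesis
    using F by (intro smooth_viaI) auto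
qed

lemma smooth_via_ident_iff:
  fixes c :: "'e::euclidean_space \<Rightarrow> 'f::euclidean_space"
  shows "smooth_via (\<lambda>x. x) c t \<longleftrightarrow> (\<exists>J. open J \<and> t \<in> J \<and> (\<forall>k. Ck_on k J c))"
proof
  assume "smooth_via (\<lambda>x. x) c t"
  then obtain \<Omega> F where F: "open \<Omega>" "t \<in> \<Omega>" "\<And>k. Ck_on k \<Omega> F" "\<forall>\<^sub>F y in nhds t. c y = F y"
    by (elim smooth_viaE) (rule that)
  from F(4) obtain S where S: "open S" "t \<in> S" "\<And>y. y \<in> S \<Longrightarrow> c y = F y"
    unfolding eventually_nhds by blast
  have "open (S \<inter> \<Omega>)"
    using S F by blast
  have "Ck_on k (S \<inter> \<Omega>) c" for k
    by (rule Ck_on_cong[OF \<open>open (S \<inter> \<Omega>)\<close> _ Ck_on_subset[OF F(3)]]) (use S in auto)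
  then show "\<exists>J. open J \<and> t \<in> J \<and> (\<forall>k. Ck_on k J c)"
    using S F by (intro exI[of _ "S \<inter> \<Omega>"]) auto
next
  assume "\<exists>J. open J \<and> t \<in> J \<and> (\<forall>k. Ck_on k J c)"
  then obtain J where J: "open J" "t \<in> J" "\<And>k. Ck_on k J c"
    by blast
  show "smooth_via (\<lambda>x. x) c t"
    by (rule smooth_viaI[OF J(1,3) eventually_nhds_in_open[OF J(1,2)]]) simp
qed

lemma smooth_via_ident_differentiable:
  fixes c :: "'e::euclidean_space \<Rightarrow> 'f::euclidean_space"
  assumes "smooth_via (\<lambda>x. x) c t"
  shows "c differentiable (at t)"
proof -
  obtain J where "open J" "t \<in> J" "Ck_on (Suc 0) J c"
    using assms unfolding smooth_via_ident_iff by blast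
  then show ?thesis
    using Ck_on_Suc_has_derivative[of 0 J c t] by (auto intro: differentiableI)
qed

section \<open>Charts and smooth maps\<close>

definition global_atlas :: "('a::topological_space, 'e::euclidean_space) chart set \<Rightarrow> bool" where
  "global_atlas A \<longleftrightarrow> (\<exists>n. smooth_manifold n A) \<and> atlas_carrier A = UNIV"

lemma atlas_subset_maximal: "smooth_manifold n A \<Longrightarrow> A \<subseteq> maximal_atlas A"
  by (auto simp: smooth_manifold_def maximal_atlas_def)

lemma chart_at:
  assumes "global_atlas A"
  obtains U \<phi> where "(U, \<phi>) \<in> A" "(U, \<phi>) \<in> maximal_atlas A" "p \<in> U"
proof -
  have "p \<in> atlas_carrier A" "A \<subseteq> maximal_atlas A"
    using assms by (auto simp: global_atlas_def dest: atlas_subset_maximal)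
  then show ?thesis
    using that by (fastforce simp: atlas_carrier_def)
qed

text \<open>The continuity of the inverse chart is what allows continuity of a map to be recovered from its
  coordinate expression.\<close>

lemma maximal_chart:
  assumes "atlas_carrier A = UNIV" "(U, \<phi>) \<in> maximal_atlas A"
  shows "open U" "inj_on \<phi> U" "continuous_on U \<phi>" "continuous_on (\<phi> ` U) (inv_into U \<phi>)"
    and "\<exists>V. subspace V \<and> openin (top_of_set V) (\<phi> ` U)"
    and "\<And>p. p \<in> U \<Longrightarrow> filterlim \<phi> (nhds (\<phi> p)) (nhds p)"
    and "\<And>p. p \<in> U \<Longrightarrow> \<forall>\<^sub>F y in nhds p. y \<in> U"
proof -
  obtain n where lc: "local_chart n UNIV (U, \<phi>)"
    using assms unfolding maximal_atlas_def by auto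
  then obtain \<psi> where hom: "homeomorphism U (\<phi> ` U) \<phi> \<psi>"
    by (auto simp: local_chart_def)
  show U: "open U" and "\<exists>V. subspace V \<and> openin (top_of_set V) (\<phi> ` U)"
    using lc by (auto simp: local_chart_def)
  show inj: "inj_on \<phi> U"
    using hom by (metis homeomorphism_apply1 inj_onI)
  show cont: "continuous_on U \<phi>"
    using hom by (simp add: homeomorphism_def)
  have "continuous_on (\<phi> ` U) \<psi>"
    using hom by (simp add: homeomorphism_def)
  moreover have "\<psi> z = inv_into U \<phi> z" if "z \<in> \<phi> ` U" for z
    using that hom inj by (auto simp: homeomorphism_apply1 inv_into_f_f)
  ultimately show "continuous_on (\<phi> ` U) (inv_into U \<phi>)"
    by (simp cong: continuous_on_cong)
  show ev: "\<forall>\<^sub>F y in nhds p. y \<in> U" if "p \<in> U" for p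
    using U that by (rule eventually_nhds_in_open)
  show "filterlim \<phi> (nhds (\<phi> p)) (nhds p)" if "p \<in> U" for p
    by (rule continuous_on_tendsto_compose[OF cont filterlim_ident that ev[OF that]])
qed

lemma smooth_transition_via:
  assumes "smooth_transition (U, \<phi>) (V, \<psi>)" "\<forall>\<^sub>F y in nhds p. y \<in> U" "\<forall>\<^sub>F y in nhds p. y \<in> V"
    and "filterlim \<phi> (nhds (\<phi> p)) (nhds p)" "inj_on \<phi> U"
  shows "smooth_via \<phi> \<psi> p"
proof (rule smooth_via_on[of \<phi> "U \<inter> V" \<psi> U])
  show "smooth_on (\<phi> ` (U \<inter> V)) (\<psi> \<circ> inv_into U \<phi>)"
    using assms(1) by (simp add: smooth_transition_def)
qed (use assms in \<open>auto intro: eventually_conj\<close>)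

text \<open>A chart of the maximal atlas is only related to charts of the given atlas, so the transition passes
  through one of these.\<close>

lemma chart_change:
  assumes A: "global_atlas A" and c: "(U, \<phi>) \<in> maximal_atlas A" and d: "(V, \<psi>) \<in> maximal_atlas A"
    and p: "p \<in> U" "p \<in> V"
  shows "smooth_via \<phi> \<psi> p"
proof -
  have car: "atlas_carrier A = UNIV"
    using A by (simp add: global_atlas_def)
  obtain W \<theta> where W: "(W, \<theta>) \<in> A" "(W, \<theta>) \<in> maximal_atlas A" "p \<in> W"
    using chart_at[OF A] .
  have "smooth_transition (U, \<phi>) (W, \<theta>)" "smooth_transition (W, \<theta>) (V, \<psi>)"
    using c d W(1) by (auto simp: maximal_atlas_def)
  note T = this
  have "smooth_via \<phi> \<theta> p"
    by (rule smooth_transition_via[OF T(1) maximal_chart(7)[OF car c p(1)] maximal_chart(7)[OF car W(2,3)]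
          maximal_chart(6)[OF car c p(1)] maximal_chart(2)[OF car c]])
  moreover have "smooth_via \<theta> \<psi> p"
    by (rule smooth_transition_via[OF T(2) maximal_chart(7)[OF car W(2,3)] maximal_chart(7)[OF car d p(2)]
          maximal_chart(6)[OF car W(2,3)] maximal_chart(2)[OF car W(2)]])
  ultimately show ?thesis
    by (rule smooth_via_trans)
qed

text \<open>The existential quantification over charts in \<open>smooth_at\<close> is replaced by a condition in charts of
  choice. Continuity is a separate condition: the coordinate expression says nothing about points that
  leave the domain of the target chart.\<close>

lemma smooth_at_iff:
  assumes A: "global_atlas A" and B: "global_atlas B"
    and c: "(U, \<phi>) \<in> maximal_atlas A" "p \<in> U" and d: "(V, \<psi>) \<in> maximal_atlas B" "f p \<in> V"
  shows "smooth_at A B f p \<longleftrightarrow>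
    filterlim f (nhds (f p)) (nhds p) \<and> smooth_via \<phi> (\<lambda>x. \<psi> (f x)) p" (is "?L \<longleftrightarrow> ?R")
proof
  have car: "atlas_carrier A = UNIV" "atlas_carrier B = UNIV"
    using A B by (auto simp: global_atlas_def)
  have max: "A \<subseteq> maximal_atlas A" "B \<subseteq> maximal_atlas B"
    using A B by (auto simp: global_atlas_def dest: atlas_subset_maximal)
  {
    assume ?L
    then obtain U' \<phi>' V' \<psi>' W where c': "(U', \<phi>') \<in> A" and d': "(V', \<psi>') \<in> B"
      and W: "open W" "p \<in> W" "W \<subseteq> U'" "f ` W \<subseteq> V'"
      and sm: "smooth_on (\<phi>' ` W) (\<psi>' \<circ> f \<circ> inv_into U' \<phi>')"
      unfolding smooth_at_def car by auto
    note C' = maximal_chart[OF car(1) subsetD[OF max(1) c']]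
    note D' = maximal_chart[OF car(2) subsetD[OF max(2) d']]
    have evW: "\<forall>\<^sub>F y in nhds p. y \<in> W"
      using W by (intro eventually_nhds_in_open) auto
    have p: "p \<in> U'" "f p \<in> V'"
      using W by auto
    have via: "smooth_via \<phi>' (\<lambda>x. \<psi>' (f x)) p"
      by (rule smooth_via_on[OF _ evW W(3) C'(6)[OF p(1)] C'(2)]) (use sm in \<open>simp add: o_def\<close>)
    have "((\<lambda>x. inv_into V' \<psi>' (\<psi>' (f x))) \<longlongrightarrow> inv_into V' \<psi>' (\<psi>' (f p))) (nhds p)"
    proof (rule continuous_on_tendsto_compose[OF D'(4)])
      show "filterlim (\<lambda>x. \<psi>' (f x)) (nhds (\<psi>' (f p))) (nhds p)"
        by (rule smooth_via_continuous[OF via C'(6)[OF p(1)]])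
      show "\<forall>\<^sub>F x in nhds p. \<psi>' (f x) \<in> \<psi>' ` V'"
        using evW by eventually_elim (use W in auto)
    qed (use p in auto)
    moreover have "\<forall>\<^sub>F x in nhds p. inv_into V' \<psi>' (\<psi>' (f x)) = f x"
      using evW by eventually_elim (use W D'(2) in \<open>auto simp: inv_into_f_f\<close>)
    ultimately have lim: "filterlim f (nhds (f p)) (nhds p)"
      using filterlim_cong[OF refl refl] D'(2) p by (simp add: inv_into_f_f cong: filterlim_cong)
    have "smooth_via \<phi> \<phi>' p"
      by (rule chart_change[OF A c(1) subsetD[OF max(1) c'] c(2) p(1)])
    moreover have "smooth_via (\<lambda>x. \<psi>' (f x)) (\<lambda>x. \<psi> (f x)) p"
      by (rule smooth_via_comp[OF chart_change[OF B subsetD[OF max(2) d'] d(1) p(2) d(2)] lim])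
    ultimately show ?R
      using lim smooth_via_trans[OF smooth_via_trans[OF _ via]] by simp
  }
  {
    assume R: ?R
    obtain U' \<phi>' where c': "(U', \<phi>') \<in> A" "(U', \<phi>') \<in> maximal_atlas A" "p \<in> U'"
      using chart_at[OF A] .
    obtain V' \<psi>' where d': "(V', \<psi>') \<in> B" "(V', \<psi>') \<in> maximal_atlas B" "f p \<in> V'"
      using chart_at[OF B] .
    note C' = maximal_chart[OF car(1) c'(2)]
    note D' = maximal_chart[OF car(2) d'(2)]
    have "smooth_via (\<lambda>x. \<psi> (f x)) (\<lambda>x. \<psi>' (f x)) p"
      using smooth_via_comp[where f = f, OF chart_change[OF B d(1) d'(2) d(2) d'(3)]] R by simp
    then have "smooth_via \<phi>' (\<lambda>x. \<psi>' (f x)) p"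
      using smooth_via_trans[OF smooth_via_trans[OF chart_change[OF A c'(2) c(1) c'(3) c(2)]]] R by blast
    then obtain \<Omega> F where F: "open \<Omega>" "\<And>k. Ck_on k \<Omega> F" "\<forall>\<^sub>F y in nhds p. \<phi>' y \<in> \<Omega>"
        "\<forall>\<^sub>F y in nhds p. \<psi>' (f y) = F (\<phi>' y)"
      by (elim smooth_viaE) (rule that)
    have "\<forall>\<^sub>F y in nhds p. f y \<in> V'"
      using R eventually_compose_filterlim[OF D'(7)[OF d'(3)], of f "nhds p"] by simp
    then have "\<forall>\<^sub>F y in nhds p. \<phi>' y \<in> \<Omega> \<and> \<psi>' (f y) = F (\<phi>' y) \<and> f y \<in> V' \<and> y \<in> U'"
      using F(3,4) C'(7)[OF c'(3)] by eventually_elim simp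
    then obtain W where W: "open W" "p \<in> W" "\<And>y. y \<in> W \<Longrightarrow> \<phi>' y \<in> \<Omega> \<and> \<psi>' (f y) = F (\<phi>' y) \<and> f y \<in> V' \<and> y \<in> U'"
      unfolding eventually_nhds by blast
    have "smooth_on (\<phi>' ` W) (\<psi>' \<circ> f \<circ> inv_into U' \<phi>')"
      unfolding smooth_on_def
      by (intro ballI exI[of _ \<Omega>] exI[of _ F] conjI allI F)
        (use W C'(2) in \<open>auto simp: inv_into_f_f\<close>)
    then show ?L
      unfolding smooth_at_def car
      by (intro bexI[OF _ c'(1)] bexI[OF _ d'(1)] case_prodI exI[of _ W] conjI) (use W in auto)
  }
qed

lemma global_euclidean: "global_atlas (euclidean_atlas :: ('e::euclidean_space, 'e) chart set)"
  and euclidean_chart: "(UNIV, \<lambda>x. x) \<in> maximal_atlas (euclidean_atlas :: ('e::euclidean_space, 'e) chart set)"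
proof -
  have "local_chart DIM('e) UNIV (UNIV :: 'e set, id :: 'e \<Rightarrow> 'e)"
    by (auto simp: local_chart_def intro!: exI[of _ UNIV] exI[of _ id] homeomorphismI)
  moreover have "smooth_transition (UNIV, id) (UNIV, id :: 'e \<Rightarrow> 'e)"
    unfolding smooth_transition_def smooth_on_def
    by (auto intro!: exI[of _ UNIV] exI[of _ "\<lambda>x. x"] Ck_on_ident simp: inv_id[unfolded id_def] id_def)
  moreover have "atlas_carrier (euclidean_atlas :: ('e, 'e) chart set) = UNIV"
    by (simp add: atlas_carrier_def euclidean_atlas_def)
  ultimately have "smooth_manifold DIM('e) (euclidean_atlas :: ('e, 'e) chart set)"
    by (simp add: smooth_manifold_def euclidean_atlas_def)
  then show "global_atlas (euclidean_atlas :: ('e, 'e) chart set)"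
    using \<open>atlas_carrier euclidean_atlas = UNIV\<close> by (auto simp: global_atlas_def)
  show "(UNIV, \<lambda>x. x) \<in> maximal_atlas (euclidean_atlas :: ('e, 'e) chart set)"
    using atlas_subset_maximal[OF \<open>smooth_manifold DIM('e) euclidean_atlas\<close>]
    by (simp add: euclidean_atlas_def id_def)
qed

lemma smooth_at_euclidean_iff:
  assumes A: "global_atlas A" and c: "(U, \<phi>) \<in> maximal_atlas A" "p \<in> U"
  shows "smooth_at A euclidean_atlas f p \<longleftrightarrow> smooth_via \<phi> f p"
proof -
  have "filterlim \<phi> (nhds (\<phi> p)) (nhds p)"
    using A c maximal_chart(6) by (auto simp: global_atlas_def)
  then show ?thesis
    using smooth_at_iff[OF A global_euclidean c euclidean_chart] smooth_via_continuous by auto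
qed

lemma smooth_at_curve_iff:
  assumes A: "global_atlas A" and c: "(U, \<phi>) \<in> maximal_atlas A" "c t \<in> U"
  shows "smooth_at euclidean_atlas A c t \<longleftrightarrow>
    filterlim c (nhds (c t)) (nhds t) \<and> smooth_via (\<lambda>x. x) (\<lambda>s. \<phi> (c s)) t"
  using smooth_at_iff[where f = c, OF global_euclidean A euclidean_chart _ c] by simp

lemma smooth_at_continuous:
  assumes A: "global_atlas A" and B: "global_atlas B" and f: "smooth_at A B f p"
  shows "filterlim f (nhds (f p)) (nhds p)"
proof -
  obtain U \<phi> where c: "(U, \<phi>) \<in> maximal_atlas A" "p \<in> U"
    using chart_at[OF A] .
  obtain V \<psi> where d: "(V, \<psi>) \<in> maximal_atlas B" "f p \<in> V"
    using chart_at[OF B] .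
  show ?thesis
    using f smooth_at_iff[where f = f, OF A B c d] by blast
qed

lemma smooth_at_compose:
  assumes A: "global_atlas A" and B: "global_atlas B" and C: "global_atlas C"
    and f: "smooth_at A B f p" and g: "smooth_at B C g (f p)"
  shows "smooth_at A C (\<lambda>x. g (f x)) p"
proof -
  obtain U \<phi> where c: "(U, \<phi>) \<in> maximal_atlas A" "p \<in> U"
    using chart_at[OF A] .
  obtain V \<psi> where d: "(V, \<psi>) \<in> maximal_atlas B" "f p \<in> V"
    using chart_at[OF B] .
  obtain W \<theta> where e: "(W, \<theta>) \<in> maximal_atlas C" "g (f p) \<in> W"
    using chart_at[OF C] .
  have F: "filterlim f (nhds (f p)) (nhds p)" "smooth_via \<phi> (\<lambda>x. \<psi> (f x)) p"
    using f smooth_at_iff[where f = f, OF A B c d] by auto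
  have G: "filterlim g (nhds (g (f p))) (nhds (f p))" "smooth_via \<psi> (\<lambda>x. \<theta> (g x)) (f p)"
    using g smooth_at_iff[where f = g, OF B C d e] by auto
  have "smooth_via \<phi> (\<lambda>x. \<theta> (g (f x))) p"
    using smooth_via_trans[OF F(2) smooth_via_comp[OF G(2) F(1)]] .
  moreover have "filterlim (\<lambda>x. g (f x)) (nhds (g (f p))) (nhds p)"
    using filterlim_compose[OF G(1) F(1)] .
  ultimately show ?thesis
    using smooth_at_iff[where f = "\<lambda>x. g (f x)", OF A C c e] by simp
qed

section \<open>Velocities and tangent spaces\<close>

lemma smooth_curve_in_smooth: "smooth_curve_in A S p c \<Longrightarrow> smooth_at euclidean_atlas A c 0"
  by (auto simp: smooth_curve_in_def)

lemma smooth_curve_in_eventually: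
  assumes "smooth_curve_in A S p c"
  shows "\<forall>\<^sub>F t in nhds 0. c t \<in> S"
proof -
  obtain e where e: "e > 0" "\<And>t. t \<in> {-e<..<e} \<Longrightarrow> c t \<in> S"
    using assms by (auto simp: smooth_curve_in_def)
  have "\<forall>\<^sub>F t in nhds 0. t \<in> {-e<..<e}"
    by (rule eventually_nhds_in_open) (use e in auto)
  then show ?thesis
    by eventually_elim (use e in auto)
qed

lemma smooth_curve_inI:
  fixes c :: "real \<Rightarrow> 'a::topological_space"
  assumes "c 0 = p" "\<forall>\<^sub>F t in nhds 0. c t \<in> S \<and> smooth_at euclidean_atlas A c t"
  shows "smooth_curve_in A S p c"
proof -
  obtain T where "open T" "0 \<in> T" and T: "\<And>t. t \<in> T \<Longrightarrow> c t \<in> S \<and> smooth_at euclidean_atlas A c t"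
    using assms(2) unfolding eventually_nhds by blast
  then obtain e where "e > 0" "ball 0 e \<subseteq> T"
    using open_contains_ball by blast
  then show ?thesis
    using assms(1) T by (auto simp: smooth_curve_in_def ball_eq_greaterThanLessThan intro!: exI[of _ e])
qed

lemma smooth_curve_in_smooth_eventually:
  assumes "smooth_curve_in A S p c"
  shows "\<forall>\<^sub>F t in nhds 0. smooth_at euclidean_atlas A c t"
proof -
  obtain e where e: "e > 0" "\<And>t. t \<in> {-e<..<e} \<Longrightarrow> smooth_at euclidean_atlas A c t"
    using assms by (auto simp: smooth_curve_in_def)
  have "\<forall>\<^sub>F t in nhds 0. t \<in> {-e<..<e}"
    by (rule eventually_nhds_in_open) (use e in auto)
  then show ?thesis
    by eventually_elim (use e in auto)
qed

lemma smooth_curve_in_continuous: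
  assumes "global_atlas A" "smooth_curve_in A S p c"
  shows "filterlim c (nhds p) (nhds 0)"
  using smooth_at_continuous[OF global_euclidean assms(1) smooth_curve_in_smooth[OF assms(2)]] assms(2)
  by (simp add: smooth_curve_in_def)

lemma smooth_curve_in_mono:
  assumes "smooth_curve_in A S p c" "S \<subseteq> T"
  shows "smooth_curve_in A T p c"
  using assms unfolding smooth_curve_in_def by blast

lemma velocity_in_tangent_space: "smooth_curve_in A S p c \<Longrightarrow> velocity A c \<in> tangent_space A S p"
  by (auto simp: tangent_space_def)

lemma tangent_spaceE:
  assumes "v \<in> tangent_space A S p"
  obtains c where "smooth_curve_in A S p c" "velocity A c = v"
  using assms that by (auto simp: tangent_space_def)

lemma representing_curve:
  assumes "v \<in> tangent_space A S p"
  shows "smooth_curve_in A S p (representing_curve A S p v)"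
    and "velocity A (representing_curve A S p v) = v"
proof -
  obtain c where "smooth_curve_in A S p c \<and> velocity A c = v"
    using assms by (elim tangent_spaceE) (rule that, simp)
  then have "smooth_curve_in A S p (representing_curve A S p v) \<and> velocity A (representing_curve A S p v) = v"
    unfolding representing_curve_def by (rule someI[where P = "\<lambda>c. smooth_curve_in A S p c \<and> velocity A c = v"])
  then show "smooth_curve_in A S p (representing_curve A S p v)"
    and "velocity A (representing_curve A S p v) = v"
    by auto
qed

subsection \<open>Velocities in a chart\<close>

lemma chart_curve_derivative:
  assumes A: "global_atlas A" and c: "(U, \<phi>) \<in> maximal_atlas A" "c t \<in> U"
    and sm: "smooth_at euclidean_atlas A c t"
  shows "((\<lambda>s. \<phi> (c s)) has_vector_derivative vector_derivative (\<lambda>s. \<phi> (c s)) (at t)) (at t)"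
proof -
  have "smooth_via (\<lambda>x. x) (\<lambda>s. \<phi> (c s)) t"
    using sm smooth_at_curve_iff[where c = c, OF A c] by simp
  then show ?thesis
    using smooth_via_ident_differentiable vector_derivative_works by blast
qed

text \<open>The chain rule: the derivative of \<open>h\<close> along a curve depends linearly on the coordinate velocity, with a
  linear map \<open>l\<close> common to all curves through \<open>p\<close>.\<close>

lemma chart_derivative:
  fixes h :: "'a::topological_space \<Rightarrow> real"
  assumes A: "global_atlas A" and c: "(U, \<phi>) \<in> maximal_atlas A" "p \<in> U"
    and h: "smooth_at A euclidean_atlas h p"
  obtains l where "linear l"
    and "\<And>c. c 0 = p \<Longrightarrow> smooth_at euclidean_atlas A c 0 \<Longrightarrow>
      ((\<lambda>t. h (c t)) has_real_derivative l (vector_derivative (\<lambda>t. \<phi> (c t)) (at 0))) (at 0)"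
proof -
  have "smooth_via \<phi> h p"
    using h smooth_at_euclidean_iff[OF A c] by blast
  then obtain \<Omega> F where F: "open \<Omega>" "\<phi> p \<in> \<Omega>" "\<And>k. Ck_on k \<Omega> F"
      "\<forall>\<^sub>F y in nhds p. h y = F (\<phi> y)"
    by (elim smooth_viaE) (rule that)
  define D where "D = frechet_derivative F (at (\<phi> p))"
  have D: "(F has_derivative D) (at (\<phi> p))"
    unfolding D_def using Ck_on_Suc_has_derivative[OF F(3) F(2)] .
  have "((\<lambda>t. h (c t)) has_real_derivative D (vector_derivative (\<lambda>t. \<phi> (c t)) (at 0))) (at 0)"
    if c0: "c 0 = p" and sm: "smooth_at euclidean_atlas A c 0" for c
  proof -
    define v where "v = vector_derivative (\<lambda>t. \<phi> (c t)) (at 0)"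
    have v: "((\<lambda>t. \<phi> (c t)) has_derivative (\<lambda>s. s *\<^sub>R v)) (at 0)"
      using chart_curve_derivative[OF A c(1) _ sm] c0 c(2) by (simp add: v_def has_vector_derivative_def)
    have "((\<lambda>t. F (\<phi> (c t))) has_derivative (\<lambda>s. D (s *\<^sub>R v))) (at 0)"
      by (rule has_derivative_compose[OF v]) (use D c0 in simp)
    moreover have "D (s *\<^sub>R v) = D v * s" for s
      using linear_cmul[OF has_derivative_linear[OF D]] by simp
    ultimately have "((\<lambda>t. F (\<phi> (c t))) has_real_derivative D v) (at 0)"
      by (simp add: has_field_derivative_def)
    moreover have "\<forall>\<^sub>F t in nhds 0. F (\<phi> (c t)) = h (c t)"
      using eventually_compose_filterlim[OF F(4)] smooth_at_continuous[OF global_euclidean A sm] c0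
      by (force elim: eventually_mono)
    ultimately show ?thesis
      unfolding v_def[symmetric] by (subst (asm) DERIV_cong_ev[OF refl _ refl])
  qed
  then show ?thesis
    using that[of D] has_derivative_linear[OF D] by blast
qed

lemma velocity_apply:
  assumes A: "global_atlas A" and c: "smooth_at euclidean_atlas A c 0"
    and h: "smooth_at A euclidean_atlas h (c 0)"
  shows "((\<lambda>t. h (c t)) has_real_derivative velocity A c h) (at 0)"
proof -
  obtain U \<phi> where "(U, \<phi>) \<in> maximal_atlas A" "c 0 \<in> U"
    using chart_at[OF A] .
  from chart_derivative[OF A this h] obtain d where "((\<lambda>t. h (c t)) has_real_derivative d) (at 0)"
    using c by metis
  then show ?thesis
    using h by (simp add: velocity_def DERIV_imp_deriv)
qed

text \<open>Velocities, as operators on functions, inherit linear relations from coordinate velocities. Functions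
  that are not smooth at \<open>p\<close> cause no trouble, since every velocity sends them to \<open>0\<close>.\<close>

lemma velocity_lincomb:
  assumes A: "global_atlas A" and c: "(U, \<phi>) \<in> maximal_atlas A" "p \<in> U"
    and x: "smooth_at euclidean_atlas A x 0" "x 0 = p"
    and y: "smooth_at euclidean_atlas A y 0" "y 0 = p"
    and z: "smooth_at euclidean_atlas A z 0" "z 0 = p"
    and eq: "vector_derivative (\<lambda>t. \<phi> (z t)) (at 0) =
      a *\<^sub>R vector_derivative (\<lambda>t. \<phi> (x t)) (at 0) + b *\<^sub>R vector_derivative (\<lambda>t. \<phi> (y t)) (at 0)"
  shows "velocity A z = a *\<^sub>R velocity A x + b *\<^sub>R velocity A y"
proof
  fix h
  show "velocity A z h = (a *\<^sub>R velocity A x + b *\<^sub>R velocity A y) h"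
  proof (cases "smooth_at A euclidean_atlas h p")
    case True
    from chart_derivative[OF A c True] obtain l where l: "linear l"
      "\<And>c. c 0 = p \<Longrightarrow> smooth_at euclidean_atlas A c 0 \<Longrightarrow>
        ((\<lambda>t. h (c t)) has_real_derivative l (vector_derivative (\<lambda>t. \<phi> (c t)) (at 0))) (at 0)"
      by metis
    have "velocity A c h = l (vector_derivative (\<lambda>t. \<phi> (c t)) (at 0))"
      if "c 0 = p" "smooth_at euclidean_atlas A c 0" for c
      using l(2)[OF that] True that by (simp add: velocity_def DERIV_imp_deriv)
    then show ?thesis
      using x y z eq by (simp add: linear_add[OF l(1)] linear_cmul[OF l(1)] scaleR_fun_def)
  next
    case False
    then show ?thesis
      using x y z by (simp add: velocity_def scaleR_fun_def)
  qed
qed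

lemma smooth_curve_of_coordinates:
  assumes A: "global_atlas A" and c: "(U, \<phi>) \<in> maximal_atlas A"
    and J: "open J" "t \<in> J" and \<gamma>: "\<And>k. Ck_on k J \<gamma>" "\<gamma> ` J \<subseteq> \<phi> ` U"
  shows "smooth_at euclidean_atlas A (\<lambda>s. inv_into U \<phi> (\<gamma> s)) t"
proof -
  have "atlas_carrier A = UNIV"
    using A by (simp add: global_atlas_def)
  note C = maximal_chart[OF this c]
  have ev: "\<forall>\<^sub>F s in nhds t. s \<in> J"
    using J by (rule eventually_nhds_in_open)
  have "inv_into U \<phi> (\<gamma> t) \<in> U"
    using \<gamma>(2) J(2) by (intro inv_into_into) blast
  moreover have "smooth_via (\<lambda>x. x) (\<lambda>s. \<phi> (inv_into U \<phi> (\<gamma> s))) t"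
  proof (rule smooth_via_cong)
    show "smooth_via (\<lambda>x. x) \<gamma> t"
      using J \<gamma>(1) unfolding smooth_via_ident_iff by blast
    show "\<forall>\<^sub>F s in nhds t. \<gamma> s = \<phi> (inv_into U \<phi> (\<gamma> s))"
      using ev by eventually_elim (use \<gamma>(2) in \<open>auto simp: f_inv_into_f\<close>)
  qed
  moreover have "filterlim (\<lambda>s. inv_into U \<phi> (\<gamma> s)) (nhds (inv_into U \<phi> (\<gamma> t))) (nhds t)"
  proof (rule continuous_on_tendsto_compose[OF C(4)])
    show "filterlim \<gamma> (nhds (\<gamma> t)) (nhds t)"
      by (rule continuous_on_tendsto_compose[OF Ck_on_imp_continuous_on[OF \<gamma>(1)[of 0]] filterlim_ident J(2) ev])
    show "\<forall>\<^sub>F s in nhds t. \<gamma> s \<in> \<phi> ` U"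
      using ev by eventually_elim (use \<gamma>(2) in auto)
  qed (use \<gamma>(2) J in auto)
  ultimately show ?thesis
    using smooth_at_curve_iff[where c = "\<lambda>s. inv_into U \<phi> (\<gamma> s)", OF A c] by simp
qed

subsection \<open>Tangent spaces are vector spaces\<close>

text \<open>In the chart the submanifold \<open>S\<close> is the part of the subspace \<open>V\<close> inside the image. The inclusion of \<open>V\<close> in
  the model space \<open>M\<close> of the chart keeps lines in \<open>V\<close> inside the image for small times. The case
  \<open>S = UNIV\<close> is included, with \<open>V = M\<close>.\<close>

definition adapted_chart ::
    "('a::topological_space, 'e::euclidean_space) chart set \<Rightarrow> 'a set \<Rightarrow> 'a \<Rightarrow> 'a set \<Rightarrow> ('a \<Rightarrow> 'e) \<Rightarrow>
      'e set \<Rightarrow> bool" where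
  "adapted_chart A S p U \<phi> V \<longleftrightarrow> (U, \<phi>) \<in> maximal_atlas A \<and> p \<in> U \<and> p \<in> S \<and> subspace V \<and>
     \<phi> ` (U \<inter> S) = \<phi> ` U \<inter> V \<and> (\<exists>M. subspace M \<and> V \<subseteq> M \<and> openin (top_of_set M) (\<phi> ` U))"

lemma adapted_chart_UNIV:
  assumes A: "global_atlas A" and c: "(U, \<phi>) \<in> maximal_atlas A" "p \<in> U"
  obtains V where "adapted_chart A UNIV p U \<phi> V" "openin (top_of_set V) (\<phi> ` U)"
proof -
  obtain V where "subspace V" "openin (top_of_set V) (\<phi> ` U)"
    using maximal_chart(5)[OF _ c(1)] A by (auto simp: global_atlas_def)
  moreover from this have "\<phi> ` U \<subseteq> V"
    by (simp add: openin_contains_ball)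
  ultimately show ?thesis
    using that[of V] c by (auto simp: adapted_chart_def)
qed

lemma adapted_chart_submanifold:
  assumes A: "global_atlas A" and S: "embedded_submanifold A S" "p \<in> S"
  obtains U \<phi> V where "adapted_chart A S p U \<phi> V"
proof -
  obtain k c where c: "c \<in> maximal_atlas A" "p \<in> fst c" "slice_chart k S c"
    using S unfolding embedded_submanifold_def by blast
  obtain U \<phi> where [simp]: "c = (U, \<phi>)"
    by (cases c)
  obtain V where V: "subspace V" "V \<subseteq> span (\<phi> ` U)" "\<phi> ` (U \<inter> S) = \<phi> ` U \<inter> V"
    using c(3) by (auto simp: slice_chart_def)
  obtain M where M: "subspace M" "openin (top_of_set M) (\<phi> ` U)"
    using maximal_chart(5)[of A U \<phi>] A c(1) by (auto simp: global_atlas_def)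
  then have "V \<subseteq> M"
    using V(2) span_minimal[OF _ M(1)] by (meson openin_imp_subset order_trans)
  then show ?thesis
    using that[of U \<phi> V] V M c S(2) by (auto simp: adapted_chart_def)
qed

lemma straight_curve:
  assumes A: "global_atlas A" and ac: "adapted_chart A S p U \<phi> V" and w: "w \<in> V"
  obtains c where "smooth_curve_in A S p c" "vector_derivative (\<lambda>t. \<phi> (c t)) (at 0) = w"
proof -
  from ac obtain M where c: "(U, \<phi>) \<in> maximal_atlas A" "p \<in> U" "p \<in> S" and V: "subspace V"
      "\<phi> ` (U \<inter> S) = \<phi> ` U \<inter> V" and M: "subspace M" "V \<subseteq> M" "openin (top_of_set M) (\<phi> ` U)"
    unfolding adapted_chart_def by blast
  have "atlas_carrier A = UNIV"
    using A by (simp add: global_atlas_def)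
  note C = maximal_chart[OF this c(1)]
  obtain O' where O': "open O'" "\<phi> ` U = M \<inter> O'"
    using M(3) by (auto simp: openin_open)
  define \<gamma> where "\<gamma> t = \<phi> p + t *\<^sub>R w" for t
  have pV: "\<phi> p \<in> V"
    using c V(2) by blast
  have \<gamma>V: "\<gamma> t \<in> V" for t
    unfolding \<gamma>_def by (intro subspace_add subspace_scale V pV w)
  define J where "J = \<gamma> -` O'"
  have "continuous_on UNIV \<gamma>"
    unfolding \<gamma>_def by (intro continuous_intros)
  then have J: "open J"
    unfolding J_def using open_vimage[OF O'(1)] by blast
  have J0: "0 \<in> J"
    using c(2) O'(2) by (auto simp: J_def \<gamma>_def)
  have sub: "\<gamma> ` J \<subseteq> \<phi> ` U"
    using O'(2) \<gamma>V M(2) by (auto simp: J_def)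
  have lin: "bounded_linear (\<lambda>t. t *\<^sub>R w)"
    by (intro bounded_linear_scaleR_left)
  have \<gamma>Ck: "Ck_on k J \<gamma>" for k
    unfolding \<gamma>_def using J by (intro Ck_on_add Ck_on_const Ck_on_bounded_linear[OF lin] Ck_on_ident)
  define x where "x t = inv_into U \<phi> (\<gamma> t)" for t
  have \<phi>x: "\<phi> (x t) = \<gamma> t" if "t \<in> J" for t
    using sub that by (auto simp: x_def f_inv_into_f)
  have evJ: "\<forall>\<^sub>F t in nhds 0. t \<in> J"
    using J J0 by (rule eventually_nhds_in_open)
  have xS: "x t \<in> S" if "t \<in> J" for t
  proof -
    have "x t \<in> U"
      unfolding x_def by (intro inv_into_into) (use sub that in blast)
    moreover have "\<gamma> t \<in> \<phi> ` (U \<inter> S)"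
      using V(2) \<gamma>V sub that by auto
    then obtain y where "y \<in> U \<inter> S" "\<phi> y = \<gamma> t"
      by auto
    ultimately show ?thesis
      using inj_onD[OF C(2), of "x t" y] \<phi>x[OF that] by simp
  qed
  have "smooth_curve_in A S p x"
  proof (rule smooth_curve_inI)
    show "x 0 = p"
      using c(2) C(2) by (simp add: x_def \<gamma>_def inv_into_f_f)
    show "\<forall>\<^sub>F t in nhds 0. x t \<in> S \<and> smooth_at euclidean_atlas A x t"
      using evJ
    proof eventually_elim
      case (elim t)
      have "smooth_at euclidean_atlas A x t"
        unfolding x_def by (rule smooth_curve_of_coordinates[OF A c(1) J elim \<gamma>Ck sub])
      then show ?case
        using xS[OF elim] by simp
    qed
  qed
  moreover have "((\<lambda>t. \<phi> (x t)) has_vector_derivative w) (at 0)"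
  proof (rule has_vector_derivative_transform_within_open[OF _ J J0])
    show "(\<gamma> has_vector_derivative w) (at 0)"
      unfolding \<gamma>_def by (auto intro!: derivative_eq_intros)
  qed (simp add: \<phi>x)
  ultimately show ?thesis
    using that vector_derivative_at by blast
qed

text \<open>A linear projection onto \<open>V\<close> fixes the curve, hence its derivative.\<close>

lemma vector_derivative_in_subspace:
  fixes f :: "real \<Rightarrow> 'e::euclidean_space"
  assumes V: "subspace V" and f: "(f has_vector_derivative d) (at t)" and ev: "\<forall>\<^sub>F s in nhds t. f s \<in> V"
  shows "d \<in> V"
proof -
  have "linear (\<lambda>x::'e. x)"
    by (rule linear_ident)
  from linear_exists_left_inverse_on[OF this V]
  obtain P where P: "range P \<subseteq> V" "linear P" "\<And>y. y \<in> V \<Longrightarrow> P y = y"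
    by auto
  have "((\<lambda>s. P (f s)) has_vector_derivative P d) (at t)"
    using bounded_linear.has_vector_derivative[OF _ f] P(2) by (simp add: linear_conv_bounded_linear)
  moreover obtain T where "open T" "t \<in> T" "\<And>s. s \<in> T \<Longrightarrow> f s \<in> V"
    using ev unfolding eventually_nhds by blast
  then have "(f has_vector_derivative P d) (at t)" if "((\<lambda>s. P (f s)) has_vector_derivative P d) (at t)"
    using has_vector_derivative_transform_within_open[OF that] P(3) by metis
  ultimately have "P d = d"
    using vector_derivative_unique_at[OF _ f] by blast
  then show ?thesis
    using P(1) by (metis rangeI subsetD)
qed

lemma coordinate_velocity_in:
  assumes A: "global_atlas A" and ac: "adapted_chart A S p U \<phi> V" and x: "smooth_curve_in A S p x"
  shows "vector_derivative (\<lambda>t. \<phi> (x t)) (at 0) \<in> V"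
proof -
  from ac have c: "(U, \<phi>) \<in> maximal_atlas A" "p \<in> U" and V: "subspace V" "\<phi> ` (U \<inter> S) = \<phi> ` U \<inter> V"
    unfolding adapted_chart_def by blast+
  have x0: "x 0 = p"
    using x by (simp add: smooth_curve_in_def)
  have car: "atlas_carrier A = UNIV"
    using A by (simp add: global_atlas_def)
  have "\<forall>\<^sub>F t in nhds 0. x t \<in> U"
    using eventually_compose_filterlim[OF maximal_chart(7)[OF car c] smooth_curve_in_continuous[OF A x]] .
  then have "\<forall>\<^sub>F t in nhds 0. \<phi> (x t) \<in> V"
    using smooth_curve_in_eventually[OF x] by eventually_elim (use V(2) in blast)
  then show ?thesis
    using vector_derivative_in_subspace[OF V(1) chart_curve_derivative[OF A c(1) _ smooth_curve_in_smooth[OF x]]]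
      x0 c(2) by simp
qed

text \<open>By \<open>straight_curve\<close> and \<open>coordinate_velocity_in\<close>, the coordinate velocities of curves in \<open>S\<close> are exactly
  the vectors of \<open>V\<close>, so linear combinations of velocities are again velocities.\<close>

lemma subspace_tangent_space:
  assumes A: "global_atlas A" and ac: "adapted_chart A S p U \<phi> V"
  shows "subspace (tangent_space A S p)"
proof -
  from ac have c: "(U, \<phi>) \<in> maximal_atlas A" "p \<in> U" and V: "subspace V"
    unfolding adapted_chart_def by blast+
  have start: "x 0 = p" if "smooth_curve_in A S p x" for x
    using that by (simp add: smooth_curve_in_def)
  have comb: "a *\<^sub>R v + b *\<^sub>R w \<in> tangent_space A S p"
    if v: "v \<in> tangent_space A S p" and w: "w \<in> tangent_space A S p" for v w a b
  proof -
    obtain x where x: "smooth_curve_in A S p x" "velocity A x = v"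
      using v by (rule tangent_spaceE)
    obtain y where y: "smooth_curve_in A S p y" "velocity A y = w"
      using w by (rule tangent_spaceE)
    define d where "d = a *\<^sub>R vector_derivative (\<lambda>t. \<phi> (x t)) (at 0) + b *\<^sub>R vector_derivative (\<lambda>t. \<phi> (y t)) (at 0)"
    have "d \<in> V"
      unfolding d_def by (intro subspace_add subspace_scale V coordinate_velocity_in[OF A ac] x y)
    then obtain z where z: "smooth_curve_in A S p z" "vector_derivative (\<lambda>t. \<phi> (z t)) (at 0) = d"
      using straight_curve[OF A ac] by metis
    have "velocity A z = a *\<^sub>R velocity A x + b *\<^sub>R velocity A y"
      by (rule velocity_lincomb[OF A c]) (use x y z start smooth_curve_in_smooth d_def in auto)
    then show ?thesis
      using velocity_in_tangent_space[OF z(1)] x y by simp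
  qed
  obtain x where "smooth_curve_in A S p x"
    using straight_curve[OF A ac subspace_0[OF V]] by metis
  then have x: "velocity A x \<in> tangent_space A S p"
    by (rule velocity_in_tangent_space)
  show ?thesis
    unfolding subspace_def using comb[OF x x, of 0 0] comb[of _ _ 1 1] comb[of _ _ _ 0] by force
qed

subsection \<open>Tangent maps\<close>

text \<open>Smoothness at \<open>p\<close> of a map that matters on \<open>S\<close> only, expressed through pullbacks of functions. This is
  what the tangent map needs: its value on \<open>h\<close> is the value of the tangent vector on the extension \<open>K\<close>.\<close>

definition smooth_along ::
    "('a::topological_space, 'e::euclidean_space) chart set \<Rightarrow> 'a set \<Rightarrow>
     ('b::topological_space, 'f::euclidean_space) chart set \<Rightarrow> ('a \<Rightarrow> 'b) \<Rightarrow> 'a \<Rightarrow> bool" where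
  "smooth_along A S B f p \<longleftrightarrow> (\<forall>h :: 'b \<Rightarrow> real. smooth_at B euclidean_atlas h (f p) \<longrightarrow>
     (\<exists>K. smooth_at A euclidean_atlas K p \<and> (\<forall>\<^sub>F x in nhds p. x \<in> S \<longrightarrow> h (f x) = K x)))"

lemma smooth_along_smooth_at:
  assumes "global_atlas A" "global_atlas B" "smooth_at A B f p"
  shows "smooth_along A S B f p"
  unfolding smooth_along_def
  using smooth_at_compose[OF assms(1,2) global_euclidean assms(3)] by (metis (mono_tags, lifting) eventuallyI)

lemma velocity_image_apply:
  assumes A: "global_atlas A" and x: "smooth_curve_in A S p x"
    and h: "smooth_at B euclidean_atlas h (f p)" and K: "smooth_at A euclidean_atlas K p"
    and eq: "\<forall>\<^sub>F y in nhds p. y \<in> S \<longrightarrow> h (f y) = K y"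
  shows "velocity B (\<lambda>t. f (x t)) h = velocity A x K"
proof -
  have x0: "x 0 = p"
    using x by (simp add: smooth_curve_in_def)
  have "\<forall>\<^sub>F t in nhds 0. x t \<in> S \<longrightarrow> h (f (x t)) = K (x t)"
    using eventually_compose_filterlim[OF eq smooth_curve_in_continuous[OF A x]] .
  then have "\<forall>\<^sub>F t in nhds 0. h (f (x t)) = K (x t)"
    using smooth_curve_in_eventually[OF x] by eventually_elim simp
  then have "deriv (\<lambda>t. h (f (x t))) 0 = deriv (\<lambda>t. K (x t)) 0"
    by (intro deriv_cong_ev) auto
  then show ?thesis
    using h K x0 by (simp add: velocity_def)
qed

lemma tangent_map_apply:
  assumes A: "global_atlas A" and v: "v \<in> tangent_space A S p"
    and h: "smooth_at B euclidean_atlas h (f p)" and K: "smooth_at A euclidean_atlas K p"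
    and eq: "\<forall>\<^sub>F y in nhds p. y \<in> S \<longrightarrow> h (f y) = K y"
  shows "tangent_map A S B f p v h = v K"
  using velocity_image_apply[where f = f, OF A representing_curve(1)[OF v] h K eq] representing_curve(2)[OF v]
  by (simp add: tangent_map_def o_def)

lemma tangent_map_not_smooth:
  assumes "v \<in> tangent_space A S p" "\<not> smooth_at B euclidean_atlas h (f p)"
  shows "tangent_map A S B f p v h = 0"
  using representing_curve(1)[OF assms(1)] assms(2) by (simp add: tangent_map_def velocity_def smooth_curve_in_def)

text \<open>The curve chosen in the definition of the tangent map may be replaced by any other curve in \<open>S\<close> with the
  same velocity, because both sides evaluate that velocity on the same extension.\<close>

lemma tangent_map_velocity:
  assumes A: "global_atlas A" and f: "smooth_along A S B f p" and x: "smooth_curve_in A S p x"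
  shows "tangent_map A S B f p (velocity A x) = velocity B (\<lambda>t. f (x t))"
proof
  fix h
  have v: "velocity A x \<in> tangent_space A S p"
    using x by (rule velocity_in_tangent_space)
  show "tangent_map A S B f p (velocity A x) h = velocity B (\<lambda>t. f (x t)) h"
  proof (cases "smooth_at B euclidean_atlas h (f p)")
    case True
    then obtain K where K: "smooth_at A euclidean_atlas K p" "\<forall>\<^sub>F y in nhds p. y \<in> S \<longrightarrow> h (f y) = K y"
      using f unfolding smooth_along_def by blast
    show ?thesis
      using tangent_map_apply[where f = f, OF A v True K] velocity_image_apply[where f = f, OF A x True K] by simp
  next
    case False
    then show ?thesis
      using tangent_map_not_smooth[where f = f, OF v False] x by (simp add: velocity_def smooth_curve_in_def)
  qed
qed

lemma tangent_map_lincomb: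
  assumes A: "global_atlas A" and f: "smooth_along A S B f p" and v: "v \<in> tangent_space A S p"
    and w: "w \<in> tangent_space A S p" and vw: "a *\<^sub>R v + b *\<^sub>R w \<in> tangent_space A S p"
  shows "tangent_map A S B f p (a *\<^sub>R v + b *\<^sub>R w) = a *\<^sub>R tangent_map A S B f p v + b *\<^sub>R tangent_map A S B f p w"
proof
  fix h
  show "tangent_map A S B f p (a *\<^sub>R v + b *\<^sub>R w) h = (a *\<^sub>R tangent_map A S B f p v + b *\<^sub>R tangent_map A S B f p w) h"
  proof (cases "smooth_at B euclidean_atlas h (f p)")
    case True
    then obtain K where K: "smooth_at A euclidean_atlas K p" "\<forall>\<^sub>F y in nhds p. y \<in> S \<longrightarrow> h (f y) = K y"
      using f unfolding smooth_along_def by blast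
    show ?thesis
      using tangent_map_apply[where f = f, OF A v True K] tangent_map_apply[where f = f, OF A w True K]
        tangent_map_apply[where f = f, OF A vw True K] by (simp add: scaleR_fun_def)
  next
    case False
    show ?thesis
      using tangent_map_not_smooth[where f = f, OF v False] tangent_map_not_smooth[where f = f, OF w False]
        tangent_map_not_smooth[where f = f, OF vw False] by (simp add: scaleR_fun_def)
  qed
qed

section \<open>Smooth inverse functions and implicit curves\<close>

text \<open>The inverse given by the differentiable inverse function theorem has derivative \<open>(D (g y))\<inverse>\<close>. If \<open>g\<close> is of
  class \<open>C\<^sup>k\<close>, then so is this derivative, since inverting a family of linear maps preserves the class;
  hence \<open>g\<close> is of class \<open>C\<^sup>k\<^sup>+\<^sup>1\<close>.\<close>

lemma smooth_inverse_function:
  fixes f :: "'e::euclidean_space \<Rightarrow> 'e"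
  assumes U: "open U" "x0 \<in> U" and f: "\<And>k. Ck_on k U f"
    and id: "(f has_derivative (\<lambda>v. v)) (at x0)"
  obtains V W g where "open V" "x0 \<in> V" "V \<subseteq> U" "open W" "f x0 \<in> W" "homeomorphism V W f g"
    and "\<And>k. Ck_on k W g" and "(g has_derivative (\<lambda>v. v)) (at (f x0))"
proof -
  define D where "D x = frechet_derivative f (at x)" for x
  have D: "(f has_derivative D x) (at x)" if "x \<in> U" for x
    unfolding D_def by (rule Ck_on_Suc_has_derivative[OF f that])
  have D_Ck: "Ck_on k U (\<lambda>x. D x v)" for k v
    unfolding D_def by (rule Ck_on_Suc_derivative[OF f])
  define f' where "f' x = Blinfun (D x)" for x
  have f': "blinfun_apply (f' x) = D x" if "x \<in> U" for x
    unfolding f'_def by (rule bounded_linear_Blinfun_apply[OF has_derivative_bounded_linear[OF D[OF that]]])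
  have cont: "continuous_on U f'"
  proof (rule continuous_on_blinfun_componentwise)
    fix i :: 'e
    have "continuous_on U (\<lambda>x. D x i)"
      by (rule Ck_on_imp_continuous_on[OF D_Ck[of 0]])
    then show "continuous_on U (\<lambda>x. blinfun_apply (f' x) i)"
      using f' by (simp cong: continuous_on_cong)
  qed
  have "D x0 = (\<lambda>v. v)"
    using has_derivative_unique[OF D[OF U(2)] id] .
  then have "f' x0 = id_blinfun"
    using f'[OF U(2)] by (simp add: blinfun_eqI)
  then have "id_blinfun o\<^sub>L f' x0 = id_blinfun"
    by (simp add: blinfun_eqI)
  moreover have "(f has_derivative blinfun_apply (f' x)) (at x)" if "x \<in> U" for x
    using D[OF that] f'[OF that] by simp
  ultimately obtain V W g g' where V: "open V" "V \<subseteq> U" "x0 \<in> V" and W: "open W" "f x0 \<in> W"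
    and hom: "homeomorphism V W f g"
    and g': "\<And>y. y \<in> W \<Longrightarrow> (g has_derivative (g' y)) (at y)"
      "\<And>y. y \<in> W \<Longrightarrow> g' y = inv (blinfun_apply (f' (g y)))"
      "\<And>y. y \<in> W \<Longrightarrow> bij (blinfun_apply (f' (g y)))"
    using inverse_function_theorem[OF U(1) _ cont U(2)] by metis
  have gV: "g y \<in> V" if "y \<in> W" for y
    using hom that by (auto simp: homeomorphism_def)
  have gU: "g y \<in> U" if "y \<in> W" for y
    using gV V that by auto
  have NM: "g' y (D (g y) v) = v" and MN: "D (g y) (g' y v) = v" if "y \<in> W" for y v
    using g'(2,3)[OF that] f'[OF gU[OF that]] by (auto simp: bij_is_inj bij_is_surj surj_f_inv_f)
  have "Ck_on k W g" for k
  proof (induction k)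
    case 0
    then show ?case
      using hom by (simp add: homeomorphism_def)
  next
    case (Suc k)
    have "Ck_on k W (\<lambda>y. D (g y) v)" for v
      by (rule Ck_on_compose[OF W(1) U(1) _ Suc D_Ck]) (use gU in auto)
    note D_g = this
    have "Ck_on k W (\<lambda>y. g' y v)" for v
    proof (rule Ck_on_inverse_linear_family[OF W(1), where M = "\<lambda>y. D (g y)"])
      show "linear (D (g y))" "linear (g' y)" if "y \<in> W" for y
        using D[OF gU[OF that]] g'(1)[OF that] by (auto intro: has_derivative_linear)
    qed (simp_all add: NM MN D_g)
    then show ?case
      by (intro Ck_on_SucI[OF W(1) g'(1)])
  qed
  moreover have "(g has_derivative (\<lambda>v. v)) (at (f x0))"
  proof -
    have "g (f x0) = x0"
      using hom V by (auto simp: homeomorphism_def)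
    then have "g' (f x0) = (\<lambda>v. v)"
      using MN[OF W(2)] \<open>D x0 = (\<lambda>v. v)\<close> by auto
    then show ?thesis
      using g'(1)[OF W(2)] by simp
  qed
  ultimately show ?thesis
    using that V W hom by blast
qed

text \<open>A level curve of \<open>F\<close> inside the subspace \<open>A\<close> with prescribed velocity \<open>w\<close> in the kernel of \<open>D\<close>. With a right
  inverse \<open>\<sigma>\<close> of \<open>D\<close> on \<open>B\<close>, it is sought in the form \<open>x0 + t w + \<sigma> u(t)\<close>, where \<open>u(t)\<close> corrects the value of
  \<open>F\<close>.\<close>

lemma implicit_curve:
  fixes F :: "'e::euclidean_space \<Rightarrow> 'f::euclidean_space"
  assumes W: "open W" "x0 \<in> W" and F: "\<And>k. Ck_on k W F"
    and D: "(F has_derivative D) (at x0)"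
    and A: "subspace A" "x0 \<in> A" and B: "subspace B"
    and FAB: "\<And>x. x \<in> W \<inter> A \<Longrightarrow> F x \<in> B" and surj: "B \<subseteq> D ` A"
    and w: "w \<in> A" "D w = 0"
  obtains J c where "open J" "0 \<in> J" "\<And>k. Ck_on k J c" "c 0 = x0" "(c has_vector_derivative w) (at 0)"
    and "\<And>t. t \<in> J \<Longrightarrow> c t \<in> W \<inter> A" and "\<And>t. t \<in> J \<Longrightarrow> F (c t) = F x0"
proof -
  have linD: "linear D"
    using D by (rule has_derivative_linear)
  obtain \<sigma> where \<sigma>: "range \<sigma> \<subseteq> A" "linear \<sigma>" "\<And>y. y \<in> B \<Longrightarrow> D (\<sigma> y) = y"
    using linear_exists_right_inverse_on[OF linD A(1)] surj by (metis subsetD)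
  \<comment> \<open>The projection \<open>P\<close> lets the correction range over the whole type \<open>'f\<close> instead of \<open>B\<close>, so that the
    inverse function theorem applies; the summand \<open>u - P u\<close> of \<open>\<Xi>\<close> makes up for the complement of \<open>B\<close>.\<close>
  have "linear (\<lambda>x::'f. x)"
    by (rule linear_ident)
  from linear_exists_left_inverse_on[OF this B]
  obtain P where P: "range P \<subseteq> B" "linear P" "\<And>y. y \<in> B \<Longrightarrow> P y = y"
    by auto
  define l where "l = (\<lambda>(t::real, u). t *\<^sub>R w + \<sigma> (P u))"
  have "linear l"
    unfolding l_def by (rule linearI)
      (auto simp: linear_add[OF \<sigma>(2)] linear_add[OF P(2)] linear_cmul[OF \<sigma>(2)] linear_cmul[OF P(2)] algebra_simps)
  then have l: "bounded_linear l"
    by (simp add: linear_conv_bounded_linear)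
  have lA: "l z \<in> A" for z
    using w(1) \<sigma>(1) A(1) by (auto simp: l_def split: prod.splits intro!: subspace_add subspace_scale)
  define a where "a z = x0 + l z" for z
  have aA: "a z \<in> A" for z
    unfolding a_def by (intro subspace_add A lA)
  have a_Ck: "Ck_on k S a" if "open S" for k S
    unfolding a_def using that by (intro Ck_on_add Ck_on_const Ck_on_bounded_linear[OF l] Ck_on_ident)
  define S where "S = a -` W"
  have a_cont: "continuous_on UNIV a"
    using Ck_on_imp_continuous_on[OF a_Ck[OF open_UNIV]] .
  have S: "open S"
    using open_vimage[OF W(1) a_cont] by (simp add: S_def)
  have l0: "l 0 = 0"
    using \<open>linear l\<close> by (rule linear_0)
  have S0: "0 \<in> S"
    using W(2) by (simp add: S_def a_def l0)
  define p where "p z = P (snd z)" for z :: "real \<times> 'f"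
  have p: "bounded_linear p"
    unfolding p_def using bounded_linear_compose[OF _ bounded_linear_snd] P(2) by (simp add: linear_conv_bounded_linear)
  define \<Xi> where "\<Xi> z = (fst z, F (a z) + (- F x0 + (snd z + - p z)))" for z
  have Fa: "Ck_on k S (\<lambda>z. F (a z))" for k
    by (rule Ck_on_compose[OF S W(1) _ a_Ck[OF S] F]) (auto simp: S_def)
  have \<Xi>_Ck: "Ck_on k S \<Xi>" for k
    unfolding \<Xi>_def
    by (intro Ck_on_Pair Ck_on_add Fa Ck_on_const S Ck_on_bounded_linear[OF bounded_linear_fst]
        Ck_on_bounded_linear[OF bounded_linear_snd] Ck_on_bounded_linear[OF bounded_linear_minus[OF p]] Ck_on_ident)
  have "(a has_derivative l) (at z)" for z
    unfolding a_def by (auto intro!: derivative_eq_intros bounded_linear_imp_has_derivative l)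
  moreover have "a 0 = x0"
    by (simp add: a_def l0)
  ultimately have "((\<lambda>z. F (a z)) has_derivative (\<lambda>z. D (l z))) (at 0)"
    using has_derivative_compose[of a l 0 UNIV F D] D by simp
  then have "(\<Xi> has_derivative (\<lambda>z. (fst z, D (l z) + (0 + (snd z + - p z))))) (at 0)"
    unfolding \<Xi>_def
    by (intro has_derivative_Pair has_derivative_add has_derivative_const has_derivative_fst has_derivative_snd
        has_derivative_minus has_derivative_ident bounded_linear_imp_has_derivative[OF p])
  moreover have "D (l z) = p z" for z
  proof -
    have "D (l z) = fst z *\<^sub>R D w + D (\<sigma> (p z))"
      by (simp add: l_def p_def case_prod_beta linear_add[OF linD] linear_cmul[OF linD])
    moreover have "p z \<in> B"
      using P(1) by (auto simp: p_def)
    ultimately show ?thesis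
      using \<sigma>(3) w(2) by simp
  qed
  \<comment> \<open>Both \<open>D w = 0\<close> and \<open>D \<circ> \<sigma> = id\<close> on \<open>B\<close> enter here: the derivative at \<open>0\<close> is the identity.\<close>
  ultimately have "(\<Xi> has_derivative (\<lambda>z. z)) (at 0)"
    by simp
  then obtain V V' g where V: "open V" "0 \<in> V" "V \<subseteq> S" and V': "open V'" "\<Xi> 0 \<in> V'"
    and hom: "homeomorphism V V' \<Xi> g" and g: "\<And>k. Ck_on k V' g" "(g has_derivative (\<lambda>z. z)) (at (\<Xi> 0))"
    using smooth_inverse_function[OF S S0 \<Xi>_Ck] by metis
  have \<Xi>0: "\<Xi> 0 = 0"
    using linear_0[OF bounded_linear.linear[OF p]] by (intro prod_eqI) (simp_all add: \<Xi>_def \<open>a 0 = x0\<close>)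
  have g0: "g 0 = 0"
    using hom V(2) \<Xi>0 by (metis homeomorphism_apply1)
  define e where "e t = (t, 0 :: 'f)" for t :: real
  have e: "bounded_linear e"
    unfolding e_def by (intro bounded_linear_Pair bounded_linear_ident bounded_linear_zero)
  define J where "J = e -` V'"
  have J: "open J" "0 \<in> J"
    using open_vimage[OF V'(1) linear_continuous_on[OF e]] V'(2) \<Xi>0
    by (auto simp: J_def e_def zero_prod_def)
  define c where "c t = a (g (e t))" for t
  have eJ: "e t \<in> V'" if "t \<in> J" for t
    using that by (simp add: J_def)
  have gJ: "g (e t) \<in> S" if "t \<in> J" for t
    using hom V(3) eJ[OF that] by (auto simp: homeomorphism_def)
  have "Ck_on k J e" for k
    by (intro Ck_on_bounded_linear[OF e J(1)] Ck_on_ident J)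
  note e_Ck = this
  have ge: "Ck_on k J (\<lambda>t. g (e t))" for k
    by (rule Ck_on_compose[OF J(1) V'(1) _ e_Ck g(1)]) (use eJ in auto)
  have "Ck_on k J c" for k
    unfolding c_def by (rule Ck_on_compose[OF J(1) S _ ge a_Ck[OF S]]) (use gJ in auto)
  moreover have "c 0 = x0"
    by (simp add: c_def e_def g0 zero_prod_def[symmetric] \<open>a 0 = x0\<close>)
  moreover have "(c has_vector_derivative w) (at 0)"
  proof -
    have 1: "((\<lambda>t. g (e t)) has_derivative e) (at 0)"
    proof (rule has_derivative_compose[OF bounded_linear_imp_has_derivative[OF e]])
      show "(g has_derivative (\<lambda>z. z)) (at (e 0))"
        using g(2) \<Xi>0 by (simp add: linear_0[OF bounded_linear.linear[OF e]])
    qed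
    have "(c has_derivative (\<lambda>t. l (e t))) (at 0)"
      unfolding c_def by (rule has_derivative_compose[OF 1 \<open>\<And>z. (a has_derivative l) (at z)\<close>])
    moreover have "l (e t) = t *\<^sub>R w" for t
      by (simp add: l_def e_def linear_0[OF P(2)] linear_0[OF \<sigma>(2)])
    ultimately show ?thesis
      by (simp add: has_vector_derivative_def)
  qed
  moreover have cA: "c t \<in> W \<inter> A" if "t \<in> J" for t
    using gJ[OF that] aA by (auto simp: c_def S_def)
  moreover have "F (c t) = F x0" if "t \<in> J" for t
  proof -
    have "\<Xi> (g (e t)) = e t"
      using hom eJ[OF that] by (metis homeomorphism_apply2)
    then have eq: "F (c t) - F x0 + (snd (g (e t)) - p (g (e t))) = 0"
      by (simp add: \<Xi>_def e_def c_def algebra_simps)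
    have "F (c t) - F x0 \<in> B"
      using FAB[OF cA[OF that]] FAB[of x0] W A by (auto intro: subspace_diff[OF B])
    then have "P (F (c t) - F x0) = F (c t) - F x0"
      by (rule P(3))
    moreover have "P (p z) = p z" for z
      using P by (auto simp: p_def)
    ultimately have "P (F (c t) - F x0 + (snd (g (e t)) - p (g (e t)))) = F (c t) - F x0 + (p (g (e t)) - p (g (e t)))"
      unfolding linear_add[OF P(2)] linear_diff[OF P(2), of "snd _"] by (simp add: p_def)
    then show ?thesis
      using eq linear_0[OF P(2)] by simp
  qed
  ultimately show ?thesis
    using that J by blast
qed

section \<open>Products\<close>

lemma prod_chart:
  assumes "(U, \<phi>) \<in> A" "(V, \<psi>) \<in> B"
  shows "(U \<times> V, map_prod \<phi> \<psi>) \<in> prod_atlas A B"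
  using assms by (auto simp: prod_atlas_def)

lemma prod_atlas_carrier: "atlas_carrier (prod_atlas A B) = atlas_carrier A \<times> atlas_carrier B"
proof
  show "atlas_carrier A \<times> atlas_carrier B \<subseteq> atlas_carrier (prod_atlas A B)"
  proof clarify
    fix a b assume "a \<in> atlas_carrier A" "b \<in> atlas_carrier B"
    then obtain U \<phi> V \<psi> where "(U, \<phi>) \<in> A" "a \<in> U" "(V, \<psi>) \<in> B" "b \<in> V"
      by (auto simp: atlas_carrier_def)
    then show "(a, b) \<in> atlas_carrier (prod_atlas A B)"
      unfolding atlas_carrier_def by (intro UN_I[OF prod_chart]) auto
  qed
qed (force simp: atlas_carrier_def prod_atlas_def)

lemma local_chart_prod:
  assumes c: "local_chart n UNIV (U, \<phi>)" and d: "local_chart m UNIV (V, \<psi>)"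
  shows "local_chart (n + m) UNIV (U \<times> V, map_prod \<phi> \<psi>)"
proof -
  obtain M \<phi>' where U: "open U" and M: "subspace M" "dim M = n" "openin (top_of_set M) (\<phi> ` U)"
    and \<phi>': "homeomorphism U (\<phi> ` U) \<phi> \<phi>'"
    using c by (auto simp: local_chart_def)
  obtain M' \<psi>' where V: "open V" and M': "subspace M'" "dim M' = m" "openin (top_of_set M') (\<psi> ` V)"
    and \<psi>': "homeomorphism V (\<psi> ` V) \<psi> \<psi>'"
    using d by (auto simp: local_chart_def)
  have img: "map_prod \<phi> \<psi> ` (U \<times> V) = \<phi> ` U \<times> \<psi> ` V"
    by (auto simp: image_iff)
  have "homeomorphism (U \<times> V) (\<phi> ` U \<times> \<psi> ` V) (map_prod \<phi> \<psi>) (map_prod \<phi>' \<psi>')"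
  proof (rule homeomorphismI)
    show "continuous_on (U \<times> V) (map_prod \<phi> \<psi>)"
      unfolding map_prod_def case_prod_beta
      using homeomorphism_cont1[OF \<phi>'] homeomorphism_cont1[OF \<psi>']
      by (intro continuous_on_Pair continuous_on_compose2[OF _ continuous_on_fst]
          continuous_on_compose2[OF _ continuous_on_snd] continuous_on_id) auto
    show "continuous_on (\<phi> ` U \<times> \<psi> ` V) (map_prod \<phi>' \<psi>')"
      unfolding map_prod_def case_prod_beta
      using homeomorphism_cont2[OF \<phi>'] homeomorphism_cont2[OF \<psi>']
      by (intro continuous_on_Pair continuous_on_compose2[OF _ continuous_on_fst]
          continuous_on_compose2[OF _ continuous_on_snd] continuous_on_id) auto
  qed (use \<phi>' \<psi>' in \<open>auto simp: homeomorphism_def\<close>)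
  moreover have "openin (top_of_set (M \<times> M')) (\<phi> ` U \<times> \<psi> ` V)"
    using openin_Times[OF M(3) M'(3)] .
  moreover have "subspace (M \<times> M')" "dim (M \<times> M') = n + m"
    using subspace_Times[OF M(1) M'(1)] dim_Times[OF M(1) M'(1)] M(2) M'(2) by auto
  moreover have "open (U \<times> V)"
    using U V by (rule open_Times)
  ultimately show ?thesis
    unfolding local_chart_def by (auto simp: img intro!: exI[of _ "M \<times> M'"])
qed

lemma smooth_transition_prod:
  assumes "smooth_transition (U, \<phi>) (U', \<phi>')" "smooth_transition (V, \<psi>) (V', \<psi>')"
    and inj: "inj_on \<phi> U" "inj_on \<psi> V"
  shows "smooth_transition (U \<times> V, map_prod \<phi> \<psi>) (U' \<times> V', map_prod \<phi>' \<psi>')"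
  unfolding smooth_transition_def case_prod_conv smooth_on_def
proof
  fix z assume "z \<in> map_prod \<phi> \<psi> ` (U \<times> V \<inter> U' \<times> V')"
  then obtain x y where z: "z = (\<phi> x, \<psi> y)" "x \<in> U \<inter> U'" "y \<in> V \<inter> V'"
    by auto
  obtain W F where F: "open W" "\<phi> x \<in> W" "\<And>k. Ck_on k W F"
      "\<And>u. u \<in> W \<inter> \<phi> ` (U \<inter> U') \<Longrightarrow> F u = (\<phi>' \<circ> inv_into U \<phi>) u"
    using assms(1) z(2) unfolding smooth_transition_def case_prod_conv smooth_on_def by (metis imageI)
  obtain X H where H: "open X" "\<psi> y \<in> X" "\<And>k. Ck_on k X H"
      "\<And>u. u \<in> X \<inter> \<psi> ` (V \<inter> V') \<Longrightarrow> H u = (\<psi>' \<circ> inv_into V \<psi>) u"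
    using assms(2) z(3) unfolding smooth_transition_def case_prod_conv smooth_on_def by (metis imageI)
  have op: "open (W \<times> X)"
    using F(1) H(1) by (rule open_Times)
  have "Ck_on k (W \<times> X) (\<lambda>u. F (fst u))" for k
    by (rule Ck_on_compose[OF op F(1) _ Ck_on_bounded_linear[OF bounded_linear_fst op Ck_on_ident[OF op]] F(3)]) auto
  moreover have "Ck_on k (W \<times> X) (\<lambda>u. H (snd u))" for k
    by (rule Ck_on_compose[OF op H(1) _ Ck_on_bounded_linear[OF bounded_linear_snd op Ck_on_ident[OF op]] H(3)]) auto
  ultimately have "\<forall>k. Ck_on k (W \<times> X) (\<lambda>u. (F (fst u), H (snd u)))"
    using Ck_on_Pair[OF op] by blast
  moreover have "(F (fst u), H (snd u)) = (map_prod \<phi>' \<psi>' \<circ> inv_into (U \<times> V) (map_prod \<phi> \<psi>)) u"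
    if uWX: "u \<in> W \<times> X \<inter> map_prod \<phi> \<psi> ` (U \<times> V \<inter> U' \<times> V')" for u
  proof -
    obtain a b where u: "u = map_prod \<phi> \<psi> (a, b)" "a \<in> U \<inter> U'" "b \<in> V \<inter> V'"
      using uWX by auto
    have "inj_on (map_prod \<phi> \<psi>) (U \<times> V)"
      using inj by (auto simp: inj_on_def)
    then have "inv_into (U \<times> V) (map_prod \<phi> \<psi>) u = (a, b)"
      unfolding u(1) by (intro inv_into_f_f) (use u in auto)
    moreover have "F (\<phi> a) = \<phi>' a" "H (\<psi> b) = \<psi>' b"
      using F(4)[of "\<phi> a"] H(4)[of "\<psi> b"] uWX u inj by (auto simp: inv_into_f_f)
    ultimately show ?thesis
      using u by simp
  qed
  ultimately show "\<exists>W F. open W \<and> z \<in> W \<and> (\<forall>k. Ck_on k W F) \<and>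
      (\<forall>y\<in>W \<inter> map_prod \<phi> \<psi> ` (U \<times> V \<inter> U' \<times> V').
        F y = (map_prod \<phi>' \<psi>' \<circ> inv_into (U \<times> V) (map_prod \<phi> \<psi>)) y)"
    using op F(2) H(2) z(1) by (intro exI[of _ "W \<times> X"] exI[of _ "\<lambda>u. (F (fst u), H (snd u))"]) auto
qed

lemma global_prod_atlas:
  assumes A: "global_atlas A" and B: "global_atlas B"
  shows "global_atlas (prod_atlas A B)"
proof -
  obtain n m where n: "smooth_manifold n A" and m: "smooth_manifold m B"
    using A B by (auto simp: global_atlas_def)
  have car: "atlas_carrier A = UNIV" "atlas_carrier B = UNIV"
    using A B by (auto simp: global_atlas_def)
  have inj: "inj_on \<phi> U" if "(U, \<phi>) \<in> A" for U \<phi>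
    using maximal_chart(2)[OF car(1)] atlas_subset_maximal[OF n] that by blast
  have inj': "inj_on \<phi> U" if "(U, \<phi>) \<in> B" for U \<phi>
    using maximal_chart(2)[OF car(2)] atlas_subset_maximal[OF m] that by blast
  have "local_chart (n + m) UNIV e" if "e \<in> prod_atlas A B" for e
    using that n m local_chart_prod by (fastforce simp: prod_atlas_def smooth_manifold_def car)
  moreover have "smooth_transition e e'" if e: "e \<in> prod_atlas A B" "e' \<in> prod_atlas A B" for e e'
  proof -
    obtain U \<phi> V \<psi> where 1: "e = (U \<times> V, map_prod \<phi> \<psi>)" "(U, \<phi>) \<in> A" "(V, \<psi>) \<in> B"
      using e(1) by (auto simp: prod_atlas_def)
    obtain U' \<phi>' V' \<psi>' where 2: "e' = (U' \<times> V', map_prod \<phi>' \<psi>')" "(U', \<phi>') \<in> A" "(V', \<psi>') \<in> B"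
      using e(2) by (auto simp: prod_atlas_def)
    show ?thesis
      unfolding 1(1) 2(1) using n m 1 2
      by (intro smooth_transition_prod inj[OF 1(2)] inj'[OF 1(3)]) (auto simp: smooth_manifold_def)
  qed
  ultimately have "smooth_manifold (n + m) (prod_atlas A B)"
    by (simp add: smooth_manifold_def prod_atlas_carrier car)
  then show ?thesis
    by (auto simp: global_atlas_def prod_atlas_carrier car)
qed

lemma prod_chart_at:
  assumes A: "global_atlas A" and B: "global_atlas B"
  obtains U \<phi> V \<psi> where "(U, \<phi>) \<in> maximal_atlas A" "p \<in> U" "(V, \<psi>) \<in> maximal_atlas B" "q \<in> V"
    "(U \<times> V, map_prod \<phi> \<psi>) \<in> maximal_atlas (prod_atlas A B)"
proof -
  obtain U \<phi> where 1: "(U, \<phi>) \<in> A" "(U, \<phi>) \<in> maximal_atlas A" "p \<in> U"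
    using chart_at[OF A] .
  obtain V \<psi> where 2: "(V, \<psi>) \<in> B" "(V, \<psi>) \<in> maximal_atlas B" "q \<in> V"
    using chart_at[OF B] .
  have "(U \<times> V, map_prod \<phi> \<psi>) \<in> maximal_atlas (prod_atlas A B)"
    using global_prod_atlas[OF A B] prod_chart[OF 1(1) 2(1)] by (auto simp: global_atlas_def dest: atlas_subset_maximal)
  then show ?thesis
    using that 1 2 by blast
qed

lemma smooth_at_Pair:
  assumes A: "global_atlas A" and B: "global_atlas B" and C: "global_atlas C"
    and f: "smooth_at C A f p" and g: "smooth_at C B g p"
  shows "smooth_at C (prod_atlas A B) (\<lambda>x. (f x, g x)) p"
proof -
  obtain U \<phi> V \<psi> where c: "(U, \<phi>) \<in> maximal_atlas A" "f p \<in> U" and d: "(V, \<psi>) \<in> maximal_atlas B" "g p \<in> V"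
    and cd: "(U \<times> V, map_prod \<phi> \<psi>) \<in> maximal_atlas (prod_atlas A B)"
    using prod_chart_at[OF A B] .
  obtain W \<theta> where e: "(W, \<theta>) \<in> maximal_atlas C" "p \<in> W"
    using chart_at[OF C] .
  have F: "filterlim f (nhds (f p)) (nhds p)" "smooth_via \<theta> (\<lambda>x. \<phi> (f x)) p"
    using f smooth_at_iff[where f = f, OF C A e c] by auto
  have G: "filterlim g (nhds (g p)) (nhds p)" "smooth_via \<theta> (\<lambda>x. \<psi> (g x)) p"
    using g smooth_at_iff[where f = g, OF C B e d] by auto
  show ?thesis
    using smooth_at_iff[where f = "\<lambda>x. (f x, g x)", OF C global_prod_atlas[OF A B] e cd]
      tendsto_Pair[OF F(1) G(1)] smooth_via_Pair[OF F(2) G(2)] c d by simp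
qed

lemma smooth_at_const:
  assumes C: "global_atlas C" and A: "global_atlas A"
  shows "smooth_at C A (\<lambda>x. a) p"
proof -
  obtain W \<theta> where e: "(W, \<theta>) \<in> maximal_atlas C" "p \<in> W"
    using chart_at[OF C] .
  obtain U \<phi> where c: "(U, \<phi>) \<in> maximal_atlas A" "a \<in> U"
    using chart_at[OF A] .
  show ?thesis
    using smooth_at_iff[where f = "\<lambda>x. a", OF C A e c] smooth_via_const by (simp add: tendsto_const)
qed

lemma smooth_at_ident:
  assumes A: "global_atlas A"
  shows "smooth_at A A (\<lambda>x. x) p"
proof -
  obtain U \<phi> where c: "(U, \<phi>) \<in> maximal_atlas A" "p \<in> U"
    using chart_at[OF A] .
  show ?thesis
    using smooth_at_iff[where f = "\<lambda>x. x", OF A A c c] smooth_via_refl[of \<phi> p] by (simp add: filterlim_ident)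
qed

lemma smooth_at_fst:
  assumes A: "global_atlas A" and B: "global_atlas B"
  shows "smooth_at (prod_atlas A B) A fst z"
proof -
  obtain U \<phi> V \<psi> where c: "(U, \<phi>) \<in> maximal_atlas A" "fst z \<in> U" and d: "(V, \<psi>) \<in> maximal_atlas B" "snd z \<in> V"
    and cd: "(U \<times> V, map_prod \<phi> \<psi>) \<in> maximal_atlas (prod_atlas A B)"
    using prod_chart_at[OF A B] .
  have z: "z \<in> U \<times> V"
    using c d by (simp add: mem_Times_iff)
  have "smooth_via (map_prod \<phi> \<psi>) (\<lambda>z. \<phi> (fst z)) z"
    using smooth_via_bounded_linear[OF bounded_linear_fst, of "map_prod \<phi> \<psi>"] by simp
  then show ?thesis
    using smooth_at_iff[where f = fst, OF global_prod_atlas[OF A B] A cd z c] tendsto_fst[OF filterlim_ident, of z] by simp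
qed

lemma smooth_at_snd:
  assumes A: "global_atlas A" and B: "global_atlas B"
  shows "smooth_at (prod_atlas A B) B snd z"
proof -
  obtain U \<phi> V \<psi> where c: "(U, \<phi>) \<in> maximal_atlas A" "fst z \<in> U" and d: "(V, \<psi>) \<in> maximal_atlas B" "snd z \<in> V"
    and cd: "(U \<times> V, map_prod \<phi> \<psi>) \<in> maximal_atlas (prod_atlas A B)"
    using prod_chart_at[OF A B] .
  have z: "z \<in> U \<times> V"
    using c d by (simp add: mem_Times_iff)
  have "smooth_via (map_prod \<phi> \<psi>) (\<lambda>z. \<psi> (snd z)) z"
    using smooth_via_bounded_linear[OF bounded_linear_snd, of "map_prod \<phi> \<psi>"] by simp
  then show ?thesis
    using smooth_at_iff[where f = snd, OF global_prod_atlas[OF A B] B cd z d] tendsto_snd[OF filterlim_ident, of z] by simp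
qed

lemma smooth_at_plus:
  assumes A: "global_atlas A" and f: "smooth_at A euclidean_atlas f p" and g: "smooth_at A euclidean_atlas g p"
  shows "smooth_at A euclidean_atlas (\<lambda>x. f x + g x) p"
proof -
  obtain U \<phi> where c: "(U, \<phi>) \<in> maximal_atlas A" "p \<in> U"
    using chart_at[OF A] .
  show ?thesis
    using f g smooth_via_add unfolding smooth_at_euclidean_iff[OF A c] by blast
qed

lemma smooth_curve_in_Pair:
  assumes A: "global_atlas A" and B: "global_atlas B"
    and x: "smooth_curve_in A S p x" and y: "smooth_curve_in B T q y"
  shows "smooth_curve_in (prod_atlas A B) (S \<times> T) (p, q) (\<lambda>t. (x t, y t))"
proof (rule smooth_curve_inI)
  show "(x 0, y 0) = (p, q)"
    using x y by (simp add: smooth_curve_in_def)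
  show "\<forall>\<^sub>F t in nhds 0. (x t, y t) \<in> S \<times> T \<and> smooth_at euclidean_atlas (prod_atlas A B) (\<lambda>t. (x t, y t)) t"
    using smooth_curve_in_eventually[OF x] smooth_curve_in_eventually[OF y]
      smooth_curve_in_smooth_eventually[OF x] smooth_curve_in_smooth_eventually[OF y]
    by eventually_elim (simp add: smooth_at_Pair[OF A B global_euclidean])
qed

text \<open>In product coordinates the velocity is a pair, hence the sum of its two partial velocities.\<close>

lemma velocity_Pair:
  assumes A: "global_atlas A" and B: "global_atlas B"
    and x: "smooth_at euclidean_atlas A x 0" "x 0 = p" and y: "smooth_at euclidean_atlas B y 0" "y 0 = q"
  shows "velocity (prod_atlas A B) (\<lambda>t. (x t, y t)) =
    velocity (prod_atlas A B) (\<lambda>t. (x t, q)) + velocity (prod_atlas A B) (\<lambda>t. (p, y t))"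
proof -
  obtain U \<phi> V \<psi> where c: "(U, \<phi>) \<in> maximal_atlas A" "p \<in> U" and d: "(V, \<psi>) \<in> maximal_atlas B" "q \<in> V"
    and cd: "(U \<times> V, map_prod \<phi> \<psi>) \<in> maximal_atlas (prod_atlas A B)"
    using prod_chart_at[OF A B] .
  note X = chart_curve_derivative[OF A c(1) _ x(1), unfolded x(2), OF c(2)]
  note Y = chart_curve_derivative[OF B d(1) _ y(1), unfolded y(2), OF d(2)]
  note sm = smooth_at_Pair[OF A B global_euclidean]
  note co = smooth_at_const[OF global_euclidean]
  have "velocity (prod_atlas A B) (\<lambda>t. (x t, y t)) =
    1 *\<^sub>R velocity (prod_atlas A B) (\<lambda>t. (x t, q)) + 1 *\<^sub>R velocity (prod_atlas A B) (\<lambda>t. (p, y t))"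
  proof (rule velocity_lincomb[OF global_prod_atlas[OF A B] cd])
    show "(p, q) \<in> U \<times> V"
      using c d by simp
    have "vector_derivative (\<lambda>t. (\<phi> (x t), \<psi> q)) (at 0) = (vector_derivative (\<lambda>t. \<phi> (x t)) (at 0), 0)"
      by (intro vector_derivative_at has_vector_derivative_Pair X has_vector_derivative_const)
    moreover have "vector_derivative (\<lambda>t. (\<phi> p, \<psi> (y t))) (at 0) = (0, vector_derivative (\<lambda>t. \<psi> (y t)) (at 0))"
      by (intro vector_derivative_at has_vector_derivative_Pair Y has_vector_derivative_const)
    moreover have "vector_derivative (\<lambda>t. (\<phi> (x t), \<psi> (y t))) (at 0) =
        (vector_derivative (\<lambda>t. \<phi> (x t)) (at 0), vector_derivative (\<lambda>t. \<psi> (y t)) (at 0))"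
      by (intro vector_derivative_at has_vector_derivative_Pair X Y)
    ultimately show "vector_derivative (\<lambda>t. map_prod \<phi> \<psi> (x t, y t)) (at 0) =
        1 *\<^sub>R vector_derivative (\<lambda>t. map_prod \<phi> \<psi> (x t, q)) (at 0) +
        1 *\<^sub>R vector_derivative (\<lambda>t. map_prod \<phi> \<psi> (p, y t)) (at 0)"
      by simp
  qed (simp_all add: x y sm co[OF A] co[OF B])
  then show ?thesis
    by simp
qed

text \<open>The curves may be chosen freely here, which is what makes \<open>pair_tangent\<close> usable for curves inside
  submanifolds and fibers.\<close>

lemma pair_tangent_velocity:
  assumes A: "global_atlas A" and B: "global_atlas B"
    and x: "smooth_curve_in A S p x" and y: "smooth_curve_in B T q y"
  shows "pair_tangent A B p q (velocity A x) (velocity B y) = velocity (prod_atlas A B) (\<lambda>t. (x t, y t))"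
proof -
  have car: "atlas_carrier A = UNIV" "atlas_carrier B = UNIV"
    using A B by (auto simp: global_atlas_def)
  have x': "smooth_curve_in A UNIV p x" and y': "smooth_curve_in B UNIV q y"
    using x y by (auto intro: smooth_curve_in_mono)
  note P = global_prod_atlas[OF A B]
  have 1: "smooth_along A UNIV (prod_atlas A B) (\<lambda>x. (x, q)) p"
    by (intro smooth_along_smooth_at A B P smooth_at_Pair smooth_at_ident smooth_at_const)
  have 2: "smooth_along B UNIV (prod_atlas A B) (\<lambda>y. (p, y)) q"
    by (intro smooth_along_smooth_at A B P smooth_at_Pair smooth_at_ident smooth_at_const)
  have 0: "x 0 = p" "y 0 = q"
    using x y by (auto simp: smooth_curve_in_def)
  show ?thesis
    unfolding pair_tangent_def car tangent_map_velocity[OF A 1 x'] tangent_map_velocity[OF B 2 y']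
    using velocity_Pair[OF A B smooth_curve_in_smooth[OF x] 0(1) smooth_curve_in_smooth[OF y] 0(2)] by simp
qed

section \<open>Submersions\<close>

text \<open>The coordinate functions themselves are smooth, so a velocity determines its coordinates.\<close>

lemma coordinate_velocity_eqI:
  assumes A: "global_atlas A" and c: "(U, \<phi>) \<in> maximal_atlas A" "p \<in> U"
    and x: "smooth_at euclidean_atlas A x 0" "x 0 = p" and y: "smooth_at euclidean_atlas A y 0" "y 0 = p"
    and eq: "velocity A x = velocity A y"
  shows "vector_derivative (\<lambda>t. \<phi> (x t)) (at 0) = vector_derivative (\<lambda>t. \<phi> (y t)) (at 0)"
proof (rule euclidean_eqI)
  fix b :: 'b assume "b \<in> Basis"
  have sm: "smooth_at A euclidean_atlas (\<lambda>z. \<phi> z \<bullet> b) p"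
    unfolding smooth_at_euclidean_iff[OF A c]
    by (rule smooth_via_bounded_linear[OF bounded_linear_inner_left])
  have "vector_derivative (\<lambda>t. \<phi> (z t)) (at 0) \<bullet> b = velocity A z (\<lambda>z. \<phi> z \<bullet> b)"
    if "smooth_at euclidean_atlas A z 0" "z 0 = p" for z
  proof -
    have "((\<lambda>t. \<phi> (z t) \<bullet> b) has_real_derivative vector_derivative (\<lambda>t. \<phi> (z t)) (at 0) \<bullet> b) (at 0)"
      using bounded_linear.has_vector_derivative[OF bounded_linear_inner_left
          chart_curve_derivative[OF A c(1) _ that(1)]] that(2) c(2)
      by (simp add: has_real_derivative_iff_has_vector_derivative)
    moreover have "((\<lambda>t. \<phi> (z t) \<bullet> b) has_real_derivative velocity A z (\<lambda>z. \<phi> z \<bullet> b)) (at 0)"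
      using velocity_apply[OF A that(1)] sm that(2) by simp
    ultimately show ?thesis
      by (rule DERIV_unique)
  qed
  then show "vector_derivative (\<lambda>t. \<phi> (x t)) (at 0) \<bullet> b = vector_derivative (\<lambda>t. \<phi> (y t)) (at 0) \<bullet> b"
    using x y eq by simp
qed

text \<open>In charts the fiber is a level set of the coordinate expression \<open>F\<close> inside the model space \<open>M\<close>, and
  surjectivity of the tangent map says that the derivative of \<open>F\<close> maps \<open>M\<close> onto the model space \<open>M'\<close> of the
  target. The level curve of \<open>F\<close> is carried back by the chart.\<close>

lemma submersion_kernel_curve:
  assumes A: "global_atlas A" and B: "global_atlas B" and sub: "submersion A B f"
    and v: "v \<in> tangent_space A UNIV p" and ker: "tangent_map A UNIV B f p v = 0"
  obtains y where "smooth_curve_in A {x. f x = f p} p y" "velocity A y = v"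
proof -
  have car: "atlas_carrier A = UNIV" "atlas_carrier B = UNIV"
    using A B by (auto simp: global_atlas_def)
  have f: "smooth_at A B f p"
    using sub by (simp add: submersion_def smooth_map_def car)
  obtain U \<phi> where c: "(U, \<phi>) \<in> maximal_atlas A" "p \<in> U"
    using chart_at[OF A] .
  obtain V \<psi> where d: "(V, \<psi>) \<in> maximal_atlas B" "f p \<in> V"
    using chart_at[OF B] .
  note C = maximal_chart[OF car(1) c(1)] and D' = maximal_chart[OF car(2) d(1)]
  obtain M where M: "adapted_chart A UNIV p U \<phi> M" "openin (top_of_set M) (\<phi> ` U)"
    using adapted_chart_UNIV[OF A c] .
  obtain M' where M': "adapted_chart B UNIV (f p) V \<psi> M'" "openin (top_of_set M') (\<psi> ` V)"
    using adapted_chart_UNIV[OF B d] .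
  have subM: "subspace M" "subspace M'" "\<phi> ` U \<subseteq> M" "\<psi> ` V \<subseteq> M'"
    using M M' by (auto simp: adapted_chart_def dest: openin_imp_subset)
  have f': "filterlim f (nhds (f p)) (nhds p)" "smooth_via \<phi> (\<lambda>x. \<psi> (f x)) p"
    using f smooth_at_iff[where f = f, OF A B c d] by auto
  from f'(2) obtain \<Omega> F where F: "open \<Omega>" "\<phi> p \<in> \<Omega>" "\<And>k. Ck_on k \<Omega> F"
      "\<forall>\<^sub>F y in nhds p. \<psi> (f y) = F (\<phi> y)"
    by (elim smooth_viaE) (rule that)
  have "\<forall>\<^sub>F y in nhds p. f y \<in> V"
    using eventually_compose_filterlim[OF D'(7)[OF d(2)] f'(1)] .
  with F(4) C(7)[OF c(2)] have "\<forall>\<^sub>F y in nhds p. \<psi> (f y) = F (\<phi> y) \<and> f y \<in> V \<and> y \<in> U"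
    by eventually_elim simp
  then obtain N where N: "open N" "p \<in> N" "\<And>y. y \<in> N \<Longrightarrow> \<psi> (f y) = F (\<phi> y) \<and> f y \<in> V \<and> y \<in> U"
    unfolding eventually_nhds by blast
  have "openin (top_of_set (\<phi> ` U)) (\<phi> ` U \<inter> inv_into U \<phi> -` N)"
    by (rule continuous_openin_preimage_gen[OF C(4) N(1)])
  then have "openin (top_of_set M) (\<phi> ` U \<inter> inv_into U \<phi> -` N)"
    using openin_trans M(2) by blast
  then obtain W' where W': "open W'" "\<phi> ` U \<inter> inv_into U \<phi> -` N = M \<inter> W'"
    by (auto simp: openin_open)
  \<comment> \<open>Inside \<open>W\<close>, points of the model space come from points of \<open>N\<close>, where \<open>F\<close> represents \<open>f\<close>.\<close>
  define W where "W = W' \<inter> \<Omega>"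
  have inv: "inv_into U \<phi> z \<in> N" "\<phi> (inv_into U \<phi> z) = z" if "z \<in> W \<inter> M" for z
  proof -
    have "z \<in> \<phi> ` U \<inter> inv_into U \<phi> -` N"
      using that unfolding W'(2) by (auto simp: W_def)
    then show "inv_into U \<phi> z \<in> N" "\<phi> (inv_into U \<phi> z) = z"
      by (auto simp: f_inv_into_f)
  qed
  have pM: "\<phi> p \<in> M"
    using c(2) subM by auto
  have "\<phi> p \<in> \<phi> ` U \<inter> inv_into U \<phi> -` N"
    using c(2) C(2) N(2) by (simp add: inv_into_f_f)
  then have pW: "\<phi> p \<in> W"
    using F(2) unfolding W'(2) by (simp add: W_def)
  have W: "open W"
    unfolding W_def using W'(1) F(1) by blast
  have FW: "Ck_on k W F" for k
    by (rule Ck_on_subset[OF F(3)]) (auto simp: W_def)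
  define D where "D = frechet_derivative F (at (\<phi> p))"
  have D: "(F has_derivative D) (at (\<phi> p))"
    unfolding D_def using Ck_on_Suc_has_derivative[OF F(3) F(2)] .
  have image: "vector_derivative (\<lambda>t. \<psi> (f (x t))) (at 0) = D (vector_derivative (\<lambda>t. \<phi> (x t)) (at 0))"
    if x: "smooth_curve_in A UNIV p x" for x
  proof -
    have x0: "x 0 = p"
      using x by (simp add: smooth_curve_in_def)
    define u where "u = vector_derivative (\<lambda>t. \<phi> (x t)) (at 0)"
    have "((\<lambda>t. \<phi> (x t)) has_vector_derivative u) (at 0)"
      unfolding u_def using chart_curve_derivative[OF A c(1) _ smooth_curve_in_smooth[OF x]] x0 c(2) by simp
    then have u: "((\<lambda>t. \<phi> (x t)) has_derivative (\<lambda>s. s *\<^sub>R u)) (at 0)"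
      by (simp add: has_vector_derivative_def)
    have "((\<lambda>t. F (\<phi> (x t))) has_derivative (\<lambda>s. D (s *\<^sub>R u))) (at 0)"
      by (rule has_derivative_compose[OF u]) (use D x0 in simp)
    then have der: "((\<lambda>t. F (\<phi> (x t))) has_vector_derivative D u) (at 0)"
      by (simp add: has_vector_derivative_def linear_cmul[OF has_derivative_linear[OF D]])
    have "\<forall>\<^sub>F t in nhds 0. x t \<in> N"
      by (rule topological_tendstoD[OF smooth_curve_in_continuous[OF A x] N(1,2)])
    then obtain T where T: "open T" "0 \<in> T" "\<And>t. t \<in> T \<Longrightarrow> x t \<in> N"
      unfolding eventually_nhds by blast
    have "((\<lambda>t. \<psi> (f (x t))) has_vector_derivative D u) (at 0)"
      by (rule has_vector_derivative_transform_within_open[OF der T(1,2)]) (use N(3) T(3) in simp)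
    then show ?thesis
      unfolding u_def by (rule vector_derivative_at)
  qed
  have along: "smooth_along A UNIV B f p"
    by (rule smooth_along_smooth_at[OF A B f])
  have smooth_image: "smooth_at euclidean_atlas B (\<lambda>t. f (x t)) 0 \<and> f (x 0) = f p"
    if x: "smooth_curve_in A UNIV p x" for x
    using smooth_at_compose[OF global_euclidean A B smooth_curve_in_smooth[OF x]] f x by (simp add: smooth_curve_in_def)
  have surj: "M' \<subseteq> D ` M"
  proof
    fix m assume "m \<in> M'"
    then obtain y where y: "smooth_curve_in B UNIV (f p) y" "vector_derivative (\<lambda>t. \<psi> (y t)) (at 0) = m"
      using straight_curve[OF B M'(1)] by metis
    have "velocity B y \<in> tangent_map A UNIV B f p ` tangent_space A UNIV p"
      using sub velocity_in_tangent_space[OF y(1)] by (simp add: submersion_def car)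
    then obtain x where x: "smooth_curve_in A UNIV p x" "velocity B y = tangent_map A UNIV B f p (velocity A x)"
      by (auto simp: tangent_space_def)
    then have "velocity B (\<lambda>t. f (x t)) = velocity B y"
      using tangent_map_velocity[OF A along x(1)] by simp
    then have "vector_derivative (\<lambda>t. \<psi> (f (x t))) (at 0) = m"
      using coordinate_velocity_eqI[OF B d, of "\<lambda>t. f (x t)" y] smooth_image[OF x(1)] smooth_curve_in_smooth[OF y(1)] y
      by (simp add: smooth_curve_in_def)
    then show "m \<in> D ` M"
      using image[OF x(1)] coordinate_velocity_in[OF A M(1) x(1)] by auto
  qed
  obtain x where x: "smooth_curve_in A UNIV p x" "velocity A x = v"
    using v by (rule tangent_spaceE)
  define w where "w = vector_derivative (\<lambda>t. \<phi> (x t)) (at 0)"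
  have w: "w \<in> M"
    unfolding w_def by (rule coordinate_velocity_in[OF A M(1) x(1)])
  have "velocity B (\<lambda>t. f (x t)) = 0"
    using ker tangent_map_velocity[OF A along x(1)] x(2) by simp
  moreover have "velocity B (\<lambda>t. f p) = 0"
    by (auto simp: velocity_def)
  ultimately have "vector_derivative (\<lambda>t. \<psi> (f (x t))) (at 0) = vector_derivative (\<lambda>t. \<psi> (f p)) (at (0::real))"
    using coordinate_velocity_eqI[OF B d, of "\<lambda>t. f (x t)" "\<lambda>t. f p"] smooth_image[OF x(1)]
      smooth_at_const[OF global_euclidean B, of "f p" "0::real"] by simp
  then have "D w = 0"
    using image[OF x(1)] unfolding w_def by (metis vector_derivative_const_at)
  have FM: "F z \<in> M'" if "z \<in> W \<inter> M" for z
    using N(3)[OF inv(1)[OF that]] inv(2)[OF that] subM(4) by auto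
  obtain J \<gamma> where J: "open J" "0 \<in> J" and \<gamma>: "\<And>k. Ck_on k J \<gamma>" "\<gamma> 0 = \<phi> p" "(\<gamma> has_vector_derivative w) (at 0)"
    "\<And>t. t \<in> J \<Longrightarrow> \<gamma> t \<in> W \<inter> M" "\<And>t. t \<in> J \<Longrightarrow> F (\<gamma> t) = F (\<phi> p)"
    using implicit_curve[OF W pW FW D subM(1) pM subM(2) FM surj w \<open>D w = 0\<close>] by metis
  define y where "y t = inv_into U \<phi> (\<gamma> t)" for t
  have yN: "y t \<in> N" "\<phi> (y t) = \<gamma> t" if "t \<in> J" for t
    using inv[OF \<gamma>(4)[OF that]] by (simp_all add: y_def)
  have img: "\<gamma> ` J \<subseteq> \<phi> ` U"
    using yN N(3) by (metis image_subsetI imageI)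
  have evJ: "\<forall>\<^sub>F t in nhds 0. t \<in> J"
    using J by (rule eventually_nhds_in_open)
  have y0: "y 0 = p"
    using C(2) c(2) by (simp add: y_def \<gamma>(2) inv_into_f_f)
  have yf: "f (y t) = f p" if "t \<in> J" for t
  proof -
    have "\<psi> (f (y t)) = \<psi> (f p)"
      using N(3)[OF yN(1)[OF that]] N(3)[OF N(2)] yN(2)[OF that] \<gamma>(5)[OF that] by simp
    then show ?thesis
      using inj_onD[OF D'(2)] N(3)[OF yN(1)[OF that]] d(2) by blast
  qed
  have ysm: "smooth_at euclidean_atlas A y t" if "t \<in> J" for t
    unfolding y_def by (rule smooth_curve_of_coordinates[OF A c(1) J(1) that \<gamma>(1) img])
  have curve: "smooth_curve_in A {x. f x = f p} p y"
  proof (rule smooth_curve_inI)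
    show "\<forall>\<^sub>F t in nhds 0. y t \<in> {x. f x = f p} \<and> smooth_at euclidean_atlas A y t"
      using evJ by eventually_elim (simp add: yf ysm)
  qed (rule y0)
  have "((\<lambda>t. \<phi> (y t)) has_vector_derivative w) (at 0)"
    by (rule has_vector_derivative_transform_within_open[OF \<gamma>(3) J]) (simp add: yN)
  then have "vector_derivative (\<lambda>t. \<phi> (y t)) (at 0) = w"
    by (rule vector_derivative_at)
  moreover have "x 0 = p" "smooth_at euclidean_atlas A x 0"
    using x(1) smooth_curve_in_smooth by (auto simp: smooth_curve_in_def)
  ultimately have "velocity A y = 1 *\<^sub>R velocity A x + 0 *\<^sub>R velocity A x"
    by (intro velocity_lincomb[OF A c]) (use ysm[OF J(2)] y0 w_def in auto)
  then show ?thesis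
    using that[OF curve] x(2) by simp
qed

section \<open>Maps defined on a submanifold\<close>

lemma induced_atlas_carrier:
  assumes "embedded_submanifold P S"
  shows "atlas_carrier (induced_atlas P S) = S"
proof
  show "S \<subseteq> atlas_carrier (induced_atlas P S)"
  proof
    fix p assume p: "p \<in> S"
    then obtain k U \<phi> where "(U, \<phi>) \<in> maximal_atlas P" "p \<in> U" "slice_chart k S (U, \<phi>)"
      using assms unfolding embedded_submanifold_def by fastforce
    then have "(U \<inter> S, \<phi>) \<in> induced_atlas P S"
      unfolding induced_atlas_def by blast
    then show "p \<in> atlas_carrier (induced_atlas P S)"
      unfolding atlas_carrier_def using \<open>p \<in> U\<close> p by (intro UN_I) auto
  qed
qed (auto simp: atlas_carrier_def induced_atlas_def)

text \<open>Smoothness in the induced atlas is local extendability in slice coordinates; composing the extension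
  with the ambient chart gives a smooth function \<open>K\<close> on an open set of the ambient manifold.\<close>

lemma smooth_at_induced_extension:
  assumes P: "global_atlas P" and B: "global_atlas B" and S: "embedded_submanifold P S"
    and f: "smooth_at (induced_atlas P S) B f z"
  obtains V \<psi> K where "(V, \<psi>) \<in> maximal_atlas B" "f z \<in> V" "smooth_at P euclidean_atlas K z"
    "\<forall>\<^sub>F x in nhds z. x \<in> S \<longrightarrow> f x \<in> V \<and> \<psi> (f x) = K x" "\<psi> (f z) = K z"
proof -
  have carP: "atlas_carrier P = UNIV"
    using P by (simp add: global_atlas_def)
  obtain U \<phi> V \<psi> W where c: "(U, \<phi>) \<in> maximal_atlas P" and d: "(V, \<psi>) \<in> B"
    and W: "openin (top_of_set S) W" "z \<in> W" "W \<subseteq> U \<inter> S" "f ` W \<subseteq> V"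
    and sm: "smooth_on (\<phi> ` W) (\<psi> \<circ> f \<circ> inv_into (U \<inter> S) \<phi>)"
    using f unfolding smooth_at_def induced_atlas_carrier[OF S] by (auto simp: induced_atlas_def)
  have zU: "z \<in> U"
    using W by auto
  note C = maximal_chart[OF carP c]
  obtain \<Omega> F where F: "open \<Omega>" "\<phi> z \<in> \<Omega>" "\<And>k. Ck_on k \<Omega> F"
      "\<And>u. u \<in> \<Omega> \<inter> \<phi> ` W \<Longrightarrow> F u = (\<psi> \<circ> f \<circ> inv_into (U \<inter> S) \<phi>) u"
    using sm W(2) unfolding smooth_on_def by (metis imageI)
  have ev\<Omega>: "\<forall>\<^sub>F x in nhds z. \<phi> x \<in> \<Omega>"
    by (rule topological_tendstoD[OF C(6)[OF zU] F(1,2)])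
  have K: "smooth_at P euclidean_atlas (\<lambda>x. F (\<phi> x)) z"
    unfolding smooth_at_euclidean_iff[OF P c zU] by (rule smooth_via_smooth[OF F(1,3) ev\<Omega>])
  obtain O' where O': "open O'" "W = S \<inter> O'"
    using W(1) by (auto simp: openin_open)
  have "\<forall>\<^sub>F x in nhds z. x \<in> O'"
    by (rule eventually_nhds_in_open[OF O'(1)]) (use O' W in auto)
  with ev\<Omega> have ev: "\<forall>\<^sub>F x in nhds z. x \<in> S \<longrightarrow> f x \<in> V \<and> \<psi> (f x) = F (\<phi> x)"
  proof eventually_elim
    case (elim x)
    show ?case
    proof
      assume "x \<in> S"
      then have x: "x \<in> W"
        using elim O' by auto
      have "inv_into (U \<inter> S) \<phi> (\<phi> x) = x"
        using x W(3) inj_on_subset[OF C(2), of "U \<inter> S"] by (intro inv_into_f_f) auto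
      then show "f x \<in> V \<and> \<psi> (f x) = F (\<phi> x)"
        using F(4)[of "\<phi> x"] elim x W(4) by auto
    qed
  qed
  have "(V, \<psi>) \<in> maximal_atlas B"
    using d B by (auto simp: global_atlas_def dest: atlas_subset_maximal)
  moreover have "z \<in> S"
    using W by auto
  ultimately show ?thesis
    using that[of V \<psi> "\<lambda>x. F (\<phi> x)"] K ev eventually_nhds_x_imp_x[OF ev] by auto
qed

text \<open>The extension of \<open>h \<circ> f\<close> is \<open>H \<circ> K\<close>, where \<open>h = H \<circ> \<psi>\<close> near \<open>f z\<close>. Since \<open>f\<close> is controlled through \<open>K\<close> only, the
  neighborhood of \<open>f z\<close> has to be pulled back along \<open>K\<close>.\<close>

lemma smooth_at_induced_along:
  assumes P: "global_atlas P" and B: "global_atlas B" and S: "embedded_submanifold P S"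
    and f: "smooth_at (induced_atlas P S) B f z"
  shows "smooth_along P S B f z"
  unfolding smooth_along_def
proof (intro allI impI)
  fix h :: "_ \<Rightarrow> real" assume h: "smooth_at B euclidean_atlas h (f z)"
  obtain V \<psi> K where d: "(V, \<psi>) \<in> maximal_atlas B" "f z \<in> V" and K: "smooth_at P euclidean_atlas K z"
    and ev: "\<forall>\<^sub>F x in nhds z. x \<in> S \<longrightarrow> f x \<in> V \<and> \<psi> (f x) = K x" and Kz: "\<psi> (f z) = K z"
    using smooth_at_induced_extension[OF P B S f] .
  have carB: "atlas_carrier B = UNIV"
    using B by (simp add: global_atlas_def)
  note D = maximal_chart[OF carB d(1)]
  have "smooth_via \<psi> h (f z)"
    using h smooth_at_euclidean_iff[OF B d] by blast
  then obtain \<Omega> H where H: "open \<Omega>" "\<psi> (f z) \<in> \<Omega>" "\<And>k. Ck_on k \<Omega> H" "\<forall>\<^sub>F y in nhds (f z). h y = H (\<psi> y)"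
    by (elim smooth_viaE) (rule that)
  obtain N where N: "open N" "f z \<in> N" "\<And>y. y \<in> N \<Longrightarrow> h y = H (\<psi> y)"
    using H(4) unfolding eventually_nhds by blast
  have "openin (top_of_set (\<psi> ` V)) (\<psi> ` V \<inter> inv_into V \<psi> -` N)"
    by (rule continuous_openin_preimage_gen[OF D(4) N(1)])
  then obtain O' where O': "open O'" "\<psi> ` V \<inter> inv_into V \<psi> -` N = \<psi> ` V \<inter> O'"
    by (auto simp: openin_open)
  have "\<psi> (f z) \<in> \<psi> ` V \<inter> inv_into V \<psi> -` N"
    using d(2) D(2) N(2) by (simp add: inv_into_f_f)
  then have KO: "K z \<in> O'"
    unfolding O'(2) Kz by simp
  have Kc: "filterlim K (nhds (K z)) (nhds z)"
    by (rule smooth_at_continuous[OF P global_euclidean K])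
  obtain U \<phi> where c: "(U, \<phi>) \<in> maximal_atlas P" "z \<in> U"
    using chart_at[OF P] .
  have "smooth_via \<phi> K z"
    using K smooth_at_euclidean_iff[OF P c] by blast
  moreover have "smooth_via K (\<lambda>x. H (K x)) z"
    by (rule smooth_via_smooth[OF H(1,3) topological_tendstoD[OF Kc H(1)]]) (use H(2) Kz in simp)
  ultimately have "smooth_at P euclidean_atlas (\<lambda>x. H (K x)) z"
    unfolding smooth_at_euclidean_iff[OF P c] by (rule smooth_via_trans)
  moreover have "\<forall>\<^sub>F x in nhds z. x \<in> S \<longrightarrow> h (f x) = H (K x)"
    using ev topological_tendstoD[OF Kc O'(1) KO]
  proof eventually_elim
    case (elim x)
    show ?case
    proof
      assume "x \<in> S"
      with elim have x: "f x \<in> V" "\<psi> (f x) = K x" "\<psi> (f x) \<in> O'"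
        by auto
      then have "\<psi> (f x) \<in> \<psi> ` V \<inter> inv_into V \<psi> -` N"
        unfolding O'(2) by blast
      then have "f x \<in> N"
        using x(1) D(2) by (simp add: inv_into_f_f)
      then show "h (f x) = H (K x)"
        using N(3) x(2) by metis
    qed
  qed
  ultimately show "\<exists>K. smooth_at P euclidean_atlas K z \<and> (\<forall>\<^sub>F x in nhds z. x \<in> S \<longrightarrow> h (f x) = K x)"
    by blast
qed

lemma smooth_at_induced_curve:
  assumes P: "global_atlas P" and B: "global_atlas B" and S: "embedded_submanifold P S"
    and f: "smooth_at (induced_atlas P S) B f (c t)" and c: "smooth_at euclidean_atlas P c t"
    and cS: "\<forall>\<^sub>F s in nhds t. c s \<in> S"
  shows "smooth_at euclidean_atlas B (\<lambda>s. f (c s)) t"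
proof -
  obtain V \<psi> K where d: "(V, \<psi>) \<in> maximal_atlas B" "f (c t) \<in> V" and K: "smooth_at P euclidean_atlas K (c t)"
    and ev: "\<forall>\<^sub>F x in nhds (c t). x \<in> S \<longrightarrow> f x \<in> V \<and> \<psi> (f x) = K x" and Kt: "\<psi> (f (c t)) = K (c t)"
    using smooth_at_induced_extension[OF P B S f] .
  have carB: "atlas_carrier B = UNIV"
    using B by (simp add: global_atlas_def)
  note D = maximal_chart[OF carB d(1)]
  have cont: "filterlim c (nhds (c t)) (nhds t)"
    by (rule smooth_at_continuous[OF global_euclidean P c])
  have "\<forall>\<^sub>F s in nhds t. c s \<in> S \<longrightarrow> f (c s) \<in> V \<and> \<psi> (f (c s)) = K (c s)"
    using eventually_compose_filterlim[OF ev cont] .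
  with cS have evc: "\<forall>\<^sub>F s in nhds t. f (c s) \<in> V \<and> \<psi> (f (c s)) = K (c s)"
    by eventually_elim simp
  have Kc: "smooth_at euclidean_atlas euclidean_atlas (\<lambda>s. K (c s)) t"
    by (rule smooth_at_compose[OF global_euclidean P global_euclidean c K])
  then have via: "smooth_via (\<lambda>x. x) (\<lambda>s. K (c s)) t"
    using smooth_at_euclidean_iff[OF global_euclidean euclidean_chart UNIV_I] by blast
  have lim: "((\<lambda>s. inv_into V \<psi> (K (c s))) \<longlongrightarrow> inv_into V \<psi> (K (c t))) (nhds t)"
  proof (rule continuous_on_tendsto_compose[OF D(4)])
    show "((\<lambda>s. K (c s)) \<longlongrightarrow> K (c t)) (nhds t)"
      by (rule smooth_at_continuous[OF global_euclidean global_euclidean Kc])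
    show "K (c t) \<in> \<psi> ` V"
      using d(2) Kt by (metis imageI)
    show "\<forall>\<^sub>F s in nhds t. K (c s) \<in> \<psi> ` V"
      using evc by eventually_elim (metis imageI)
  qed
  have "inv_into V \<psi> (K (c t)) = f (c t)"
    using inv_into_f_f[OF D(2) d(2)] Kt by simp
  moreover have "\<forall>\<^sub>F s in nhds t. inv_into V \<psi> (K (c s)) = f (c s)"
    using evc
  proof eventually_elim
    case (elim s)
    then show ?case
      using inv_into_f_f[OF D(2), of "f (c s)"] by simp
  qed
  ultimately have "((\<lambda>s. f (c s)) \<longlongrightarrow> f (c t)) (nhds t)"
    using lim by (simp cong: filterlim_cong)
  moreover have "smooth_via (\<lambda>x. x) (\<lambda>s. \<psi> (f (c s))) t"
    by (rule smooth_via_cong[OF via]) (use evc in \<open>auto elim: eventually_mono\<close>)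
  ultimately show ?thesis
    using smooth_at_curve_iff[where c = "\<lambda>s. f (c s)", OF B d] by simp
qed

lemma velocity_cong:
  assumes "\<forall>\<^sub>F t in nhds 0. x t = y t"
  shows "velocity A x = velocity A y"
proof
  fix h :: "'a \<Rightarrow> real"
  have "\<forall>\<^sub>F t in nhds 0. h (x t) = h (y t)"
    using assms by eventually_elim simp
  then have "deriv (\<lambda>t. h (x t)) 0 = deriv (\<lambda>t. h (y t)) 0"
    by (intro deriv_cong_ev) auto
  then show "velocity A x h = velocity A y h"
    using eventually_nhds_x_imp_x[OF assms] by (simp add: velocity_def)
qed

lemma velocity_const: "velocity A (\<lambda>t. a) = 0"
  by (auto simp: velocity_def)

section \<open>Translations in a Lie groupoid\<close>

context lie_groupoid
begin

lemma global_arrows: "global_atlas (arrow_atlas G)"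
  using arrow_manifold arrow_carrier by (simp add: global_atlas_def)

lemma global_objects: "global_atlas (object_atlas G)"
  using object_manifold object_carrier by (simp add: global_atlas_def)

abbreviation pairs_atlas where
  "pairs_atlas \<equiv> prod_atlas (arrow_atlas G) (arrow_atlas G)"

lemma global_pairs: "global_atlas pairs_atlas"
  by (rule global_prod_atlas[OF global_arrows global_arrows])

lemma smooth_at_mul:
  assumes "target G x = source G y"
  shows "smooth_at (induced_atlas pairs_atlas (composable G)) (arrow_atlas G) (\<lambda>(g, h). mul G g h) (x, y)"
  using mul_smooth assms
  unfolding smooth_map_def induced_atlas_carrier[OF composable_submanifold] by (auto simp: composable_def)

lemma mul_along:
  assumes "target G x = source G y"
  shows "smooth_along pairs_atlas (composable G) (arrow_atlas G) (\<lambda>(g, h). mul G g h) (x, y)"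
  by (rule smooth_at_induced_along[OF global_pairs global_arrows composable_submanifold smooth_at_mul[OF assms]])

lemma mul_curve:
  assumes x: "smooth_at euclidean_atlas (arrow_atlas G) x t" and y: "smooth_at euclidean_atlas (arrow_atlas G) y t"
    and xy: "\<forall>\<^sub>F s in nhds t. target G (x s) = source G (y s)"
  shows "smooth_at euclidean_atlas (arrow_atlas G) (\<lambda>s. mul G (x s) (y s)) t"
proof -
  have "smooth_at euclidean_atlas (arrow_atlas G) (\<lambda>s. (\<lambda>(g, h). mul G g h) (x s, y s)) t"
  proof (rule smooth_at_induced_curve[OF global_pairs global_arrows composable_submanifold])
    show "smooth_at (induced_atlas pairs_atlas (composable G)) (arrow_atlas G) (\<lambda>(g, h). mul G g h) (x t, y t)"
      by (rule smooth_at_mul[OF eventually_nhds_x_imp_x[OF xy]])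
    show "smooth_at euclidean_atlas pairs_atlas (\<lambda>s. (x s, y s)) t"
      by (rule smooth_at_Pair[OF global_arrows global_arrows global_euclidean x y])
    show "\<forall>\<^sub>F s in nhds t. (x s, y s) \<in> composable G"
      using xy by (simp add: composable_def)
  qed
  then show ?thesis
    by simp
qed

text \<open>Both translations arise from the multiplication by prescribing how the variable enters a composable
  pair.\<close>

lemma mul_after_along:
  assumes F: "smooth_at (arrow_atlas G) pairs_atlas F p" and comp: "target G (fst (F p)) = source G (snd (F p))"
    and S: "\<And>h. h \<in> S \<Longrightarrow> F h \<in> composable G"
  shows "smooth_along (arrow_atlas G) S (arrow_atlas G) (\<lambda>h. (\<lambda>(x, y). mul G x y) (F h)) p"
  unfolding smooth_along_def
proof (intro allI impI)
  fix k :: "'g \<Rightarrow> real" assume "smooth_at (arrow_atlas G) euclidean_atlas k ((\<lambda>(x, y). mul G x y) (F p))"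
  then obtain K where K: "smooth_at pairs_atlas euclidean_atlas K (F p)"
      "\<forall>\<^sub>F z in nhds (F p). z \<in> composable G \<longrightarrow> k ((\<lambda>(x, y). mul G x y) z) = K z"
    using mul_along[OF comp] unfolding smooth_along_def by auto
  have "smooth_at (arrow_atlas G) euclidean_atlas (\<lambda>h. K (F h)) p"
    by (rule smooth_at_compose[OF global_arrows global_pairs global_euclidean F K(1)])
  moreover have "\<forall>\<^sub>F h in nhds p. F h \<in> composable G \<longrightarrow> k ((\<lambda>(x, y). mul G x y) (F h)) = K (F h)"
    using eventually_compose_filterlim[OF K(2) smooth_at_continuous[OF global_arrows global_pairs F]] .
  then have "\<forall>\<^sub>F h in nhds p. h \<in> S \<longrightarrow> k ((\<lambda>(x, y). mul G x y) (F h)) = K (F h)"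
    by eventually_elim (simp add: S)
  ultimately show "\<exists>K. smooth_at (arrow_atlas G) euclidean_atlas K p \<and>
      (\<forall>\<^sub>F h in nhds p. h \<in> S \<longrightarrow> k ((\<lambda>(x, y). mul G x y) (F h)) = K h)"
    by blast
qed

lemma smooth_at_inversion: "smooth_at (arrow_atlas G) (arrow_atlas G) (inversion G) p"
  using inversion_smooth by (simp add: smooth_map_def arrow_carrier)

lemma smooth_at_source: "smooth_at (arrow_atlas G) (object_atlas G) (source G) p"
  using source_submersion by (simp add: submersion_def smooth_map_def arrow_carrier)

lemma smooth_at_target: "smooth_at (arrow_atlas G) (object_atlas G) (target G) p"
  using target_submersion by (simp add: submersion_def smooth_map_def arrow_carrier)

lemma left_along:
  assumes "target G g = q"
  shows "smooth_along (arrow_atlas G) (source_fiber G q) (arrow_atlas G) (\<lambda>h. mul G g h) (identity G q)"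
proof -
  have "smooth_along (arrow_atlas G) (source_fiber G q) (arrow_atlas G)
      (\<lambda>h. (\<lambda>(x, y). mul G x y) (g, h)) (identity G q)"
    by (intro mul_after_along smooth_at_Pair global_arrows smooth_at_const smooth_at_ident)
      (auto simp: source_identity composable_def source_fiber_def assms)
  then show ?thesis
    by simp
qed

lemma right_along:
  assumes "source G g = q"
  shows "smooth_along (arrow_atlas G) (source_fiber G q) (arrow_atlas G)
    (\<lambda>h. mul G (inversion G h) g) (identity G q)"
proof -
  have "smooth_along (arrow_atlas G) (source_fiber G q) (arrow_atlas G)
      (\<lambda>h. (\<lambda>(x, y). mul G x y) (inversion G h, g)) (identity G q)"
    by (intro mul_after_along smooth_at_Pair global_arrows smooth_at_const smooth_at_inversion)
      (auto simp: source_identity target_inversion composable_def source_fiber_def assms)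
  then show ?thesis
    by simp
qed

lemma inversion_identity: "inversion G (identity G q) = identity G q"
  using mul_identity[of "inversion G (identity G q)"] inversion_mul[of "identity G q"]
  by (simp add: target_inversion source_identity target_identity)

text \<open>The source map is a submersion, so elements of the algebroid fiber are velocities in the source fiber,
  where the translations are defined.\<close>

lemma algebroid_fiber_curve:
  assumes "v \<in> algebroid_fiber G q"
  obtains c where "smooth_curve_in (arrow_atlas G) (source_fiber G q) (identity G q) c"
    "velocity (arrow_atlas G) c = v"
  using submersion_kernel_curve[OF global_arrows global_objects source_submersion, of v "identity G q"] assms that
  by (auto simp: algebroid_fiber_def source_fiber_def source_identity)

lemma algebroid_fiber_tangent:
  "v \<in> algebroid_fiber G q \<Longrightarrow> v \<in> tangent_space (arrow_atlas G) (source_fiber G q) (identity G q)"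
  using algebroid_fiber_curve velocity_in_tangent_space by metis

lemma subspace_tangent_UNIV: "subspace (tangent_space (arrow_atlas G) UNIV p)"
proof -
  obtain U \<phi> where c: "(U, \<phi>) \<in> maximal_atlas (arrow_atlas G)" "p \<in> U"
    using chart_at[OF global_arrows] .
  obtain V where "adapted_chart (arrow_atlas G) UNIV p U \<phi> V"
    using adapted_chart_UNIV[OF global_arrows c] .
  then show ?thesis
    by (rule subspace_tangent_space[OF global_arrows])
qed

lemma algebroid_fiber_lincomb:
  assumes v: "v \<in> algebroid_fiber G q" and w: "w \<in> algebroid_fiber G q"
  shows "a *\<^sub>R v + b *\<^sub>R w \<in> algebroid_fiber G q"
proof -
  have T: "v \<in> tangent_space (arrow_atlas G) UNIV (identity G q)" "w \<in> tangent_space (arrow_atlas G) UNIV (identity G q)"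
    using v w by (auto simp: algebroid_fiber_def)
  then have vw: "a *\<^sub>R v + b *\<^sub>R w \<in> tangent_space (arrow_atlas G) UNIV (identity G q)"
    by (intro subspace_add subspace_scale subspace_tangent_UNIV)
  have "smooth_along (arrow_atlas G) UNIV (object_atlas G) (source G) (identity G q)"
    by (rule smooth_along_smooth_at[OF global_arrows global_objects smooth_at_source])
  from tangent_map_lincomb[OF global_arrows this T vw] show ?thesis
    using v w vw by (simp add: algebroid_fiber_def)
qed

lemma zero_in_algebroid_fiber: "0 \<in> algebroid_fiber G q"
proof -
  have 0: "0 \<in> tangent_space (arrow_atlas G) UNIV (identity G q)"
    by (rule subspace_0[OF subspace_tangent_UNIV])
  have "smooth_along (arrow_atlas G) UNIV (object_atlas G) (source G) (identity G q)"
    by (rule smooth_along_smooth_at[OF global_arrows global_objects smooth_at_source])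
  from tangent_map_lincomb[OF global_arrows this 0 0, of 0 0] show ?thesis
    using 0 by (simp add: algebroid_fiber_def)
qed

lemma left_vec_lincomb:
  assumes "v \<in> algebroid_fiber G (target G g)" "w \<in> algebroid_fiber G (target G g)"
  shows "left_vec G (a *\<^sub>R v + b *\<^sub>R w) g = a *\<^sub>R left_vec G v g + b *\<^sub>R left_vec G w g"
  unfolding left_vec_def
  by (intro tangent_map_lincomb global_arrows left_along refl algebroid_fiber_tangent algebroid_fiber_lincomb assms)

lemma right_vec_lincomb:
  assumes "v \<in> algebroid_fiber G (source G g)" "w \<in> algebroid_fiber G (source G g)"
  shows "right_vec G (a *\<^sub>R v + b *\<^sub>R w) g = a *\<^sub>R right_vec G v g + b *\<^sub>R right_vec G w g"
proof -
  have "tangent_map (arrow_atlas G) (source_fiber G (source G g)) (arrow_atlas G)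
      (\<lambda>h. mul G (inversion G h) g) (identity G (source G g)) (a *\<^sub>R v + b *\<^sub>R w) =
    a *\<^sub>R tangent_map (arrow_atlas G) (source_fiber G (source G g)) (arrow_atlas G)
      (\<lambda>h. mul G (inversion G h) g) (identity G (source G g)) v +
    b *\<^sub>R tangent_map (arrow_atlas G) (source_fiber G (source G g)) (arrow_atlas G)
      (\<lambda>h. mul G (inversion G h) g) (identity G (source G g)) w"
    by (intro tangent_map_lincomb global_arrows right_along refl algebroid_fiber_tangent algebroid_fiber_lincomb assms)
  then show ?thesis
    unfolding right_vec_def by (simp add: scaleR_minus_right)
qed

text \<open>All four claims are read off from the curve \<open>t \<mapsto> (g1 c(t), c(t)\<inverse> g2)\<close>: the inner endpoints of its two
  components are both \<open>target (c t)\<close>, and the inner factors cancel in the product. Its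
  second component has velocity minus the right vector, since that vector is defined with a minus sign.\<close>

lemma algebroid_variation:
  assumes comp: "target G g1 = source G g2" and v: "v \<in> algebroid_fiber G (target G g1)"
  shows "tangent_map (arrow_atlas G) UNIV (object_atlas G) (target G) g1 (left_vec G v g1) =
      tangent_map (arrow_atlas G) UNIV (object_atlas G) (source G) g2 (- right_vec G v g2)"
    and "tangent_map pairs_atlas (composable G) (arrow_atlas G) (\<lambda>(g, h). mul G g h) (g1, g2)
      (pair_tangent (arrow_atlas G) (arrow_atlas G) g1 g2 (left_vec G v g1) (- right_vec G v g2)) = 0"
    and "left_vec G v g1 \<in> tangent_space (arrow_atlas G) UNIV g1"
    and "right_vec G v g2 \<in> tangent_space (arrow_atlas G) UNIV g2"
proof -
  let ?q = "target G g1"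
  obtain c where c: "smooth_curve_in (arrow_atlas G) (source_fiber G ?q) (identity G ?q) c"
      "velocity (arrow_atlas G) c = v"
    using algebroid_fiber_curve[OF v] .
  define x where "x t = mul G g1 (c t)" for t
  define y where "y t = mul G (inversion G (c t)) g2" for t
  have c0: "c 0 = identity G ?q"
    using c(1) by (simp add: smooth_curve_in_def)
  have fib: "\<forall>\<^sub>F t in nhds 0. source G (c t) = ?q"
    using smooth_curve_in_eventually[OF c(1)] by (simp add: source_fiber_def)
  have evev: "\<forall>\<^sub>F t in nhds 0. \<forall>\<^sub>F s in nhds t. source G (c s) = ?q"
    using fib by (simp add: eventually_eventually)
  have sm: "\<forall>\<^sub>F t in nhds 0. smooth_at euclidean_atlas (arrow_atlas G) c t"
    by (rule smooth_curve_in_smooth_eventually[OF c(1)])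
  have x: "smooth_curve_in (arrow_atlas G) UNIV g1 x"
  proof (rule smooth_curve_inI)
    show "x 0 = g1"
      by (simp add: x_def c0 mul_identity)
    show "\<forall>\<^sub>F t in nhds 0. x t \<in> UNIV \<and> smooth_at euclidean_atlas (arrow_atlas G) x t"
      using sm evev
    proof eventually_elim
      case (elim t)
      have "smooth_at euclidean_atlas (arrow_atlas G) x t"
        unfolding x_def
        by (rule mul_curve[OF smooth_at_const[OF global_euclidean global_arrows] elim(1)])
          (use elim(2) in \<open>auto elim: eventually_mono\<close>)
      then show ?case
        by simp
    qed
  qed
  have y: "smooth_curve_in (arrow_atlas G) UNIV g2 y"
  proof (rule smooth_curve_inI)
    show "y 0 = g2"
      by (simp add: y_def c0 inversion_identity comp identity_mul)
    show "\<forall>\<^sub>F t in nhds 0. y t \<in> UNIV \<and> smooth_at euclidean_atlas (arrow_atlas G) y t"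
      using sm evev
    proof eventually_elim
      case (elim t)
      have "smooth_at euclidean_atlas (arrow_atlas G) (\<lambda>s. inversion G (c s)) t"
        by (rule smooth_at_compose[OF global_euclidean global_arrows global_arrows elim(1) smooth_at_inversion])
      then have "smooth_at euclidean_atlas (arrow_atlas G) y t"
        unfolding y_def
        by (rule mul_curve[OF _ smooth_at_const[OF global_euclidean global_arrows]])
          (use elim(2) comp in \<open>auto elim: eventually_mono simp: target_inversion\<close>)
      then show ?case
        by simp
    qed
  qed
  have vx: "left_vec G v g1 = velocity (arrow_atlas G) x"
    unfolding left_vec_def c(2)[symmetric] x_def[abs_def]
    by (rule tangent_map_velocity[OF global_arrows left_along[OF refl] c(1)])
  have vy: "- right_vec G v g2 = velocity (arrow_atlas G) y"
    using tangent_map_velocity[OF global_arrows right_along[OF refl, of g2], folded comp, OF c(1)]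
    by (simp add: right_vec_def c(2)[symmetric] y_def[abs_def] comp)
  show "left_vec G v g1 \<in> tangent_space (arrow_atlas G) UNIV g1"
    unfolding vx by (rule velocity_in_tangent_space[OF x])
  have "- right_vec G v g2 \<in> tangent_space (arrow_atlas G) UNIV g2"
    unfolding vy by (rule velocity_in_tangent_space[OF y])
  then show "right_vec G v g2 \<in> tangent_space (arrow_atlas G) UNIV g2"
    using subspace_neg[OF subspace_tangent_UNIV] by fastforce
  have tx: "\<forall>\<^sub>F t in nhds 0. target G (x t) = target G (c t)"
    using fib by eventually_elim (simp add: x_def target_mul)
  have ty: "\<forall>\<^sub>F t in nhds 0. source G (y t) = target G (c t)"
    using fib by eventually_elim (simp add: y_def source_mul target_inversion source_inversion comp)
  have tsxy: "\<forall>\<^sub>F t in nhds 0. target G (x t) = source G (y t)"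
    using tx ty by eventually_elim simp
  show "tangent_map (arrow_atlas G) UNIV (object_atlas G) (target G) g1 (left_vec G v g1) =
      tangent_map (arrow_atlas G) UNIV (object_atlas G) (source G) g2 (- right_vec G v g2)"
    unfolding vx vy
      tangent_map_velocity[OF global_arrows smooth_along_smooth_at[OF global_arrows global_objects smooth_at_target] x]
      tangent_map_velocity[OF global_arrows smooth_along_smooth_at[OF global_arrows global_objects smooth_at_source] y]
    by (rule velocity_cong[OF tsxy])
  have xy: "smooth_curve_in pairs_atlas (composable G) (g1, g2) (\<lambda>t. (x t, y t))"
  proof (rule smooth_curve_inI)
    have xy': "smooth_curve_in pairs_atlas (UNIV \<times> UNIV) (g1, g2) (\<lambda>t. (x t, y t))"
      by (rule smooth_curve_in_Pair[OF global_arrows global_arrows x y])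
    then show "(x 0, y 0) = (g1, g2)"
      by (simp add: smooth_curve_in_def)
    show "\<forall>\<^sub>F t in nhds 0. (x t, y t) \<in> composable G \<and> smooth_at euclidean_atlas pairs_atlas (\<lambda>t. (x t, y t)) t"
      using tsxy smooth_curve_in_smooth_eventually[OF xy'] by eventually_elim (simp add: composable_def)
  qed
  have "\<forall>\<^sub>F t in nhds 0. mul G (x t) (y t) = mul G g1 g2"
    using fib
  proof eventually_elim
    case (elim t)
    have "mul G (x t) (y t) = mul G g1 (mul G (c t) (mul G (inversion G (c t)) g2))"
      unfolding x_def y_def
      by (rule mul_assoc) (simp_all add: elim source_mul target_inversion source_inversion comp)
    also have "mul G (c t) (mul G (inversion G (c t)) g2) = mul G (mul G (c t) (inversion G (c t))) g2"
      by (rule mul_assoc[symmetric]) (simp_all add: elim source_inversion target_inversion comp)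
    also have "\<dots> = g2"
      by (simp add: mul_inversion elim comp identity_mul)
    finally show ?case .
  qed
  then have "velocity (arrow_atlas G) (\<lambda>t. mul G (x t) (y t)) = 0"
    using velocity_cong[of "\<lambda>t. mul G (x t) (y t)" "\<lambda>t. mul G g1 g2"] velocity_const by metis
  then show "tangent_map pairs_atlas (composable G) (arrow_atlas G) (\<lambda>(g, h). mul G g h) (g1, g2)
      (pair_tangent (arrow_atlas G) (arrow_atlas G) g1 g2 (left_vec G v g1) (- right_vec G v g2)) = 0"
    unfolding vx vy pair_tangent_velocity[OF global_arrows global_arrows x y]
      tangent_map_velocity[OF global_pairs mul_along[OF comp] xy] by simp
qed

end

section \<open>Multipliers\<close>

text \<open>The relation \<open>R\<close> is the graph of a linear functional on the subspace \<open>fst ` R\<close>. A linear left inverse of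
  \<open>fst\<close> on \<open>R\<close>, defined on the whole space, extends it.\<close>

lemma linear_functional_of_graph:
  fixes R :: "('v::real_vector \<times> real) set"
  assumes R: "subspace R" and zero: "\<And>a. (0, a) \<in> R \<Longrightarrow> a = 0"
  obtains \<Psi> where "linear \<Psi>" "\<And>x a. (x, a) \<in> R \<Longrightarrow> \<Psi> x = a"
proof -
  have "inj_on fst R"
  proof (rule inj_onI)
    fix z w assume zw: "z \<in> R" "w \<in> R" "fst z = fst w"
    then have "(0, snd z - snd w) \<in> R"
      using subspace_diff[OF R zw(1,2)] by (simp add: minus_prod_def)
    then show "z = w"
      using zero[of "snd z - snd w"] zw(3) by (simp add: prod_eq_iff)
  qed
  then obtain g where g: "linear g" "\<And>z. z \<in> R \<Longrightarrow> g (fst z) = z"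
    using linear_exists_left_inverse_on[OF linear_fst R] by auto
  have "linear (\<lambda>x. snd (g x))"
    using linear_compose[OF g(1) linear_snd] by (simp add: o_def)
  then show ?thesis
    using that[of "\<lambda>x. snd (g x)"] g(2) by force
qed

text \<open>The prescription \<open>(x + n1, y + n2) \<mapsto> l1 x + l2 y\<close> for \<open>(x, y) \<in> J\<close> and \<open>n1 \<in> T1\<close>, \<open>n2 \<in> T2\<close> is
  unambiguous exactly because the functional vanishes on \<open>J \<inter> T1 \<times> T2\<close>. Restricting an extension to the
  two factors gives the multipliers.\<close>

lemma lagrange_multipliers:
  fixes J :: "('v::real_vector \<times> 'w::real_vector) set"
  assumes J: "subspace J" and T1: "subspace T1" and T2: "subspace T2"
    and l1: "linear l1" and l2: "linear l2"
    and crit: "\<And>x y. (x, y) \<in> J \<Longrightarrow> x \<in> T1 \<Longrightarrow> y \<in> T2 \<Longrightarrow> l1 x + l2 y = (0::real)"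
  shows "\<exists>m1 m2. linear m1 \<and> linear m2 \<and> (\<forall>x\<in>T1. m1 x = (0::real)) \<and> (\<forall>y\<in>T2. m2 y = (0::real)) \<and>
    (\<forall>(x, y)\<in>J. l1 x + l2 y = m1 x + m2 y)"
proof -
  define f where "f = (\<lambda>((x, y), (n1, n2)). ((x + n1, y + n2), l1 x + l2 y))"
  have "linear f"
    unfolding f_def by (rule linearI)
      (auto simp: linear_add[OF l1] linear_add[OF l2] linear_cmul[OF l1] linear_cmul[OF l2] algebra_simps)
  then have sub: "subspace (f ` (J \<times> (T1 \<times> T2)))"
    by (intro linear_subspace_image subspace_Times J T1 T2)
  have inj: "a = 0" if a: "(0, a) \<in> f ` (J \<times> (T1 \<times> T2))" for a
  proof -
    obtain x y n1 n2 where *: "(x, y) \<in> J" "n1 \<in> T1" "n2 \<in> T2" "x + n1 = 0" "y + n2 = 0" "a = l1 x + l2 y"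
      using a by (auto simp: f_def zero_prod_def)
    then have "x = - n1" "y = - n2"
      by (auto simp: eq_neg_iff_add_eq_0)
    then have "x \<in> T1" "y \<in> T2"
      using * subspace_neg T1 T2 by auto
    then show ?thesis
      using crit *(1,6) by simp
  qed
  obtain \<Psi> where \<Psi>: "linear \<Psi>" "\<And>z a. (z, a) \<in> f ` (J \<times> (T1 \<times> T2)) \<Longrightarrow> \<Psi> z = a"
    using linear_functional_of_graph[OF sub inj] by metis
  have val: "\<Psi> (x + n1, y + n2) = l1 x + l2 y" if "(x, y) \<in> J" "n1 \<in> T1" "n2 \<in> T2" for x y n1 n2
    by (rule \<Psi>(2)) (use that in \<open>force simp: f_def\<close>)
  have z: "(0, 0) \<in> J" "0 \<in> T1" "0 \<in> T2"
    using subspace_0[OF J] subspace_0[OF T1] subspace_0[OF T2] by (simp_all add: zero_prod_def)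
  have split: "\<Psi> (x, y) = \<Psi> (x, 0) + \<Psi> (0, y)" for x y
    using linear_add[OF \<Psi>(1), of "(x, 0)" "(0, y)"] by simp
  show ?thesis
  proof (intro exI[of _ "\<lambda>x. \<Psi> (x, 0)"] exI[of _ "\<lambda>y. \<Psi> (0, y)"] conjI ballI)
    show "linear (\<lambda>x. \<Psi> (x, 0))"
      using linear_add[OF \<Psi>(1), of "(_, 0)" "(_, 0)"] linear_cmul[OF \<Psi>(1), of _ "(_, 0)"]
      by (intro linearI) auto
    show "linear (\<lambda>y. \<Psi> (0, y))"
      using linear_add[OF \<Psi>(1), of "(0, _)" "(0, _)"] linear_cmul[OF \<Psi>(1), of _ "(0, _)"]
      by (intro linearI) auto
    show "\<Psi> (x, 0) = 0" if "x \<in> T1" for x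
      using val[OF z(1) that z(3)] by (simp add: linear_0[OF l1] linear_0[OF l2])
    show "\<Psi> (0, y) = 0" if "y \<in> T2" for y
      using val[OF z(1) z(2) that] by (simp add: linear_0[OF l1] linear_0[OF l2])
    fix w assume "w \<in> J"
    then show "case w of (x, y) \<Rightarrow> l1 x + l2 y = \<Psi> (x, 0) + \<Psi> (0, y)"
      using val[of "fst w" "snd w", OF _ z(2,3)] split[of "fst w" "snd w"] by (simp add: case_prod_beta)
  qed
qed

text \<open>On \<open>N \<times> N\<close> the action sum agrees with the smooth function \<open>Lhat \<circ> fst + Lhat \<circ> snd\<close>, whose derivative
  depends on the velocity alone and not on the chosen representing curve.\<close>

lemma differential_action_sum:
  assumes A: "global_atlas A"
    and x: "smooth_curve_in A N p x" and y: "smooth_curve_in A N q y"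
    and sm: "smooth_at A euclidean_atlas Lhat p" "smooth_at A euclidean_atlas Lhat q"
    and eq: "\<And>h. h \<in> N \<Longrightarrow> Lhat h = L h"
  shows "differential (prod_atlas A A) (N \<times> N) (action_sum L) (p, q)
      (pair_tangent A A p q (velocity A x) (velocity A y)) = velocity A x Lhat + velocity A y Lhat"
proof -
  let ?P = "prod_atlas A A"
  note P = global_prod_atlas[OF A A]
  have xy: "smooth_curve_in ?P (N \<times> N) (p, q) (\<lambda>t. (x t, y t))"
    by (rule smooth_curve_in_Pair[OF A A x y])
  define v where "v = velocity ?P (\<lambda>t. (x t, y t))"
  have v: "v \<in> tangent_space ?P (N \<times> N) (p, q)"
    unfolding v_def by (rule velocity_in_tangent_space[OF xy])
  define r where "r = representing_curve ?P (N \<times> N) (p, q) v"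
  have r: "smooth_curve_in ?P (N \<times> N) (p, q) r" "velocity ?P r = v"
    unfolding r_def by (rule representing_curve[OF v])+
  define M where "M z = Lhat (fst z) + Lhat (snd z)" for z
  have start: "x 0 = p" "y 0 = q" "r 0 = (p, q)"
    using x y r by (auto simp: smooth_curve_in_def)
  have M: "smooth_at ?P euclidean_atlas M (p, q)"
    unfolding M_def
    by (intro smooth_at_plus P smooth_at_compose[OF P A global_euclidean smooth_at_fst[OF A A]]
        smooth_at_compose[OF P A global_euclidean smooth_at_snd[OF A A]]) (simp_all add: sm)
  have "\<forall>\<^sub>F t in nhds 0. action_sum L (r t) = M (r t)"
    using smooth_curve_in_eventually[OF r(1)]
  proof eventually_elim
    case (elim t)
    then show ?case
      using eq[of "fst (r t)"] eq[of "snd (r t)"] by (simp add: action_sum_def M_def case_prod_beta mem_Times_iff)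
  qed
  then have "deriv (\<lambda>t. action_sum L (r t)) 0 = deriv (\<lambda>t. M (r t)) 0"
    by (intro deriv_cong_ev) auto
  also have "\<dots> = v M"
    using velocity_apply[OF P smooth_curve_in_smooth[OF r(1)], of M] M r(2) start by (simp add: DERIV_imp_deriv)
  also have "\<dots> = velocity A x Lhat + velocity A y Lhat"
  proof (rule DERIV_unique)
    show "((\<lambda>t. M (x t, y t)) has_real_derivative v M) (at 0)"
      using velocity_apply[OF P smooth_curve_in_smooth[OF xy], of M] M start by (simp add: v_def)
    show "((\<lambda>t. M (x t, y t)) has_real_derivative velocity A x Lhat + velocity A y Lhat) (at 0)"
      unfolding M_def fst_conv snd_conv
      by (intro DERIV_add velocity_apply[OF A] smooth_curve_in_smooth[OF x] smooth_curve_in_smooth[OF y])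
        (simp_all add: start sm)
  qed
  finally show ?thesis
    unfolding differential_def pair_tangent_velocity[OF A A x y] v_def[symmetric] r_def[symmetric] .
qed

theorem mainTheorem6:
  fixes G :: "('g::{t2_space, second_countable_topology}, 'e::euclidean_space,
               'q::{t2_space, second_countable_topology}, 'f::euclidean_space) groupoid_data"
    and N U :: "'g set" and L Lhat :: "'g \<Rightarrow> real" and g g1 g2 :: 'g
  assumes system: "discrete_constrained_system G N L"
    and neighborhood: "open U" "N \<subseteq> U"
    and extension_smooth: "\<And>h. h \<in> U \<Longrightarrow> smooth_at (arrow_atlas G) euclidean_atlas Lhat h"
    and extension: "\<And>h. h \<in> N \<Longrightarrow> Lhat h = L h"
    and pairs_submanifold:
      "embedded_submanifold
         (prod_atlas (induced_atlas (arrow_atlas G) N) (induced_atlas (arrow_atlas G) N))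
         (composable G \<inter> N \<times> N)"
    and constant_rank:
      "constant_rank_near (prod_atlas (arrow_atlas G) (arrow_atlas G)) (composable G \<inter> N \<times> N)
         (arrow_atlas G) (\<lambda>(h1, h2). mul G h1 h2) (admissible_trajectories G N g)"
    and critical: "critical_point G N L g (g1, g2)"
  shows "\<exists>\<Lambda>1 \<in> conormal_space (arrow_atlas G) N g1. \<exists>\<Lambda>2 \<in> conormal_space (arrow_atlas G) N g2.
     \<forall>X \<in> algebroid_sections G.
       left_vf G X g1 Lhat + \<Lambda>1 (left_vf G X g1) = right_vf G X g2 Lhat + \<Lambda>2 (right_vf G X g2)"
proof -
  interpret discrete_constrained_system G N L
    by (rule system)
  let ?A = "arrow_atlas G"
  have traj: "target G g1 = source G g2" "g1 \<in> N" "g2 \<in> N"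
    using critical by (auto simp: critical_point_def admissible_trajectories_def composable_def)
  define F where "F = algebroid_fiber G (target G g1)"
  define J where "J = (\<lambda>v. (left_vec G v g1, - right_vec G v g2)) ` F"
  define T1 where "T1 = tangent_space ?A N g1"
  define T2 where "T2 = tangent_space ?A N g2"
  have T: "subspace T1" "subspace T2"
    unfolding T1_def T2_def
    using adapted_chart_submanifold[OF global_arrows constraint_submanifold] subspace_tangent_space[OF global_arrows]
      traj by metis+
  have "left_vec G (a *\<^sub>R v + b *\<^sub>R w) g1 = a *\<^sub>R left_vec G v g1 + b *\<^sub>R left_vec G w g1"
    "right_vec G (a *\<^sub>R v + b *\<^sub>R w) g2 = a *\<^sub>R right_vec G v g2 + b *\<^sub>R right_vec G w g2"
    "a *\<^sub>R v + b *\<^sub>R w \<in> F" if "v \<in> F" "w \<in> F" for v w a b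
    using that left_vec_lincomb[of v g1 w] right_vec_lincomb[of v g2 w] algebroid_fiber_lincomb[of v _ w]
    by (simp_all add: F_def traj)
  note lin = this
  have comb: "a *\<^sub>R z + b *\<^sub>R z' \<in> J" if zz': "z \<in> J" "z' \<in> J" for z z' a b
  proof -
    obtain v w where vw: "v \<in> F" "w \<in> F" "z = (left_vec G v g1, - right_vec G v g2)"
        "z' = (left_vec G w g1, - right_vec G w g2)"
      using zz' by (auto simp: J_def)
    have "a *\<^sub>R z + b *\<^sub>R z' = (left_vec G (a *\<^sub>R v + b *\<^sub>R w) g1, - right_vec G (a *\<^sub>R v + b *\<^sub>R w) g2)"
      using lin[OF vw(1,2)] vw(3,4) by simp
    then show ?thesis
      using lin(3)[OF vw(1,2)] unfolding J_def by blast
  qed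
  have "0 \<in> F"
    by (simp add: F_def zero_in_algebroid_fiber)
  then obtain z where "z \<in> J"
    unfolding J_def by blast
  have J: "subspace J"
    unfolding subspace_def using comb[OF \<open>z \<in> J\<close> \<open>z \<in> J\<close>, of 0 0] comb[of _ _ 1 1] comb[of _ _ _ 0] by force
  have crit: "x Lhat + y Lhat = 0" if xy: "(x, y) \<in> J" "x \<in> T1" "y \<in> T2" for x y
  proof -
    obtain v where v: "v \<in> F" "x = left_vec G v g1" "y = - right_vec G v g2"
      using xy(1) by (auto simp: J_def)
    have "(x, y) \<in> admissible_variations G N g1 g2"
      using xy(2,3) algebroid_variation(1,2)[OF traj(1) v(1)[unfolded F_def]]
      by (simp add: admissible_variations_def T1_def T2_def v(2,3))
    then have zero: "differential (prod_atlas ?A ?A) (N \<times> N) (action_sum L) (g1, g2)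
        (pair_tangent ?A ?A g1 g2 x y) = 0"
      using critical by (auto simp: critical_point_def)
    obtain c where c: "smooth_curve_in ?A N g1 c" "velocity ?A c = x"
      using xy(2) unfolding T1_def by (rule tangent_spaceE)
    obtain d where d: "smooth_curve_in ?A N g2 d" "velocity ?A d = y"
      using xy(3) unfolding T2_def by (rule tangent_spaceE)
    have "smooth_at ?A euclidean_atlas Lhat g1" "smooth_at ?A euclidean_atlas Lhat g2"
      using extension_smooth neighborhood traj by blast+
    from differential_action_sum[OF global_arrows c(1) d(1) this extension] zero
    show ?thesis
      by (simp add: c d)
  qed
  define l where "l x = x Lhat" for x :: "'g tangent_vector"
  have l: "linear l"
    unfolding l_def by (rule linearI) (simp_all add: scaleR_fun_def)
  have "\<exists>m1 m2. linear m1 \<and> linear m2 \<and> (\<forall>x\<in>T1. m1 x = 0) \<and> (\<forall>y\<in>T2. m2 y = 0) \<and>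
      (\<forall>(x, y)\<in>J. l x + l y = m1 x + m2 y)"
    by (rule lagrange_multipliers[OF J T l l]) (simp add: l_def crit)
  then obtain m1 m2 where m: "linear m1" "linear m2" "\<And>x. x \<in> T1 \<Longrightarrow> m1 x = 0" "\<And>y. y \<in> T2 \<Longrightarrow> m2 y = 0"
    "\<And>x y. (x, y) \<in> J \<Longrightarrow> l x + l y = m1 x + m2 y"
    by blast
  show ?thesis
  proof (intro bexI ballI)
    show "(\<lambda>x. - m1 x) \<in> conormal_space ?A N g1" "(\<lambda>y. - m2 y) \<in> conormal_space ?A N g2"
      using m(3,4) by (simp_all add: conormal_space_def cotangent_space_def T1_def T2_def linear_add[OF m(1)]
          linear_add[OF m(2)] linear_cmul[OF m(1)] linear_cmul[OF m(2)])
    fix X assume "X \<in> algebroid_sections G"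
    then have "X (target G g1) \<in> F"
      by (simp add: algebroid_sections_def F_def)
    then have "(left_vf G X g1, - right_vf G X g2) \<in> J"
      by (auto simp: J_def left_vf_def right_vf_def traj)
    from m(5)[OF this] show "left_vf G X g1 Lhat + - m1 (left_vf G X g1) = right_vf G X g2 Lhat + - m2 (right_vf G X g2)"
      by (simp add: l_def linear_neg[OF m(2)])
  qed
qed

end
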